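(* Let $\mu$ be a radially symmetric measure on $\mathbb{C}$ and let $\mathcal{X}$ be a determinantal process on $\mathbb{C}$ with kernel $$K(z,w)=\sum_{k=0}^{n-1}\lambda_k a_k^2\,(z\overline{w})^k$$ with respect to $\mu$, where $a_kz^k$, $0\le k\le n-1$, are the normalized eigenfunctions of $K$ in $L^2(\mathbb{C},\mu)$ (with $a_k>0$) and $\lambda_k\in[0,1]$ are the corresponding eigenvalues, with $\sum_k\lambda_k<\infty$ (here $n\in\{1,2,\dots\}\cup\{\infty\}$). Then the point process $\{|z|^2:z\in\mathcal{X}\}$ (points counted with multiplicity) has the distribution given by the following construction. 1. Let $Z$ be picked from the probability distribution $\mu/\mu(\mathbb{C})$, and let $Q_0=|Z|^2$. 2. For $1\le k\le n-1$ let $Q_k$ be an independent size-biased version of $Q_{k-1}$; that is, the random variables $Q_0,Q_1,\dots$ are independent and the law of $Q_k$ has density $f_k(q)=\frac{a_k^2}{a_{k-1}^2}\,q$ with respect to the law of $Q_{k-1}$. 3. Consider the point process in which each point $Q_k$, $0\le k\le n-1$, is included with probability $\lambda_k$, independently of everything else. Moreover, when $\mu$ has density $\varphi(|z|)$ with respect to Lebesgue measure on $\mathbb{C}$, then $Q_k$ has density $\pi a_k^2\,q^k\,\varphi(\sqrt{q})$ with respect to Lebesgue measure on $(0,\infty)$.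
   Context: A point process on $\mathbb{C}$ is a random integer-valued positive Radon measure $\mathcal{X}$; it is simple if almost surely it assigns measure at most $1$ to singletons (and is then identified with a random discrete set). The joint intensities of $\mathcal{X}$ with respect to a Radon measure $\mu$ are functions $\rho_k:\mathbb{C}^k\to[0,\infty)$, $k\ge1$, such that for mutually disjoint Borel sets $D_1,\dots,D_k$, $\mathbf{E}\big[\prod_{i=1}^k\mathcal{X}(D_i)\big]=\int_{D_1\times\cdots\times D_k}\rho_k\,d\mu^{k}$. The process is determinantal with kernel $K$ with respect to $\mu$ if it is simple and $\rho_k(x_1,\dots,x_k)=\det(K(x_i,x_j))_{1\le i,j\le k}$ for every $k\ge1$. The kernel acts by $f\mapsto\int_{\mathbb{C}}K(\cdot,w)f(w)\,d\mu(w)$ on $L^2(\mathbb{C},\mu)$. Radially symmetric means invariant under rotations about $0$. *)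

theory Defs
  imports
    "HOL-Probability.Probability"
    "Jordan_Normal_Form.Determinant"
begin

text \<open>
  On a Euclidean space every Borel measure that is finite on compact sets is regular,
  so local finiteness is all that has to be required of a Radon measure.
\<close>

definition radon_measure :: "'a::euclidean_space measure \<Rightarrow> bool" where
  "radon_measure \<mu> \<longleftrightarrow> sets \<mu> = sets borel \<and> (\<forall>C. compact C \<longrightarrow> emeasure \<mu> C < \<infinity>)"

text \<open>
  The space of all Borel measures with the \<open>\<sigma>\<close>-algebra generated by the evaluations
  \<open>N \<mapsto> N(D)\<close>, \<open>D\<close> Borel; compare \<open>subprob_algebra\<close>.
\<close>

definition measure_algebra :: "'a::topological_space measure measure" where
  "measure_algebra =
     (SUP D\<in>sets borel. vimage_algebra {N. sets N = sets borel} (\<lambda>N. emeasure N D) borel)"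

definition point_process :: "'w measure \<Rightarrow> ('w \<Rightarrow> 'a::euclidean_space measure) \<Rightarrow> bool" where
  "point_process M X \<longleftrightarrow>
     prob_space M \<and> X \<in> M \<rightarrow>\<^sub>M measure_algebra \<and>
     (AE \<omega> in M. radon_measure (X \<omega>) \<and> (\<forall>D\<in>sets borel. emeasure (X \<omega>) D \<in> \<nat> \<union> {\<infinity>}))"

definition point_process_law ::
    "'w measure \<Rightarrow> ('w \<Rightarrow> 'a::euclidean_space measure) \<Rightarrow> 'a measure measure" where
  "point_process_law M X = distr M measure_algebra X"

definition simple_process :: "'w measure \<Rightarrow> ('w \<Rightarrow> 'a::euclidean_space measure) \<Rightarrow> bool" where
  "simple_process M X \<longleftrightarrow> (AE \<omega> in M. \<forall>x. emeasure (X \<omega>) {x} \<le> 1)"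

text \<open>
  A point \<open>(x\<^sub>1, \<dots>, x\<^sub>k)\<close> is encoded as an extensional function on \<open>{..<k}\<close>.
\<close>

definition joint_intensities ::
    "'w measure \<Rightarrow> ('w \<Rightarrow> 'a::euclidean_space measure) \<Rightarrow> 'a measure \<Rightarrow>
     (nat \<Rightarrow> (nat \<Rightarrow> 'a) \<Rightarrow> real) \<Rightarrow> bool" where
  "joint_intensities M X \<mu> \<rho> \<longleftrightarrow>
     (\<forall>k\<ge>1.
        \<rho> k \<in> borel_measurable (\<Pi>\<^sub>M i\<in>{..<k}. \<mu>) \<and>
        (\<forall>x. 0 \<le> \<rho> k x) \<and>
        (\<forall>D. (\<forall>i<k. D i \<in> sets borel) \<longrightarrow> disjoint_family_on D {..<k} \<longrightarrow>
           (\<integral>\<^sup>+\<omega>. (\<Prod>i<k. emeasure (X \<omega>) (D i)) \<partial>M) =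
           (\<integral>\<^sup>+x\<in>(\<Pi>\<^sub>E i\<in>{..<k}. D i). ennreal (\<rho> k x) \<partial>(\<Pi>\<^sub>M i\<in>{..<k}. \<mu>))))"

text \<open>
  Joint intensities are determined only up to \<open>\<mu>\<^sup>k\<close>-null sets, so they are identified
  with the determinants almost everywhere.
\<close>

definition determinantal_process ::
    "'w measure \<Rightarrow> ('w \<Rightarrow> 'a::euclidean_space measure) \<Rightarrow> 'a measure \<Rightarrow>
     ('a \<Rightarrow> 'a \<Rightarrow> complex) \<Rightarrow> bool" where
  "determinantal_process M X \<mu> K \<longleftrightarrow>
     radon_measure \<mu> \<and> point_process M X \<and> simple_process M X \<and>
     (\<exists>\<rho>. joint_intensities M X \<mu> \<rho> \<and>
        (\<forall>k\<ge>1. AE x in (\<Pi>\<^sub>M i\<in>{..<k}. \<mu>).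
           complex_of_real (\<rho> k x) = Determinant.det (mat k k (\<lambda>(i, j). K (x i) (x j)))))"

definition radially_symmetric :: "complex measure \<Rightarrow> bool" where
  "radially_symmetric \<mu> \<longleftrightarrow> (\<forall>\<theta>. distr \<mu> borel (\<lambda>z. cis \<theta> * z) = \<mu>)"

definition normalized_eigenfunction ::
    "'a measure \<Rightarrow> ('a \<Rightarrow> 'a \<Rightarrow> complex) \<Rightarrow> complex \<Rightarrow> ('a \<Rightarrow> complex) \<Rightarrow> bool" where
  "normalized_eigenfunction \<mu> K c f \<longleftrightarrow>
     f \<in> borel_measurable \<mu> \<and>
     has_bochner_integral \<mu> (\<lambda>z. (cmod (f z))\<^sup>2) 1 \<and>
     (AE z in \<mu>. has_bochner_integral \<mu> (\<lambda>w. K z w * f w) (c * f z))"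

text \<open>
  For \<open>n = \<infinity>\<close> the series need not converge everywhere. When \<open>\<Sum>\<^sub>k lam k < \<infinity>\<close> and the functions
  \<open>a\<^sub>k z\<^sup>k\<close> have norm 1 in \<open>L\<^sup>2(\<mu>)\<close>, it converges absolutely for \<open>\<mu> \<otimes> \<mu>\<close>-almost all \<open>(z, w)\<close>;
  \<open>infsum\<close> is \<open>0\<close> where the series is not summable.
\<close>

definition radial_kernel ::
    "enat \<Rightarrow> (nat \<Rightarrow> real) \<Rightarrow> (nat \<Rightarrow> real) \<Rightarrow> complex \<Rightarrow> complex \<Rightarrow> complex" where
  "radial_kernel n lam a z w =
     (\<Sum>\<^sub>\<infinity>k\<in>{k. enat k < n}. complex_of_real (lam k * (a k)\<^sup>2) * (z * cnj w) ^ k)"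

text \<open>
  \<open>Q k\<close> is the \<open>k\<close>-th candidate point and \<open>B k\<close> is the event that it is included.
  The disjoint sum of index sets makes all the \<open>Q k\<close> and all the \<open>B k\<close> one mutually
  independent family.
\<close>

definition radial_construction ::
    "complex measure \<Rightarrow> enat \<Rightarrow> (nat \<Rightarrow> real) \<Rightarrow> (nat \<Rightarrow> real) \<Rightarrow>
     's measure \<Rightarrow> ('s \<Rightarrow> complex) \<Rightarrow> (nat \<Rightarrow> 's \<Rightarrow> real) \<Rightarrow> (nat \<Rightarrow> 's \<Rightarrow> bool) \<Rightarrow> bool" where
  "radial_construction \<mu> n lam a P Z Q B \<longleftrightarrow>
     prob_space P \<and>
     Z \<in> borel_measurable P \<and>
     distr P borel Z = scale_measure (1 / emeasure \<mu> UNIV) \<mu> \<and>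
     (\<forall>\<omega>\<in>space P. Q 0 \<omega> = (cmod (Z \<omega>))\<^sup>2) \<and>
     (\<forall>k. 1 \<le> k \<and> enat k < n \<longrightarrow>
        distr P borel (Q k) =
        density (distr P borel (Q (k - 1))) (\<lambda>q. ennreal ((a k)\<^sup>2 / (a (k - 1))\<^sup>2 * q))) \<and>
     (\<forall>k. enat k < n \<longrightarrow> measure P {\<omega> \<in> space P. B k \<omega>} = lam k) \<and>
     prob_space.indep_vars P (\<lambda>_. borel) (case_sum Q (\<lambda>k \<omega>. of_bool (B k \<omega>)))
       ({k. enat k < n} <+> {k. enat k < n})"

text \<open>The counting measure of the included points, with multiplicity.\<close>

definition thinned_process ::
    "enat \<Rightarrow> (nat \<Rightarrow> 's \<Rightarrow> real) \<Rightarrow> (nat \<Rightarrow> 's \<Rightarrow> bool) \<Rightarrow> 's \<Rightarrow> real measure" where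
  "thinned_process n Q B \<omega> = distr (count_space {k. enat k < n \<and> B k \<omega>}) borel (\<lambda>k. Q k \<omega>)"

end

theory Submission
  imports Defs
begin

text \<open>
  The monomials \<open>z ^ k\<close> are orthogonal not only in \<open>L\<^sup>2(\<mu>)\<close> but in \<open>L\<^sup>2\<close> of the restriction of
  \<open>\<mu>\<close> to every rotation invariant set (\<open>integral_monomial\<close>). Let \<open>A\<^sub>1, \<dots>, A\<^sub>k\<close> be preimages of
  Borel sets \<open>D\<^sub>1, \<dots>, D\<^sub>k\<close> under \<open>z \<mapsto> |z|\<^sup>2\<close>, and expand \<open>det (K(x\<^sub>i, x\<^sub>j))\<close> over permutations
  \<open>p\<close> and over the indices \<open>t\<^sub>i\<close> of the terms of the kernel. By orthogonality the integral of a
  term over \<open>A\<^sub>1 \<times> \<dots> \<times> A\<^sub>k\<close> vanishes unless \<open>t \<circ> p = t\<close>. What remains is the sum over \<open>t\<close> of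
  \<open>\<Prod>\<^sub>i lam(t\<^sub>i) P(Q\<^bsub>t\<^sub>i\<^esub> \<in> D\<^sub>i)\<close>, weighted by the signed number of permutations that fix \<open>t\<close>.
  That number is the determinant of the matrix with entries \<open>[t\<^sub>i = t\<^sub>j]\<close>, so it is \<open>1\<close> if \<open>t\<close> is
  injective and \<open>0\<close> otherwise (\<open>sum_sign_stabilizer\<close>, \<open>integral_det_truncated_kernel\<close>).

  The resulting sum over injective \<open>t\<close> is exactly the expected number of \<open>k\<close>-tuples of distinct
  included indices with \<open>Q\<^bsub>t\<^sub>i\<^esub> \<in> D\<^sub>i\<close> (\<open>factorial_moment_thinned\<close>), because the law of \<open>Q\<^sub>k\<close> is the
  image of \<open>a\<^sub>k\<^sup>2 |z|\<^sup>2\<^sup>k \<mu>\<close> under \<open>|z|\<^sup>2\<close>: the size biasing factors telescope (\<open>law_Q\<close>).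
  Hence the two processes on the line have the same factorial moments.
  These are at most \<open>(\<Sum>\<^sub>k lam(k)) ^ k\<close>, so they determine the joint law of the numbers of points in
  disjoint Borel sets by inclusion and exclusion, and therefore the law of the process
  (\<open>law_eqI_factorial_moments\<close>).

  Two points need care. Joint intensities only speak about disjoint sets, whereas factorial
  moments of \<open>X(A)\<close> count tuples inside one set; and \<open>|z|\<^sup>2\<close> need not be injective on the points
  of \<open>X\<close> (take \<open>\<mu>\<close> uniform on a circle), so multiplicities on the line are invisible to disjoint
  subsets of the line. Both are resolved on the plane, where \<open>X\<close> is simple: cutting it into ever
  finer cells separates the points of \<open>X\<close>, and tuples of distinct points are counted by
  tuples of distinct, hence disjoint, cells (\<open>factorial_moment_eq_integral_intensity\<close>). For
  \<open>n = \<infinity>\<close> the kernel is approximated by its partial sums, and dominated convergence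
  applies with the bound \<open>k! \<Prod>\<^sub>i K(x\<^sub>i, x\<^sub>i)\<close> (\<open>integral_intensity_eq_limit\<close>).
\<close>

section \<open>Counting injective tuples\<close>

text \<open>
  Injective tuples with prescribed labels are chosen one entry at a time: an entry labelled \<open>j\<close>
  must avoid the earlier entries with the same label and, the \<open>T j\<close> being disjoint, only those.
  So a class that is used \<open>k\<close> times contributes a falling factorial.
\<close>

lemma card_injective_tuples:
  fixes T :: "'j \<Rightarrow> 'b set" and c :: "'i \<Rightarrow> 'j"
  assumes "finite I" "finite J" and c: "c ` I \<subseteq> J"
    and disj: "disjoint_family_on T J" and fin: "\<And>j. j \<in> J \<Longrightarrow> finite (T j)"
  shows "card {x \<in> (\<Pi>\<^sub>E i\<in>I. T (c i)). inj_on x I} =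
         (\<Prod>j\<in>J. fact (card {i\<in>I. c i = j}) * (card (T j) choose card {i\<in>I. c i = j}))"
  using \<open>finite I\<close> c
proof (induction I rule: finite_induct)
  case empty
  then show ?case by simp
next
  case (insert i0 I)
  define S where "S = {x \<in> (\<Pi>\<^sub>E i\<in>I. T (c i)). inj_on x I}"
  define k where "k j = card {i\<in>I. c i = j}" for j
  have cI: "\<And>i. i \<in> I \<Longrightarrow> c i \<in> J" and c0: "c i0 \<in> J" using insert by auto
  have finS: "finite S"
    unfolding S_def using insert fin cI by (intro finite_subset[OF _ finite_PiE[of I "\<lambda>i. T (c i)"]]) auto
  have used: "x ` I \<inter> T (c i0) = x ` {i\<in>I. c i = c i0}" if "x \<in> S" for x
  proof -
    have "c i = c i0" if "i \<in> I" "x i \<in> T (c i0)" for i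
    proof (rule ccontr)
      assume "c i \<noteq> c i0"
      then have "T (c i) \<inter> T (c i0) = {}"
        using disj cI[OF \<open>i \<in> I\<close>] c0 by (auto simp: disjoint_family_on_def)
      then show False using \<open>x \<in> S\<close> that by (auto simp: S_def)
    qed
    then show ?thesis using \<open>x \<in> S\<close> by (auto simp: S_def PiE_iff)
  qed
  have cnt: "card (T (c i0) - x ` I) = card (T (c i0)) - k (c i0)" if "x \<in> S" for x
  proof -
    have "T (c i0) - x ` I = T (c i0) - x ` {i\<in>I. c i = c i0}" using used[OF that] by blast
    moreover have "x ` {i\<in>I. c i = c i0} \<subseteq> T (c i0)" using used[OF that] by blast
    moreover have "card (x ` {i\<in>I. c i = c i0}) = k (c i0)"
      unfolding k_def using that by (intro card_image) (auto simp: S_def inj_on_def)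
    ultimately show ?thesis
      using fin[OF c0] by (simp add: card_Diff_subset finite_subset)
  qed
  have bij: "bij_betw (\<lambda>(x, y). x(i0 := y)) (SIGMA x:S. T (c i0) - x ` I)
      {x \<in> (\<Pi>\<^sub>E i\<in>insert i0 I. T (c i)). inj_on x (insert i0 I)}"
  proof (rule bij_betwI[where g = "\<lambda>x. (restrict x I, x i0)"], goal_cases)
    case 1
    show ?case
    proof
      fix p assume "p \<in> (SIGMA x:S. T (c i0) - x ` I)"
      then obtain x y where p: "p = (x, y)" and x: "x \<in> S" and y: "y \<in> T (c i0)" "y \<notin> x ` I"
        by auto
      have "x(i0 := y) \<in> (\<Pi>\<^sub>E i\<in>insert i0 I. T (c i))"
        using x y by (auto simp: S_def PiE_iff extensional_def)
      moreover have "inj_on (x(i0 := y)) (insert i0 I)"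
        using x y insert(2) by (auto simp: S_def inj_on_def)
      ultimately show "(case p of (x, y) \<Rightarrow> x(i0 := y)) \<in>
          {x \<in> (\<Pi>\<^sub>E i\<in>insert i0 I. T (c i)). inj_on x (insert i0 I)}"
        by (simp add: p)
    qed
  next
    case 2
    show ?case using insert(2) by (auto simp: S_def inj_on_def PiE_iff)
  next
    case (3 x)
    then show ?case using insert(2)
      by (auto simp: S_def PiE_iff extensional_def restrict_def fun_eq_iff)
  next
    case (4 x)
    then show ?case
      by (auto simp: PiE_iff extensional_def restrict_def fun_eq_iff)
  qed
  have "card {x \<in> (\<Pi>\<^sub>E i\<in>insert i0 I. T (c i)). inj_on x (insert i0 I)} =
      (\<Sum>x\<in>S. card (T (c i0) - x ` I))"
    using bij_betw_same_card[OF bij] finS fin[OF c0] by (simp add: card_SigmaI)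
  also have "\<dots> = card S * (card (T (c i0)) - k (c i0))" using cnt by simp
  also have "card S = (\<Prod>j\<in>J. fact (k j) * (card (T j) choose k j))"
    using insert.IH insert.prems unfolding S_def k_def by simp
  also have "\<dots> * (card (T (c i0)) - k (c i0)) =
      (\<Prod>j\<in>J. fact (card {i\<in>insert i0 I. c i = j}) * (card (T j) choose card {i\<in>insert i0 I. c i = j}))"
  proof -
    have k': "card {i\<in>insert i0 I. c i = j} = (if j = c i0 then Suc (k j) else k j)" for j
    proof (cases "j = c i0")
      case True
      then have "{i\<in>insert i0 I. c i = j} = insert i0 {i\<in>I. c i = j}" by auto
      then show ?thesis using insert True by (simp add: k_def)
    next
      case False
      then have "{i\<in>insert i0 I. c i = j} = {i\<in>I. c i = j}" by auto
      then show ?thesis using False by (simp add: k_def)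
    qed
    have step: "fact (Suc m) * (N choose Suc m) = (fact m * (N choose m)) * (N - m)" for N m :: nat
    proof -
      have "Suc m * (N choose Suc m) = (N choose m) * (N - m)"
        by (metis binomial_absorb_comp binomial_absorption mult.commute)
      moreover have "fact (Suc m) * (N choose Suc m) = fact m * (Suc m * (N choose Suc m))"
        by (simp only: fact_Suc of_nat_id ac_simps)
      ultimately show ?thesis by (simp only: mult.assoc)
    qed
    define R where "R = (\<Prod>j\<in>J - {c i0}. fact (k j) * (card (T j) choose k j))"
    have R: "(\<Prod>j\<in>J - {c i0}. fact (if j = c i0 then Suc (k j) else k j) *
        (card (T j) choose (if j = c i0 then Suc (k j) else k j))) = R"
      unfolding R_def by (intro prod.cong) auto
    show ?thesis
      unfolding k' prod.remove[OF \<open>finite J\<close> c0] R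
      using step[of "k (c i0)" "card (T (c i0))"]
      by (simp add: R_def[symmetric] ac_simps del: fact_Suc)
  qed
  finally show ?case .
qed

text \<open>
  Every family of multiplicities is realised by a labelling, so products of factorial moments are
  reached by counting labelled tuples.
\<close>

lemma ex_labelling:
  fixes \<kappa> :: "'j \<Rightarrow> nat"
  assumes "finite J"
  obtains c :: "nat \<Rightarrow> 'j" where "c ` {..<sum \<kappa> J} \<subseteq> J"
    "\<And>j. j \<in> J \<Longrightarrow> card {i\<in>{..<sum \<kappa> J}. c i = j} = \<kappa> j"
proof -
  have fin: "finite (SIGMA j:J. {..<\<kappa> j})" using assms by auto
  have "card (SIGMA j:J. {..<\<kappa> j}) = sum \<kappa> J" using assms by simp
  with fin obtain h where h: "bij_betw h {..<sum \<kappa> J} (SIGMA j:J. {..<\<kappa> j})"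
    using ex_bij_betw_nat_finite by (metis atLeast0LessThan)
  show ?thesis
  proof (rule that[of "fst \<circ> h"])
    show "(fst \<circ> h) ` {..<sum \<kappa> J} \<subseteq> J"
    proof
      fix j assume "j \<in> (fst \<circ> h) ` {..<sum \<kappa> J}"
      then obtain i where "i \<in> {..<sum \<kappa> J}" "j = fst (h i)" by auto
      moreover from this have "h i \<in> (SIGMA j:J. {..<\<kappa> j})" using bij_betw_apply[OF h] by blast
      ultimately show "j \<in> J" by auto
    qed
    fix j assume "j \<in> J"
    have "inj_on h {..<sum \<kappa> J}" and im: "h ` {..<sum \<kappa> J} = (SIGMA j:J. {..<\<kappa> j})"
      using h by (auto simp: bij_betw_def)
    have "inj_on h {i\<in>{..<sum \<kappa> J}. (fst \<circ> h) i = j}"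
      using \<open>inj_on h {..<sum \<kappa> J}\<close> by (auto simp: inj_on_def)
    moreover have "h ` {i\<in>{..<sum \<kappa> J}. (fst \<circ> h) i = j} = {p \<in> h ` {..<sum \<kappa> J}. fst p = j}" by auto
    moreover have "{p \<in> h ` {..<sum \<kappa> J}. fst p = j} = {j} \<times> {..<\<kappa> j}"
      unfolding im using \<open>j \<in> J\<close> by auto
    ultimately have "bij_betw h {i\<in>{..<sum \<kappa> J}. (fst \<circ> h) i = j} ({j} \<times> {..<\<kappa> j})"
      by (simp add: bij_betw_def)
    then show "card {i\<in>{..<sum \<kappa> J}. (fst \<circ> h) i = j} = \<kappa> j"
      by (auto dest!: bij_betw_same_card)
  qed
qed

text \<open>
  The sum is the determinant of the matrix with entries \<open>[t i = t j]\<close>: the identity matrix if \<open>t\<close>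
  is injective, a matrix with two equal rows otherwise.
\<close>

lemma sum_sign_stabilizer:
  fixes t :: "nat \<Rightarrow> 'a"
  shows "(\<Sum>p | p permutes {0..<k}. signof p * (\<Prod>i=0..<k. of_bool (t i = t (p i)))) =
         (of_bool (inj_on t {..<k}) :: 'b :: {comm_ring_1})"
proof -
  define A :: "'b mat" where "A = mat k k (\<lambda>(i, j). of_bool (t i = t j))"
  have A: "A \<in> carrier_mat k k" by (simp add: A_def)
  have "(\<Sum>p | p permutes {0..<k}. signof p * (\<Prod>i=0..<k. of_bool (t i = t (p i)))) = Determinant.det A"
    unfolding Determinant.det_def A_def
    by (auto intro!: sum.cong prod.cong arg_cong2[where f = "(*)"] simp: permutes_in_image)
  also have "\<dots> = of_bool (inj_on t {..<k})"
  proof (cases "inj_on t {..<k}")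
    case True
    then have "A = 1\<^sub>m k" by (intro eq_matI) (auto simp: A_def inj_on_def)
    then show ?thesis using True by simp
  next
    case False
    then obtain i j where ij: "i < k" "j < k" "i \<noteq> j" "t i = t j" by (auto simp: inj_on_def)
    have "row A i = row A j" using ij by (intro eq_vecI) (auto simp: A_def)
    then have "Determinant.det A = 0" using det_identical_rows[OF A ij(3,1,2)] by simp
    then show ?thesis using False by simp
  qed
  finally show ?thesis .
qed

section \<open>Binomial moments determine the law of a vector of counts\<close>

text \<open>
  Binomial inversion, which recovers a point mass from binomial moments.
\<close>

lemma indicator_eq_sum_binomial:
  fixes N m :: nat
  shows "(\<Sum>k\<le>N. (-1) ^ (k + m) * real (k choose m) * real (N choose k)) = of_bool (N = m)"
proof -
  have zero: "(\<Sum>k\<le>N. (-1) ^ (k + m) * real (k choose m) * real (N choose k)) = 0" if "N < m"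
    using that by (intro sum.neutral) auto
  show ?thesis
  proof (cases "N < m")
    case False
    then have "m \<le> N" by simp
    have "(\<Sum>k\<le>N. (-1) ^ (k + m) * real (k choose m) * real (N choose k)) =
        (\<Sum>k\<in>{m..N}. (-1) ^ (k + m) * real (k choose m) * real (N choose k))"
      by (intro sum.mono_neutral_right) auto
    also have "\<dots> = (\<Sum>k\<in>{m..N}. (-1) ^ (k + m) * (real (N choose m) * real ((N - m) choose (k - m))))"
    proof (intro sum.cong refl)
      fix k assume "k \<in> {m..N}"
      then have "(N choose k) * (k choose m) = (N choose m) * ((N - m) choose (k - m))"
        by (intro choose_mult) auto
      then show "(-1) ^ (k + m) * real (k choose m) * real (N choose k) =
          (-1) ^ (k + m) * (real (N choose m) * real ((N - m) choose (k - m)))"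
        by (metis (no_types, lifting) mult.assoc mult.commute of_nat_mult)
    qed
    also have "\<dots> = (\<Sum>k\<le>N - m. (-1) ^ (k + m + m) * (real (N choose m) * real ((N - m) choose k)))"
      using \<open>m \<le> N\<close>
      by (intro sum.reindex_bij_witness[of _ "\<lambda>k. k + m" "\<lambda>k. k - m"]) auto
    also have "\<dots> = real (N choose m) * (\<Sum>k\<le>N - m. (-1) ^ k * real ((N - m) choose k))"
      by (simp add: sum_distrib_left mult_ac add.assoc power_add flip: power_mult_distrib)
    also have "(\<Sum>k\<le>N - m. (-1) ^ k * real ((N - m) choose k)) = of_bool (N - m = 0)"
      using choose_alternating_sum[of "N - m", where 'a = real] by (cases "N - m = 0") auto
    finally show ?thesis using \<open>m \<le> N\<close> by auto
  qed (use zero in simp)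
qed

lemma sum_binomial_le_4_power:
  fixes N m :: nat
  shows "(\<Sum>k\<le>N. real (k choose m) * real (N choose k)) \<le> 4 ^ N"
proof -
  have "(\<Sum>k\<le>N. real (k choose m) * real (N choose k)) \<le> (\<Sum>k\<le>N. 2 ^ N * real (N choose k))"
  proof (intro sum_mono mult_right_mono)
    fix k assume k: "k \<in> {..N}"
    have "k choose m \<le> 2 ^ k" by (rule binomial_le_pow2)
    also have "(2::nat) ^ k \<le> 2 ^ N" using k by (intro power_increasing) auto
    finally show "real (k choose m) \<le> 2 ^ N" by (metis of_nat_le_iff of_nat_numeral of_nat_power)
  qed auto
  also have "\<dots> = 2 ^ N * real (\<Sum>k\<le>N. N choose k)" by (simp add: sum_distrib_left)
  also have "\<dots> = 4 ^ N" by (simp only: choose_row_sum) (simp flip: power_mult_distrib)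
  finally show ?thesis .
qed

text \<open>
  Binomial inversion under the integral. The sum of the absolute values of the terms is at most
  \<open>4 ^ N * \<bar>Y\<bar>\<close>, which serves as dominating function; \<open>Y\<close> carries the factors that belong to the other
  coordinates of a vector of counts.
\<close>

lemma integral_of_bool_eq_suminf_binomial:
  fixes N :: "'w \<Rightarrow> nat" and Y :: "'w \<Rightarrow> real"
  assumes N [measurable]: "N \<in> M \<rightarrow>\<^sub>M count_space UNIV" and Y [measurable]: "Y \<in> borel_measurable M"
    and int: "integrable M (\<lambda>\<omega>. 4 ^ N \<omega> * \<bar>Y \<omega>\<bar>)"
  shows "(\<integral>\<omega>. of_bool (N \<omega> = m) * Y \<omega> \<partial>M) =
         (\<Sum>k. (-1) ^ (k + m) * real (k choose m) * (\<integral>\<omega>. real (N \<omega> choose k) * Y \<omega> \<partial>M))"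
proof -
  define f where "f = (\<lambda>k \<omega>. ((-1) ^ (k + m) * real (k choose m)) * (real (N \<omega> choose k) * Y \<omega>))"
  have zero: "f k \<omega> = 0" if "k \<notin> {..N \<omega>}" for k \<omega> using that by (simp add: f_def)
  have summ: "summable (\<lambda>k. norm (f k \<omega>))" for \<omega>
    by (rule summable_finite[of "{..N \<omega>}"]) (use zero in auto)
  have norm_sum: "(\<Sum>k. norm (f k \<omega>)) \<le> 4 ^ N \<omega> * \<bar>Y \<omega>\<bar>" for \<omega>
  proof -
    have "(\<Sum>k. norm (f k \<omega>)) = (\<Sum>k\<le>N \<omega>. norm (f k \<omega>))"
      by (rule suminf_finite) (use zero in auto)
    also have "\<dots> = (\<Sum>k\<le>N \<omega>. real (k choose m) * real (N \<omega> choose k)) * \<bar>Y \<omega>\<bar>"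
      by (simp add: f_def abs_mult sum_distrib_left sum_distrib_right mult_ac power_abs)
    also have "\<dots> \<le> 4 ^ N \<omega> * \<bar>Y \<omega>\<bar>"
      by (intro mult_right_mono sum_binomial_le_4_power) auto
    finally show ?thesis .
  qed
  have meas: "f k \<in> borel_measurable M" for k unfolding f_def by measurable
  have part: "(\<Sum>k<n. norm (f k \<omega>)) \<le> 4 ^ N \<omega> * \<bar>Y \<omega>\<bar>" for n \<omega>
    using sum_le_suminf[OF summ, of "{..<n}" \<omega>] norm_sum[of \<omega>] by force
  have lim: "(\<lambda>n. \<integral>\<omega>. (\<Sum>k<n. f k \<omega>) \<partial>M) \<longlonglongrightarrow> (\<integral>\<omega>. of_bool (N \<omega> = m) * Y \<omega> \<partial>M)"
  proof (rule integral_dominated_convergence[OF _ _ int])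
    show "(\<lambda>\<omega>. of_bool (N \<omega> = m) * Y \<omega>) \<in> borel_measurable M" by measurable
    show "(\<lambda>\<omega>. \<Sum>k<n. f k \<omega>) \<in> borel_measurable M" for n using meas by measurable
    show "AE \<omega> in M. (\<lambda>n. \<Sum>k<n. f k \<omega>) \<longlonglongrightarrow> of_bool (N \<omega> = m) * Y \<omega>"
    proof (rule AE_I2)
      fix \<omega>
      have "(\<lambda>k. f k \<omega>) sums (\<Sum>k\<le>N \<omega>. f k \<omega>)"
        by (rule sums_finite) (use zero in auto)
      moreover have "(\<Sum>k\<le>N \<omega>. f k \<omega>) = of_bool (N \<omega> = m) * Y \<omega>"
        unfolding f_def by (subst indicator_eq_sum_binomial[symmetric]) (simp add: sum_distrib_right mult.assoc)
      ultimately show "(\<lambda>n. \<Sum>k<n. f k \<omega>) \<longlonglongrightarrow> of_bool (N \<omega> = m) * Y \<omega>"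
        by (simp add: sums_def)
    qed
    show "AE \<omega> in M. norm (\<Sum>k<n. f k \<omega>) \<le> 4 ^ N \<omega> * \<bar>Y \<omega>\<bar>" for n
      using part by (intro AE_I2) (meson norm_sum order_trans sum_norm_le order_refl)
  qed
  have intf: "integrable M (f k)" for k
  proof (rule Bochner_Integration.integrable_bound[OF int meas])
    show "AE \<omega> in M. norm (f k \<omega>) \<le> norm (4 ^ N \<omega> * \<bar>Y \<omega>\<bar>)"
    proof (rule AE_I2)
      fix \<omega>
      have "norm (f k \<omega>) \<le> (\<Sum>k<Suc k. norm (f k \<omega>))" by (simp add: sum_nonneg)
      also note part
      finally show "norm (f k \<omega>) \<le> norm (4 ^ N \<omega> * \<bar>Y \<omega>\<bar>)" by simp
    qed
  qed
  have "(\<integral>\<omega>. (\<Sum>k<n. f k \<omega>) \<partial>M) =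
      (\<Sum>k<n. (-1) ^ (k + m) * real (k choose m) * (\<integral>\<omega>. real (N \<omega> choose k) * Y \<omega> \<partial>M))" for n
    using intf by (subst Bochner_Integration.integral_sum) (auto simp: f_def intro!: sum.cong)
  with lim show ?thesis by (simp add: sums_def sums_unique)
qed

lemma prod_of_bool:
  "finite J \<Longrightarrow> (\<Prod>j\<in>J. of_bool (P j)) = (of_bool (\<forall>j\<in>J. P j) :: 'a :: comm_semiring_1)"
  by (induction J rule: finite_induct) auto

text \<open>
  The coordinates in \<open>I\<close> have already been converted from binomial moments to point masses.
\<close>

definition mixed_moment ::
    "'j set \<Rightarrow> ('j \<Rightarrow> nat) \<Rightarrow> 'j set \<Rightarrow> ('j \<Rightarrow> nat) \<Rightarrow> ('j \<Rightarrow> 'w \<Rightarrow> nat) \<Rightarrow> 'w \<Rightarrow> real" where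
  "mixed_moment J m I \<kappa> N \<omega> =
     (\<Prod>j\<in>I. of_bool (N j \<omega> = m j)) * (\<Prod>j\<in>J - I. real (N j \<omega> choose \<kappa> j))"

lemma mixed_moment_insert:
  assumes "finite J" and "insert i I \<subseteq> J" "i \<notin> I"
    and [measurable]: "\<And>j. j \<in> J \<Longrightarrow> N j \<in> M \<rightarrow>\<^sub>M count_space UNIV"
    and int: "integrable M (\<lambda>\<omega>. (4::real) ^ (\<Sum>j\<in>J. N j \<omega>))"
  shows "(\<integral>\<omega>. mixed_moment J m (insert i I) \<kappa> N \<omega> \<partial>M) =
      (\<Sum>k. (-1) ^ (k + m i) * real (k choose m i) * (\<integral>\<omega>. mixed_moment J m I (\<kappa>(i := k)) N \<omega> \<partial>M))"
proof -
  define G where "G = (\<lambda>\<omega>.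
      (\<Prod>j\<in>I. of_bool (N j \<omega> = m j)) * (\<Prod>j\<in>J - insert i I. real (N j \<omega> choose \<kappa> j)))"
  have [measurable]: "j \<in> I \<Longrightarrow> N j \<in> M \<rightarrow>\<^sub>M count_space UNIV" "N i \<in> M \<rightarrow>\<^sub>M count_space UNIV" for j
    using assms by auto
  have I: "finite I" "i \<in> J" using assms finite_subset by auto
  have meas: "G \<in> borel_measurable M"
    unfolding G_def by measurable
  have bound: "norm (4 ^ N i \<omega> * \<bar>G \<omega>\<bar>) \<le> norm ((4::real) ^ (\<Sum>j\<in>J. N j \<omega>))" for \<omega>
  proof -
    have "\<bar>G \<omega>\<bar> \<le> 1 * (\<Prod>j\<in>J - insert i I. 4 ^ N j \<omega>)"
    proof -
      have "real (N j \<omega> choose \<kappa> j) \<le> 4 ^ N j \<omega>" for j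
      proof -
        have "real (N j \<omega> choose \<kappa> j) \<le> 2 ^ N j \<omega>"
          by (metis binomial_le_pow2 of_nat_le_iff of_nat_numeral of_nat_power)
        also have "\<dots> \<le> 4 ^ N j \<omega>" by (intro power_mono) auto
        finally show ?thesis .
      qed
      then show ?thesis
        unfolding G_def abs_mult
        by (intro mult_mono) (auto simp: abs_prod intro!: prod_mono prod_le_1 prod_nonneg)
    qed
    also have "\<dots> \<le> (\<Prod>j\<in>J - {i}. 4 ^ N j \<omega>)"
      unfolding mult_1 by (rule prod_mono2) (use \<open>finite J\<close> in auto)
    finally have "4 ^ N i \<omega> * \<bar>G \<omega>\<bar> \<le> 4 ^ N i \<omega> * (\<Prod>j\<in>J - {i}. 4 ^ N j \<omega>)"
      by (intro mult_left_mono) auto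
    also have "\<dots> = 4 ^ (\<Sum>j\<in>J. N j \<omega>)"
      by (simp only: power_sum prod.remove[OF \<open>finite J\<close> I(2)])
    finally show ?thesis by simp
  qed
  have absorb: "real (N i \<omega> choose k) * G \<omega> = mixed_moment J m I (\<kappa>(i := k)) N \<omega>" for k \<omega>
  proof -
    have "J - I = insert i (J - insert i I)" using I \<open>i \<notin> I\<close> by auto
    have "(\<Prod>j\<in>J - I. real (N j \<omega> choose (\<kappa>(i := k)) j)) =
        real (N i \<omega> choose k) * (\<Prod>j\<in>J - insert i I. real (N j \<omega> choose (\<kappa>(i := k)) j))"
      unfolding \<open>J - I = insert i (J - insert i I)\<close>
      using \<open>finite J\<close> by (subst prod.insert) auto
    also have "(\<Prod>j\<in>J - insert i I. real (N j \<omega> choose (\<kappa>(i := k)) j)) =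
        (\<Prod>j\<in>J - insert i I. real (N j \<omega> choose \<kappa> j))"
      by (intro prod.cong) auto
    finally show ?thesis by (simp add: mixed_moment_def G_def)
  qed
  have "(\<integral>\<omega>. mixed_moment J m (insert i I) \<kappa> N \<omega> \<partial>M) = (\<integral>\<omega>. of_bool (N i \<omega> = m i) * G \<omega> \<partial>M)"
    using I \<open>i \<notin> I\<close> by (simp add: mixed_moment_def G_def mult.assoc)
  also have "\<dots> = (\<Sum>k. (-1) ^ (k + m i) * real (k choose m i) *
      (\<integral>\<omega>. real (N i \<omega> choose k) * G \<omega> \<partial>M))"
  proof (rule integral_of_bool_eq_suminf_binomial[OF _ meas])
    show "integrable M (\<lambda>\<omega>. 4 ^ N i \<omega> * \<bar>G \<omega>\<bar>)"
    proof (rule Bochner_Integration.integrable_bound[OF int])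
      show "(\<lambda>\<omega>. 4 ^ N i \<omega> * \<bar>G \<omega>\<bar>) \<in> borel_measurable M"
        by (intro borel_measurable_times borel_measurable_abs meas) measurable
      show "AE \<omega> in M. norm (4 ^ N i \<omega> * \<bar>G \<omega>\<bar>) \<le> norm ((4::real) ^ (\<Sum>j\<in>J. N j \<omega>))"
        using bound by (rule AE_I2)
    qed
  qed measurable
  also have "\<dots> = (\<Sum>k. (-1) ^ (k + m i) * real (k choose m i) *
      (\<integral>\<omega>. mixed_moment J m I (\<kappa>(i := k)) N \<omega> \<partial>M))"
    by (simp only: absorb)
  finally show ?thesis .
qed

text \<open>
  The coordinates are converted one at a time, each by binomial inversion. The exponential moments
  justify every exchange of sum and integral.
\<close>

lemma prob_eq_of_binomial_moments:
  fixes N :: "'j \<Rightarrow> 'w \<Rightarrow> nat" and N' :: "'j \<Rightarrow> 'v \<Rightarrow> nat"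
  assumes "finite J"
    and N [measurable]: "\<And>j. j \<in> J \<Longrightarrow> N j \<in> M \<rightarrow>\<^sub>M count_space UNIV"
    and N' [measurable]: "\<And>j. j \<in> J \<Longrightarrow> N' j \<in> M' \<rightarrow>\<^sub>M count_space UNIV"
    and int: "integrable M (\<lambda>\<omega>. (4::real) ^ (\<Sum>j\<in>J. N j \<omega>))" "integrable M' (\<lambda>\<omega>. (4::real) ^ (\<Sum>j\<in>J. N' j \<omega>))"
    and eq: "\<And>\<kappa>. (\<integral>\<omega>. (\<Prod>j\<in>J. real (N j \<omega> choose \<kappa> j)) \<partial>M) = (\<integral>\<omega>. (\<Prod>j\<in>J. real (N' j \<omega> choose \<kappa> j)) \<partial>M')"
  shows "(\<integral>\<omega>. of_bool (\<forall>j\<in>J. N j \<omega> = m j) \<partial>M) = (\<integral>\<omega>. of_bool (\<forall>j\<in>J. N' j \<omega> = m j) \<partial>M' :: real)"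
proof -
  have "(\<integral>\<omega>. mixed_moment J m I \<kappa> N \<omega> \<partial>M) = (\<integral>\<omega>. mixed_moment J m I \<kappa> N' \<omega> \<partial>M')" if "finite I" "I \<subseteq> J" for I \<kappa>
    using that
  proof (induction I arbitrary: \<kappa> rule: finite_induct)
    case empty
    then show ?case using eq by (simp add: mixed_moment_def)
  next
    case (insert i I)
    then have "I \<subseteq> J" by auto
    have "(\<integral>\<omega>. mixed_moment J m (insert i I) \<kappa> N \<omega> \<partial>M) =
        (\<Sum>k. (-1) ^ (k + m i) * real (k choose m i) * (\<integral>\<omega>. mixed_moment J m I (\<kappa>(i := k)) N \<omega> \<partial>M))"
      by (rule mixed_moment_insert) (use insert.prems insert.hyps \<open>finite J\<close> N int in auto)
    also have "\<dots> = (\<Sum>k. (-1) ^ (k + m i) * real (k choose m i) * (\<integral>\<omega>. mixed_moment J m I (\<kappa>(i := k)) N' \<omega> \<partial>M'))"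
      by (simp only: insert.IH[OF \<open>I \<subseteq> J\<close>])
    also have "\<dots> = (\<integral>\<omega>. mixed_moment J m (insert i I) \<kappa> N' \<omega> \<partial>M')"
      by (rule mixed_moment_insert[symmetric]) (use insert.prems insert.hyps \<open>finite J\<close> N' int in auto)
    finally show ?case .
  qed
  from this[OF \<open>finite J\<close> order_refl] show ?thesis
    by (simp add: mixed_moment_def prod_of_bool[OF \<open>finite J\<close>])
qed

section \<open>Laws on the space of measures\<close>

lemma space_measure_algebra: "space measure_algebra = {N. sets N = sets borel}"
  by (auto simp: measure_algebra_def space_Sup_eq_UN)

lemma measurable_emeasure_measure_algebra:
  "D \<in> sets borel \<Longrightarrow> (\<lambda>N. emeasure N D) \<in> borel_measurable measure_algebra"
  by (auto intro!: measurable_Sup1 measurable_vimage_algebra1 simp: measure_algebra_def)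

lemma measurable_measure_algebraI:
  assumes "\<And>\<omega>. \<omega> \<in> space M \<Longrightarrow> sets (f \<omega>) = sets borel"
    and "\<And>D. D \<in> sets borel \<Longrightarrow> (\<lambda>\<omega>. emeasure (f \<omega>) D) \<in> borel_measurable M"
  shows "f \<in> M \<rightarrow>\<^sub>M measure_algebra"
  using assms unfolding measure_algebra_def
  by (intro measurable_Sup2) (auto intro!: measurable_vimage_algebra2)

text \<open>
  Regarding a measure as the family of its values embeds the space of measures in a product space,
  so that uniqueness of measures on infinite products becomes available.
\<close>

lemma measure_algebra_eq_vimage:
  "sets (measure_algebra :: 'a::topological_space measure measure) =
   sets (vimage_algebra {N. sets N = sets borel} (\<lambda>N. \<lambda>D\<in>sets borel. emeasure N D)
      (\<Pi>\<^sub>M D\<in>(sets borel :: 'a set set). (borel :: ennreal measure)))"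
  (is "_ = sets (vimage_algebra ?\<Omega> ?ev ?P)")
proof (rule antisym)
  have "(\<lambda>N. N) \<in> vimage_algebra ?\<Omega> ?ev ?P \<rightarrow>\<^sub>M measure_algebra"
  proof (rule measurable_measure_algebraI)
    fix D :: "'a set" assume D: "D \<in> sets borel"
    have "(\<lambda>N. ?ev N D) \<in> borel_measurable (vimage_algebra ?\<Omega> ?ev ?P)"
      by (rule measurable_compose[OF measurable_vimage_algebra1 measurable_component_singleton[OF D]])
        (auto simp: space_PiM)
    then show "(\<lambda>N. emeasure N D) \<in> borel_measurable (vimage_algebra ?\<Omega> ?ev ?P)"
      using D by simp
  qed simp
  then show "sets (measure_algebra :: 'a measure measure) \<subseteq> sets (vimage_algebra ?\<Omega> ?ev ?P)"
    using sets.sets_into_space[of _ "measure_algebra :: 'a measure measure"]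
    by (fastforce simp: measurable_def space_measure_algebra vimage_def Int_absorb2 subset_eq Collect_conj_eq dest: bspec)
  have ev: "?ev \<in> measure_algebra \<rightarrow>\<^sub>M ?P"
    by (intro measurable_restrict measurable_emeasure_measure_algebra)
  then show "sets (vimage_algebra ?\<Omega> ?ev ?P) \<subseteq> sets measure_algebra"
    by (auto simp: sets_vimage_algebra2 measurable_def space_PiM space_measure_algebra[symmetric]
       intro: measurable_sets[OF ev])
qed

text \<open>
  A random measure is determined in law by its finite-dimensional distributions.
\<close>

lemma measure_algebra_eqI:
  fixes Y :: "'w \<Rightarrow> 'a::topological_space measure" and Y' :: "'v \<Rightarrow> 'a measure"
  assumes M: "prob_space M" "prob_space M'"
    and Y [measurable]: "Y \<in> M \<rightarrow>\<^sub>M measure_algebra" "Y' \<in> M' \<rightarrow>\<^sub>M measure_algebra"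
    and eq: "\<And>F A. finite F \<Longrightarrow> F \<subseteq> sets borel \<Longrightarrow> (\<And>D. D \<in> F \<Longrightarrow> A D \<in> sets (borel :: ennreal measure)) \<Longrightarrow>
      emeasure M {\<omega>\<in>space M. \<forall>D\<in>F. emeasure (Y \<omega>) D \<in> A D} =
      emeasure M' {\<omega>\<in>space M'. \<forall>D\<in>F. emeasure (Y' \<omega>) D \<in> A D}"
  shows "distr M measure_algebra Y = distr M' measure_algebra Y'"
proof -
  let ?\<Omega> = "{N :: 'a measure. sets N = sets borel}"
  let ?ev = "\<lambda>N. \<lambda>D\<in>(sets borel :: 'a set set). emeasure N D"
  let ?P = "\<Pi>\<^sub>M D\<in>(sets borel :: 'a set set). (borel :: ennreal measure)"
  have ev [measurable]: "?ev \<in> measure_algebra \<rightarrow>\<^sub>M ?P"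
    by (intro measurable_restrict measurable_emeasure_measure_algebra)
  have *: "distr M ?P (\<lambda>\<omega>. ?ev (Y \<omega>)) = distr M' ?P (\<lambda>\<omega>. ?ev (Y' \<omega>))"
  proof (rule measure_eqI_PiM_infinite)
    show "finite_measure (distr M ?P (\<lambda>\<omega>. ?ev (Y \<omega>)))"
      by (intro prob_space.finite_measure prob_space.prob_space_distr M) measurable
    fix A and F :: "'a set set" assume F: "finite F" "F \<subseteq> sets borel" "\<And>D. D \<in> F \<Longrightarrow> A D \<in> sets (borel :: ennreal measure)"
    have meas: "prod_emb (sets borel) (\<lambda>_. borel) F (Pi\<^sub>E F A) \<in> sets ?P"
      using F by (intro sets_PiM_I) auto
    have "?ev N \<in> prod_emb (sets borel) (\<lambda>_. borel) F (Pi\<^sub>E F A) \<longleftrightarrow> (\<forall>D\<in>F. emeasure N D \<in> A D)" for N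
      using F by (auto simp: prod_emb_def PiE_iff subset_eq)
    then show "emeasure (distr M ?P (\<lambda>\<omega>. ?ev (Y \<omega>))) (prod_emb (sets borel) (\<lambda>_. borel) F (Pi\<^sub>E F A)) =
      emeasure (distr M' ?P (\<lambda>\<omega>. ?ev (Y' \<omega>))) (prod_emb (sets borel) (\<lambda>_. borel) F (Pi\<^sub>E F A))"
      using meas eq[OF F] by (simp add: emeasure_distr vimage_def Int_def conj_commute)
  qed auto
  show ?thesis
  proof (rule measure_eqI)
    fix S assume "S \<in> sets (distr M measure_algebra Y)"
    then have S: "S \<in> sets measure_algebra" by simp
    then obtain T where T: "T \<in> sets ?P" "S = ?ev -` T \<inter> ?\<Omega>"
      unfolding measure_algebra_eq_vimage by (subst (asm) sets_vimage_algebra2) (auto simp: space_PiM)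
    have YO: "\<omega> \<in> space M \<Longrightarrow> Y \<omega> \<in> ?\<Omega>" "\<omega>' \<in> space M' \<Longrightarrow> Y' \<omega>' \<in> ?\<Omega>" for \<omega> \<omega>'
      using measurable_space[OF Y(1)] measurable_space[OF Y(2)] by (auto simp: space_measure_algebra)
    have "emeasure (distr M measure_algebra Y) S = emeasure (distr M ?P (\<lambda>\<omega>. ?ev (Y \<omega>))) T"
      using S T YO by (auto simp: emeasure_distr intro!: arg_cong[where f = "emeasure M"])
    also have "\<dots> = emeasure (distr M' measure_algebra Y') S"
      unfolding * using S T YO by (auto simp: emeasure_distr intro!: arg_cong[where f = "emeasure M'"])
    finally show "emeasure (distr M measure_algebra Y) S = emeasure (distr M' measure_algebra Y') S" .
  qed simp
qed

section \<open>Factorial moments determine the law of a finite point process\<close>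

text \<open>
  This is meaningful only where the measure of \<open>D\<close> is a natural number.
\<close>

definition num_points :: "'a measure \<Rightarrow> 'a set \<Rightarrow> nat" where
  "num_points N D = nat \<lfloor>enn2real (emeasure N D)\<rfloor>"

lemma num_points_eqI: "emeasure N D = of_nat m \<Longrightarrow> num_points N D = m"
  by (simp add: num_points_def)

lemma emeasure_eq_num_points: "emeasure N D \<in> \<nat> \<Longrightarrow> emeasure N D = of_nat (num_points N D)"
  using num_points_eqI by (metis Nats_cases)

lemma measurable_num_points:
  assumes Y: "Y \<in> M \<rightarrow>\<^sub>M measure_algebra" and D: "D \<in> sets borel"
  shows "(\<lambda>\<omega>. num_points (Y \<omega>) D) \<in> M \<rightarrow>\<^sub>M count_space UNIV"
proof -
  have [measurable]: "(\<lambda>\<omega>. emeasure (Y \<omega>) D) \<in> borel_measurable M"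
    using measurable_compose[OF Y measurable_emeasure_measure_algebra[OF D]] .
  show ?thesis unfolding num_points_def by measurable
qed

lemma num_points_UN_disjoint:
  assumes "finite J" "disjoint_family_on E J" "\<And>j. j \<in> J \<Longrightarrow> E j \<in> sets N"
    and "\<And>j. j \<in> J \<Longrightarrow> emeasure N (E j) \<in> \<nat>"
  shows "num_points N (\<Union>j\<in>J. E j) = (\<Sum>j\<in>J. num_points N (E j))"
proof (rule num_points_eqI)
  have "emeasure N (\<Union>j\<in>J. E j) = (\<Sum>j\<in>J. emeasure N (E j))"
    using assms by (intro sum_emeasure[symmetric]) auto
  also have "\<dots> = (\<Sum>j\<in>J. of_nat (num_points N (E j)))"
    using assms by (intro sum.cong refl emeasure_eq_num_points)
  finally show "emeasure N (\<Union>j\<in>J. E j) = of_nat (\<Sum>j\<in>J. num_points N (E j))" by simp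
qed

lemma four_power_eq_sum_binomial: "(4::ennreal) ^ N = (\<Sum>k. of_nat (3 ^ k * (N choose k)))"
proof -
  have "(4::nat) ^ N = (\<Sum>k\<le>N. 3 ^ k * (N choose k))"
    using binomial[of 3 1 N] by (simp add: mult.commute)
  then have "(4::ennreal) ^ N = (\<Sum>k\<le>N. of_nat (3 ^ k * (N choose k)))"
    by (metis of_nat_numeral of_nat_power of_nat_sum)
  also have "\<dots> = (\<Sum>k. of_nat (3 ^ k * (N choose k)))"
    by (intro suminf_finite[symmetric]) auto
  finally show ?thesis .
qed

text \<open>
  Expanding \<open>4 ^ N = (1 + 3) ^ N\<close> binomially bounds the expectation by the exponential series of
  \<open>3 * C\<close>.
\<close>

lemma integrable_4_power:
  fixes N :: "'w \<Rightarrow> nat" and C :: real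
  assumes N [measurable]: "N \<in> M \<rightarrow>\<^sub>M count_space UNIV" and C: "0 \<le> C"
    and bound: "\<And>k. (\<integral>\<^sup>+\<omega>. of_nat (fact k * (N \<omega> choose k)) \<partial>M) \<le> ennreal (C ^ k)"
  shows "integrable M (\<lambda>\<omega>. (4::real) ^ N \<omega>)"
proof (rule integrableI_bounded)
  show "(\<lambda>\<omega>. (4::real) ^ N \<omega>) \<in> borel_measurable M" by measurable
  have b: "(\<integral>\<^sup>+\<omega>. of_nat (3 ^ k * (N \<omega> choose k)) \<partial>M) \<le> ennreal ((3 * C) ^ k /\<^sub>R fact k)" for k
  proof -
    have "(of_nat (3 ^ k * (N \<omega> choose k)) :: ennreal) = ennreal (3 ^ k / fact k) * of_nat (fact k * (N \<omega> choose k))" for \<omega>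
    proof -
      have "real (3 ^ k * (N \<omega> choose k)) = (3 ^ k / fact k) * real (fact k * (N \<omega> choose k))" by simp
      then show ?thesis
        by (metis ennreal_mult ennreal_of_nat_eq_real_of_nat divide_nonneg_nonneg fact_ge_zero of_nat_0_le_iff
            zero_le_numeral zero_le_power)
    qed
    then have "(\<integral>\<^sup>+\<omega>. of_nat (3 ^ k * (N \<omega> choose k)) \<partial>M) =
        (\<integral>\<^sup>+\<omega>. ennreal (3 ^ k / fact k) * of_nat (fact k * (N \<omega> choose k)) \<partial>M)" by simp
    also have "\<dots> = ennreal (3 ^ k / fact k) * (\<integral>\<^sup>+\<omega>. of_nat (fact k * (N \<omega> choose k)) \<partial>M)"
      by (rule nn_integral_cmult) measurable
    also have "\<dots> \<le> ennreal (3 ^ k / fact k) * ennreal (C ^ k)"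
      by (intro mult_left_mono bound) auto
    also have "\<dots> = ennreal ((3 * C) ^ k /\<^sub>R fact k)"
      using C by (simp add: ennreal_mult[symmetric] field_simps)
    finally show ?thesis .
  qed
  have "(\<integral>\<^sup>+\<omega>. ennreal (norm ((4::real) ^ N \<omega>)) \<partial>M) = (\<integral>\<^sup>+\<omega>. (\<Sum>k. of_nat (3 ^ k * (N \<omega> choose k))) \<partial>M)"
    by (simp only: four_power_eq_sum_binomial[symmetric]) (simp add: ennreal_power[symmetric])
  also have "\<dots> = (\<Sum>k. \<integral>\<^sup>+\<omega>. of_nat (3 ^ k * (N \<omega> choose k)) \<partial>M)"
    by (rule nn_integral_suminf) measurable
  also have "\<dots> \<le> (\<Sum>k. ennreal ((3 * C) ^ k /\<^sub>R fact k))"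
    by (intro suminf_le b) auto
  also have "\<dots> = ennreal (\<Sum>k. (3 * C) ^ k /\<^sub>R fact k)"
    using C summable_exp_generic[of "3 * C"] by (intro suminf_ennreal2) auto
  also have "\<dots> < \<infinity>" by simp
  finally show "(\<integral>\<^sup>+\<omega>. ennreal (norm ((4::real) ^ N \<omega>)) \<partial>M) < \<infinity>" .
qed

abbreviation factorial_moment ::
    "'w measure \<Rightarrow> ('w \<Rightarrow> 'a measure) \<Rightarrow> 'j set \<Rightarrow> ('j \<Rightarrow> 'a set) \<Rightarrow> ('j \<Rightarrow> nat) \<Rightarrow> ennreal" where
  "factorial_moment M Y J E \<kappa> \<equiv>
     (\<integral>\<^sup>+\<omega>. of_nat (\<Prod>j\<in>J. fact (\<kappa> j) * (num_points (Y \<omega>) (E j) choose \<kappa> j)) \<partial>M)"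

text \<open>
  Almost surely all counts are finite, which makes binomial moments available.
\<close>

definition finite_counts :: "'w measure \<Rightarrow> ('w \<Rightarrow> 'a::topological_space measure) \<Rightarrow> bool" where
  "finite_counts M Y \<longleftrightarrow> prob_space M \<and> Y \<in> M \<rightarrow>\<^sub>M measure_algebra \<and>
     (AE \<omega> in M. \<forall>D\<in>sets borel. emeasure (Y \<omega>) D \<in> \<nat>)"

lemma finite_countsD:
  assumes "finite_counts M Y"
  shows "prob_space M" "Y \<in> M \<rightarrow>\<^sub>M measure_algebra"
    and "AE \<omega> in M. sets (Y \<omega>) = sets borel \<and> (\<forall>D\<in>sets borel. emeasure (Y \<omega>) D \<in> \<nat>)"
proof -
  show M: "prob_space M" and Y: "Y \<in> M \<rightarrow>\<^sub>M measure_algebra" using assms by (auto simp: finite_counts_def)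
  have "sets (Y \<omega>) = sets borel" if "\<omega> \<in> space M" for \<omega>
    using measurable_space[OF Y that] by (simp add: space_measure_algebra)
  then show "AE \<omega> in M. sets (Y \<omega>) = sets borel \<and> (\<forall>D\<in>sets borel. emeasure (Y \<omega>) D \<in> \<nat>)"
    using assms by (auto simp: finite_counts_def)
qed

lemma integrable_4_power_sum:
  fixes Y :: "'w \<Rightarrow> 'a::topological_space measure" and E :: "'j \<Rightarrow> 'a set"
  assumes Y: "finite_counts M Y"
    and "finite J" and disj: "disjoint_family_on E J" and E: "\<And>j. j \<in> J \<Longrightarrow> E j \<in> sets borel"
    and int: "integrable M (\<lambda>\<omega>. (4::real) ^ num_points (Y \<omega>) UNIV)"
  shows "integrable M (\<lambda>\<omega>. (4::real) ^ (\<Sum>j\<in>J. num_points (Y \<omega>) (E j)))"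
proof (rule Bochner_Integration.integrable_bound[OF int])
  have [measurable]: "j \<in> J \<Longrightarrow> (\<lambda>\<omega>. num_points (Y \<omega>) (E j)) \<in> M \<rightarrow>\<^sub>M count_space UNIV" for j
    using finite_countsD(2)[OF Y] E by (rule measurable_num_points)
  show "(\<lambda>\<omega>. (4::real) ^ (\<Sum>j\<in>J. num_points (Y \<omega>) (E j))) \<in> borel_measurable M" by measurable
  show "AE \<omega> in M. norm ((4::real) ^ (\<Sum>j\<in>J. num_points (Y \<omega>) (E j))) \<le> norm ((4::real) ^ num_points (Y \<omega>) UNIV)"
    using finite_countsD(3)[OF Y]
  proof eventually_elim
    fix \<omega> assume \<omega>: "sets (Y \<omega>) = sets borel \<and> (\<forall>D\<in>sets borel. emeasure (Y \<omega>) D \<in> \<nat>)"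
    have U: "(\<Union>j\<in>J. E j) \<in> sets borel" using \<open>finite J\<close> E by auto
    have "emeasure (Y \<omega>) (\<Union>j\<in>J. E j) \<le> emeasure (Y \<omega>) UNIV"
      using \<omega> by (intro emeasure_mono) auto
    then have "num_points (Y \<omega>) (\<Union>j\<in>J. E j) \<le> num_points (Y \<omega>) UNIV"
      using \<omega> U by (simp add: emeasure_eq_num_points)
    moreover have "num_points (Y \<omega>) (\<Union>j\<in>J. E j) = (\<Sum>j\<in>J. num_points (Y \<omega>) (E j))"
      using \<omega> E by (intro num_points_UN_disjoint[OF \<open>finite J\<close> disj]) auto
    ultimately show "norm ((4::real) ^ (\<Sum>j\<in>J. num_points (Y \<omega>) (E j))) \<le> norm ((4::real) ^ num_points (Y \<omega>) UNIV)"
      by simp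
  qed
qed

lemma integral_prod_binomial:
  assumes [measurable]: "\<And>j. j \<in> J \<Longrightarrow> n j \<in> M \<rightarrow>\<^sub>M count_space UNIV"
  shows "(\<integral>\<omega>. (\<Prod>j\<in>J. real (n j \<omega> choose \<kappa> j)) \<partial>M) =
      enn2real (\<integral>\<^sup>+\<omega>. of_nat (\<Prod>j\<in>J. fact (\<kappa> j) * (n j \<omega> choose \<kappa> j)) \<partial>M) / (\<Prod>j\<in>J. fact (\<kappa> j))"
proof -
  have nz: "(\<Prod>j\<in>J. fact (\<kappa> j)) \<noteq> (0::real)" by (cases "finite J") auto
  have "(\<integral>\<omega>. (\<Prod>j\<in>J. real (n j \<omega> choose \<kappa> j)) \<partial>M) =
      (\<integral>\<omega>. real (\<Prod>j\<in>J. fact (\<kappa> j) * (n j \<omega> choose \<kappa> j)) / (\<Prod>j\<in>J. fact (\<kappa> j)) \<partial>M)"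
    using nz by (simp add: prod.distrib)
  also have "\<dots> = (\<integral>\<omega>. real (\<Prod>j\<in>J. fact (\<kappa> j) * (n j \<omega> choose \<kappa> j)) \<partial>M) / (\<Prod>j\<in>J. fact (\<kappa> j))"
    by (rule integral_divide_zero)
  also have "(\<integral>\<omega>. real (\<Prod>j\<in>J. fact (\<kappa> j) * (n j \<omega> choose \<kappa> j)) \<partial>M) =
      enn2real (\<integral>\<^sup>+\<omega>. of_nat (\<Prod>j\<in>J. fact (\<kappa> j) * (n j \<omega> choose \<kappa> j)) \<partial>M)"
    unfolding ennreal_of_nat_eq_real_of_nat by (rule integral_eq_nn_integral) (simp_all add: prod_nonneg)
  finally show ?thesis .
qed

lemma prob_num_points_eq:
  fixes Y :: "'w \<Rightarrow> 'a::topological_space measure" and Y' :: "'v \<Rightarrow> 'a measure"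
    and E :: "'j \<Rightarrow> 'a set" and m :: "'j \<Rightarrow> nat"
  assumes Y: "finite_counts M Y" "finite_counts M' Y'"
    and "finite J" and disj: "disjoint_family_on E J" and E: "\<And>j. j \<in> J \<Longrightarrow> E j \<in> sets borel"
    and int: "integrable M (\<lambda>\<omega>. (4::real) ^ num_points (Y \<omega>) UNIV)"
             "integrable M' (\<lambda>\<omega>. (4::real) ^ num_points (Y' \<omega>) UNIV)"
    and eq: "\<And>\<kappa>. factorial_moment M Y J E \<kappa> =
             factorial_moment M' Y' J E \<kappa>"
  shows "emeasure M {\<omega>\<in>space M. \<forall>j\<in>J. num_points (Y \<omega>) (E j) = m j} =
         emeasure M' {\<omega>\<in>space M'. \<forall>j\<in>J. num_points (Y' \<omega>) (E j) = m j}"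
proof -
  interpret M: prob_space M using Y by (simp add: finite_counts_def)
  interpret M': prob_space M' using Y by (simp add: finite_counts_def)
  have mY: "j \<in> J \<Longrightarrow> (\<lambda>\<omega>. num_points (Y \<omega>) (E j)) \<in> M \<rightarrow>\<^sub>M count_space UNIV"
           "j \<in> J \<Longrightarrow> (\<lambda>\<omega>. num_points (Y' \<omega>) (E j)) \<in> M' \<rightarrow>\<^sub>M count_space UNIV" for j
    using Y E by (auto intro: measurable_num_points simp: finite_counts_def)
  have "(\<integral>\<omega>. of_bool (\<forall>j\<in>J. num_points (Y \<omega>) (E j) = m j) \<partial>M) =
      (\<integral>\<omega>. of_bool (\<forall>j\<in>J. num_points (Y' \<omega>) (E j) = m j) \<partial>M' :: real)"
  proof (rule prob_eq_of_binomial_moments[OF \<open>finite J\<close> mY])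
    show "integrable M (\<lambda>\<omega>. (4::real) ^ (\<Sum>j\<in>J. num_points (Y \<omega>) (E j)))"
         "integrable M' (\<lambda>\<omega>. (4::real) ^ (\<Sum>j\<in>J. num_points (Y' \<omega>) (E j)))"
      using integrable_4_power_sum[OF Y(1) \<open>finite J\<close> disj E int(1)]
        integrable_4_power_sum[OF Y(2) \<open>finite J\<close> disj E int(2)] by auto
    show "(\<integral>\<omega>. (\<Prod>j\<in>J. real (num_points (Y \<omega>) (E j) choose \<kappa> j)) \<partial>M) =
        (\<integral>\<omega>. (\<Prod>j\<in>J. real (num_points (Y' \<omega>) (E j) choose \<kappa> j)) \<partial>M')" for \<kappa>
      by (simp only: integral_prod_binomial[OF mY(1)] integral_prod_binomial[OF mY(2)] eq)
  qed
  moreover have "(\<integral>\<omega>. of_bool (\<forall>j\<in>J. num_points (Y \<omega>) (E j) = m j) \<partial>M) =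
      M.prob {\<omega>\<in>space M. \<forall>j\<in>J. num_points (Y \<omega>) (E j) = m j}"
    by (subst Bochner_Integration.integral_cong[OF refl, where g = "indicator {\<omega>\<in>space M. \<forall>j\<in>J. num_points (Y \<omega>) (E j) = m j}"])
      (auto simp: indicator_def Int_def intro!: arg_cong[where f = M.prob])
  moreover have "(\<integral>\<omega>. of_bool (\<forall>j\<in>J. num_points (Y' \<omega>) (E j) = m j) \<partial>M') =
      M'.prob {\<omega>\<in>space M'. \<forall>j\<in>J. num_points (Y' \<omega>) (E j) = m j}"
    by (subst Bochner_Integration.integral_cong[OF refl, where g = "indicator {\<omega>\<in>space M'. \<forall>j\<in>J. num_points (Y' \<omega>) (E j) = m j}"])
      (auto simp: indicator_def Int_def intro!: arg_cong[where f = M'.prob])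
  ultimately show ?thesis by (simp add: M.emeasure_eq_measure M'.emeasure_eq_measure)
qed

text \<open>
  The points that lie in exactly the members \<open>S\<close> of \<open>F\<close>, for \<open>S \<subseteq> F\<close>. Counts of arbitrary finitely
  many Borel sets are sums of counts of these disjoint sets.
\<close>

definition atom :: "'a set set \<Rightarrow> 'a set set \<Rightarrow> 'a set" where
  "atom F S = (\<Inter>D\<in>F. if D \<in> S then D else - D)"

lemma atom_iff: "S \<subseteq> F \<Longrightarrow> x \<in> atom F S \<longleftrightarrow> S = {D\<in>F. x \<in> D}"
  by (auto simp: atom_def split: if_splits)

lemma Union_atoms: "D \<in> F \<Longrightarrow> D = (\<Union>S\<in>{S\<in>Pow F. D \<in> S}. atom F S)"
  by (auto simp: atom_iff)

lemma emeasure_eq_of_point_masses: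
  assumes \<nu>: "\<nu> \<in> M \<rightarrow>\<^sub>M count_space A" "\<nu>' \<in> M' \<rightarrow>\<^sub>M count_space A" and "countable A"
    and eq: "\<And>m. m \<in> A \<Longrightarrow> emeasure M {\<omega>\<in>space M. \<nu> \<omega> = m} = emeasure M' {\<omega>\<in>space M'. \<nu>' \<omega> = m}"
    and "T \<subseteq> A"
  shows "emeasure M {\<omega>\<in>space M. \<nu> \<omega> \<in> T} = emeasure M' {\<omega>\<in>space M'. \<nu>' \<omega> \<in> T}"
proof -
  have "distr M (count_space A) \<nu> = distr M' (count_space A) \<nu>'"
  proof (rule measure_eqI_countable[of _ A])
    fix m assume "m \<in> A"
    then show "emeasure (distr M (count_space A) \<nu>) {m} = emeasure (distr M' (count_space A) \<nu>') {m}"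
      using eq[of m] \<nu> by (simp add: emeasure_distr vimage_def Int_def conj_commute)
  qed (use \<open>countable A\<close> in auto)
  then have "emeasure (distr M (count_space A) \<nu>) T = emeasure (distr M' (count_space A) \<nu>') T" by simp
  then show ?thesis using \<nu> \<open>T \<subseteq> A\<close> by (simp add: emeasure_distr vimage_def Int_def conj_commute)
qed

definition atom_counts :: "'a set set \<Rightarrow> 'a measure \<Rightarrow> 'a set set \<Rightarrow> nat" where
  "atom_counts F N = (\<lambda>S\<in>Pow F. num_points N (atom F S))"

lemma sets_atom: "finite F \<Longrightarrow> F \<subseteq> sets borel \<Longrightarrow> atom F S \<in> sets borel"
  unfolding atom_def by (intro sets.countable_INT'' countable_finite) (auto intro: borel_comp)

lemma disjoint_family_atom: "disjoint_family_on (atom F) (Pow F)"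
  by (auto simp: disjoint_family_on_def atom_iff)

lemma atom_counts_eq_iff:
  assumes "m \<in> (\<Pi>\<^sub>E S\<in>Pow F. UNIV)"
  shows "atom_counts F N = m \<longleftrightarrow> (\<forall>S\<in>Pow F. num_points N (atom F S) = m S)"
  using assms by (auto simp: atom_counts_def fun_eq_iff PiE_iff extensional_def restrict_def)

lemma measurable_atom_counts:
  assumes Y: "Y \<in> M \<rightarrow>\<^sub>M measure_algebra" and F: "finite F" "F \<subseteq> sets borel"
  shows "(\<lambda>\<omega>. atom_counts F (Y \<omega>)) \<in> M \<rightarrow>\<^sub>M count_space (\<Pi>\<^sub>E S\<in>Pow F. UNIV)"
proof -
  let ?V = "\<Pi>\<^sub>E S\<in>Pow F. (UNIV :: nat set)"
  have "Measurable.pred M (\<lambda>\<omega>. \<forall>S\<in>Pow F. num_points (Y \<omega>) (atom F S) = m S)" for m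
  proof (rule pred_intros_finite(3))
    show "finite (Pow F)" using F by simp
    fix S
    have [measurable]: "(\<lambda>\<omega>. num_points (Y \<omega>) (atom F S)) \<in> M \<rightarrow>\<^sub>M count_space UNIV"
      by (rule measurable_num_points[OF Y sets_atom[OF F]])
    show "Measurable.pred M (\<lambda>\<omega>. num_points (Y \<omega>) (atom F S) = m S)" by measurable
  qed
  moreover have "(\<lambda>\<omega>. atom_counts F (Y \<omega>)) -` {m} \<inter> space M =
      {\<omega>\<in>space M. \<forall>S\<in>Pow F. num_points (Y \<omega>) (atom F S) = m S}" if "m \<in> ?V" for m
    using atom_counts_eq_iff[OF that] by auto
  moreover have "countable ?V" using F by (intro countable_PiE) auto
  ultimately show ?thesis
    by (subst measurable_count_space_eq_countable) (auto simp: pred_def atom_counts_def)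
qed

text \<open>
  A finite-dimensional event about overlapping sets becomes an event about the countably many possible
  values of the vector of atom counts.
\<close>

lemma emeasure_evaluations_eq_atom_counts:
  assumes Y: "finite_counts M Y" and F: "finite F" "F \<subseteq> sets borel"
    and A: "\<And>D. D \<in> F \<Longrightarrow> A D \<in> sets (borel :: ennreal measure)"
  shows "emeasure M {\<omega>\<in>space M. \<forall>D\<in>F. emeasure (Y \<omega>) D \<in> A D} =
    emeasure M {\<omega>\<in>space M. atom_counts F (Y \<omega>) \<in>
      {m\<in>(\<Pi>\<^sub>E S\<in>Pow F. UNIV). \<forall>D\<in>F. of_nat (\<Sum>S\<in>{S\<in>Pow F. D \<in> S}. m S) \<in> A D}}"
    (is "_ = emeasure M {\<omega>\<in>space M. _ \<in> ?T}")
proof (rule emeasure_eq_AE)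
  let ?V = "{\<omega>\<in>space M. \<forall>D\<in>F. emeasure (Y \<omega>) D \<in> A D}"
  let ?W = "{\<omega>\<in>space M. atom_counts F (Y \<omega>) \<in> ?T}"
  show "AE \<omega> in M. (\<omega> \<in> ?V) \<longleftrightarrow>
      (\<omega> \<in> ?W)"
    using finite_countsD(3)[OF Y]
  proof eventually_elim
    fix \<omega> assume \<omega>: "sets (Y \<omega>) = sets borel \<and> (\<forall>D\<in>sets borel. emeasure (Y \<omega>) D \<in> \<nat>)"
    have "emeasure (Y \<omega>) D = of_nat (\<Sum>S\<in>{S\<in>Pow F. D \<in> S}. atom_counts F (Y \<omega>) S)" if "D \<in> F" for D
    proof -
      let ?I = "{S\<in>Pow F. D \<in> S}"
      have "emeasure (Y \<omega>) D = of_nat (num_points (Y \<omega>) D)"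
        using \<omega> that F by (intro emeasure_eq_num_points) auto
      also have "num_points (Y \<omega>) D = num_points (Y \<omega>) (\<Union>S\<in>?I. atom F S)"
        using Union_atoms[OF that] by simp
      also have "\<dots> = (\<Sum>S\<in>?I. num_points (Y \<omega>) (atom F S))"
        using F \<omega> sets_atom[OF F] disjoint_family_atom[of F]
        by (intro num_points_UN_disjoint) (auto simp: disjoint_family_on_def)
      also have "\<dots> = (\<Sum>S\<in>?I. atom_counts F (Y \<omega>) S)"
        by (intro sum.cong) (auto simp: atom_counts_def)
      finally show ?thesis .
    qed
    then show "(\<omega> \<in> ?V) \<longleftrightarrow>
      (\<omega> \<in> ?W)"
      by (simp add: atom_counts_def)
  qed
  have mD [simp]: "(\<lambda>\<omega>. emeasure (Y \<omega>) D) \<in> borel_measurable M" if "D \<in> F" for D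
    using that F measurable_compose[OF finite_countsD(2)[OF Y] measurable_emeasure_measure_algebra] by auto
  have "Measurable.pred M (\<lambda>\<omega>. \<forall>D\<in>F. emeasure (Y \<omega>) D \<in> A D)"
    using F(1) A by (intro pred_intros_finite pred_sets2[where N = borel]) simp_all
  then show "?V \<in> sets M" by (simp add: pred_def)
  have "?T \<in> sets (count_space (\<Pi>\<^sub>E S\<in>Pow F. UNIV))" by auto
  from measurable_sets[OF measurable_atom_counts[OF finite_countsD(2)[OF Y] F] this]
  show "?W \<in> sets M" by (simp add: vimage_def Int_def conj_commute)
qed

text \<open>
  The moments of the counts of the atoms of a finite family of Borel sets give the law of these
  counts, hence all finite-dimensional distributions. The index type \<open>'a set set\<close> is the one of the
  atoms.
\<close>

theorem law_eqI_factorial_moments: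
  fixes Y :: "'w \<Rightarrow> 'a::topological_space measure" and Y' :: "'v \<Rightarrow> 'a measure" and C :: real
  assumes Y: "finite_counts M Y" "finite_counts M' Y'" and "0 \<le> C"
    and eq: "\<And>(J :: 'a set set set) E \<kappa>. finite J \<Longrightarrow> disjoint_family_on E J \<Longrightarrow> (\<And>j. j \<in> J \<Longrightarrow> E j \<in> sets borel) \<Longrightarrow>
      factorial_moment M Y J E \<kappa> =
      factorial_moment M' Y' J E \<kappa>"
    and bound: "\<And>k. (\<integral>\<^sup>+\<omega>. of_nat (fact k * (num_points (Y \<omega>) UNIV choose k)) \<partial>M) \<le> ennreal (C ^ k)"
  shows "distr M measure_algebra Y = distr M' measure_algebra Y'"
proof (rule measure_algebra_eqI)
  show "prob_space M" "prob_space M'" and mY: "Y \<in> M \<rightarrow>\<^sub>M measure_algebra" "Y' \<in> M' \<rightarrow>\<^sub>M measure_algebra"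
    using Y by (auto intro: finite_countsD)
  \<comment> \<open>The bound passes to the second process through the moments of the whole space.\<close>
  have bound': "(\<integral>\<^sup>+\<omega>. of_nat (fact k * (num_points (Y' \<omega>) UNIV choose k)) \<partial>M') \<le> ennreal (C ^ k)" for k
    using bound[of k] eq[of "{{}}" "\<lambda>_. UNIV" "\<lambda>_. k"] by (simp add: disjoint_family_on_def)
  have int: "integrable M (\<lambda>\<omega>. (4::real) ^ num_points (Y \<omega>) UNIV)"
            "integrable M' (\<lambda>\<omega>. (4::real) ^ num_points (Y' \<omega>) UNIV)"
    using \<open>0 \<le> C\<close> bound bound' mY by (auto intro!: integrable_4_power measurable_num_points)
  fix F :: "'a set set" and A
  assume F: "finite F" "F \<subseteq> sets borel" and A: "\<And>D. D \<in> F \<Longrightarrow> A D \<in> sets (borel :: ennreal measure)"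
  let ?T = "{m\<in>(\<Pi>\<^sub>E S\<in>Pow F. UNIV). \<forall>D\<in>F. of_nat (\<Sum>S\<in>{S\<in>Pow F. D \<in> S}. m S) \<in> A D}"
  have "emeasure M {\<omega>\<in>space M. \<forall>D\<in>F. emeasure (Y \<omega>) D \<in> A D} =
      emeasure M {\<omega>\<in>space M. atom_counts F (Y \<omega>) \<in> ?T}"
    by (rule emeasure_evaluations_eq_atom_counts[OF Y(1) F]) (rule A)
  also have "\<dots> = emeasure M' {\<omega>\<in>space M'. atom_counts F (Y' \<omega>) \<in> ?T}"
  proof (rule emeasure_eq_of_point_masses)
    show "countable (\<Pi>\<^sub>E S\<in>Pow F. (UNIV :: nat set))" using F by (intro countable_PiE) auto
    fix m :: "'a set set \<Rightarrow> nat" assume m: "m \<in> (\<Pi>\<^sub>E S\<in>Pow F. UNIV)"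
    show "emeasure M {\<omega>\<in>space M. atom_counts F (Y \<omega>) = m} = emeasure M' {\<omega>\<in>space M'. atom_counts F (Y' \<omega>) = m}"
      unfolding atom_counts_eq_iff[OF m]
    proof (rule prob_num_points_eq[OF Y])
      show "finite (Pow F)" using F by simp
      show "factorial_moment M Y (Pow F) (atom F) \<kappa> =
          factorial_moment M' Y' (Pow F) (atom F) \<kappa>" for \<kappa>
        using F sets_atom[OF F] disjoint_family_atom by (intro eq) auto
    qed (use int sets_atom[OF F] disjoint_family_atom in auto)
  qed (use measurable_atom_counts[OF _ F] mY in auto)
  also have "\<dots> = emeasure M' {\<omega>\<in>space M'. \<forall>D\<in>F. emeasure (Y' \<omega>) D \<in> A D}"
    by (rule emeasure_evaluations_eq_atom_counts[OF Y(2) F, symmetric]) (rule A)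
  finally show "emeasure M {\<omega>\<in>space M. \<forall>D\<in>F. emeasure (Y \<omega>) D \<in> A D} =
        emeasure M' {\<omega>\<in>space M'. \<forall>D\<in>F. emeasure (Y' \<omega>) D \<in> A D}" .
qed

section \<open>Simple integer-valued measures are counting measures\<close>

text \<open>
  The measures of the balls around a point that is not an atom are natural numbers that decrease
  to \<open>0\<close>, so some ball has measure \<open>0\<close>; by Lindelof's theorem countably many such balls cover \<open>D\<close>.
\<close>

lemma integer_valued_no_atoms_zero:
  fixes N :: "'a::{second_countable_topology, metric_space} measure"
  assumes sets: "sets N = sets borel" and int: "\<And>D. D \<in> sets borel \<Longrightarrow> emeasure N D \<in> \<nat>"
    and "D \<in> sets borel" and no_atoms: "\<And>x. x \<in> D \<Longrightarrow> emeasure N {x} = 0"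
  shows "emeasure N D = 0"
proof -
  have fin: "emeasure N E \<noteq> \<infinity>" if "E \<in> sets borel" for E using int[OF that] by (auto simp: Nats_def)
  have "\<exists>e>0. emeasure N (ball x e) = 0" if "x \<in> D" for x
  proof -
    have lim: "(\<lambda>n. emeasure N (ball x (1 / Suc n))) \<longlonglongrightarrow> emeasure N (\<Inter>n. ball x (1 / Suc n))"
      using sets fin by (intro Lim_emeasure_decseq) (auto simp: decseq_def intro!: frac_le elim!: order.strict_trans2)
    have "(\<Inter>n. ball x (1 / Suc n)) = {x}"
    proof -
      have "y = x" if "\<forall>n. dist x y < 1 / Suc n" for y
      proof (rule ccontr)
        assume "y \<noteq> x"
        then have "0 < dist x y" by auto
        then obtain n where "1 / Suc n < dist x y" using nat_approx_posE by blast
        then show False using that[rule_format, of n] by simp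
      qed
      then show ?thesis by auto
    qed
    with lim no_atoms[OF that] have "(\<lambda>n. emeasure N (ball x (1 / Suc n))) \<longlonglongrightarrow> 0" by simp
    then have "eventually (\<lambda>n. emeasure N (ball x (1 / Suc n)) < 1) sequentially"
      by (rule order_tendstoD(2)) simp
    then obtain n where n: "emeasure N (ball x (1 / Suc n)) < 1" by (auto simp: eventually_sequentially)
    have "emeasure N (ball x (1 / Suc n)) \<in> \<nat>" by (rule int) auto
    then have "emeasure N (ball x (1 / Suc n)) = 0"
    proof (cases rule: Nats_cases)
      case (of_nat k)
      with n have "(of_nat k :: ennreal) < of_nat 1" by simp
      then have "k = 0" unfolding of_nat_less_iff by simp
      then show ?thesis using of_nat by simp
    qed
    then show ?thesis by (intro exI[of _ "1 / Suc n"]) auto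
  qed
  then obtain e where e: "\<And>x. x \<in> D \<Longrightarrow> e x > 0 \<and> emeasure N (ball x (e x)) = 0" by metis
  obtain F where F: "F \<subseteq> (\<lambda>x. ball x (e x)) ` D" "countable F" "\<Union>F = (\<Union>x\<in>D. ball x (e x))"
    using Lindelof[of "(\<lambda>x. ball x (e x)) ` D"] by auto
  have "emeasure N (\<Union>F) = 0"
  proof -
    have "(\<Union>B\<in>F. B) \<in> null_sets N"
    proof (rule null_sets_UN'[OF F(2)])
      fix B assume "B \<in> F"
      then obtain x where "x \<in> D" "B = ball x (e x)" using F(1) by auto
      then show "B \<in> null_sets N" using e sets by (intro null_setsI) auto
    qed
    then show ?thesis by auto
  qed
  moreover have "D \<subseteq> \<Union>F"
  proof
    fix x assume "x \<in> D"
    then have "x \<in> ball x (e x)" using e by simp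
    then show "x \<in> \<Union>F" unfolding F(3) using \<open>x \<in> D\<close> by blast
  qed
  moreover have "\<Union>F \<in> sets N" unfolding F(3) sets by (intro borel_open open_UN) auto
  ultimately have "emeasure N D \<le> 0" by (metis emeasure_mono)
  then show ?thesis by (rule le_zero_eq[THEN iffD1])
qed

lemma simple_integer_valued_eq_card:
  fixes N :: "'a::{second_countable_topology, metric_space} measure"
  assumes sets: "sets N = sets borel" and int: "\<And>D. D \<in> sets borel \<Longrightarrow> emeasure N D \<in> \<nat>"
    and simple: "\<And>x. emeasure N {x} \<le> 1"
  shows "finite {x. emeasure N {x} \<noteq> 0}"
    and "D \<in> sets borel \<Longrightarrow> emeasure N D = of_nat (card ({x. emeasure N {x} \<noteq> 0} \<inter> D))"
proof -
  let ?S = "{x. emeasure N {x} \<noteq> 0}"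
  have one: "emeasure N {x} = 1" if "x \<in> ?S" for x
  proof -
    have "emeasure N {x} \<in> \<nat>" by (rule int) auto
    then obtain k where k: "emeasure N {x} = of_nat k" by (auto elim: Nats_cases)
    have "k \<le> 1" using simple[of x] unfolding k of_nat_1[symmetric, where 'a = ennreal] of_nat_le_iff .
    moreover have "k \<noteq> 0" using that k by auto
    ultimately show ?thesis using k by (simp add: le_Suc_eq)
  qed
  have fin_card: "of_nat (card T) = emeasure N T" if "finite T" "T \<subseteq> ?S" for T
  proof -
    have "emeasure N T = (\<Sum>x\<in>T. emeasure N {x})"
      using that(1) sets by (intro emeasure_eq_sum_singleton) auto
    also have "\<dots> = (\<Sum>x\<in>T. 1)" 
    proof (rule sum.cong[OF refl])
      fix x assume "x \<in> T"
      with that(2) show "emeasure N {x} = 1" by (intro one) blast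
    qed
    finally show ?thesis by simp
  qed
  obtain m where m: "emeasure N UNIV = of_nat m" using int[of UNIV] by (auto elim: Nats_cases)
  show fin: "finite ?S"
  proof (rule ccontr)
    assume "infinite ?S"
    then obtain T where T: "finite T" "card T = Suc m" "T \<subseteq> ?S" by (meson infinite_arbitrarily_large)
    have "emeasure N T \<le> emeasure N UNIV" using sets by (intro emeasure_mono) auto
    then have "(of_nat (Suc m) :: ennreal) \<le> of_nat m" using fin_card[OF T(1,3)] T(2) m by simp
    then show False unfolding of_nat_le_iff by simp
  qed
  assume D: "D \<in> sets borel"
  have S: "?S \<inter> D \<in> sets borel" "?S \<in> sets borel" using fin by (auto intro!: borel_closed finite_imp_closed)
  have "emeasure N D = emeasure N ((?S \<inter> D) \<union> (D - ?S))" by (rule arg_cong[where f = "emeasure N"]) blast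
  also have "\<dots> = emeasure N (?S \<inter> D) + emeasure N (D - ?S)"
    using S D sets by (intro plus_emeasure[symmetric]) (auto intro: sets.Diff)
  also have "emeasure N (D - ?S) = 0"
    by (rule integer_valued_no_atoms_zero[OF sets int]) (use D S in \<open>auto intro: sets.Diff\<close>)
  also have "emeasure N (?S \<inter> D) = of_nat (card (?S \<inter> D))"
    using fin by (intro fin_card[symmetric]) auto
  finally show "emeasure N D = of_nat (card (?S \<inter> D))" by simp
qed

section \<open>Factorial moments from joint intensities\<close>

text \<open>
  A countable basis, enumerated.
\<close>

lemma ex_separating_sequence:
  obtains U :: "nat \<Rightarrow> 'a::{second_countable_topology, t0_space} set"
  where "\<And>i. open (U i)" "\<And>x y. x \<noteq> y \<Longrightarrow> \<exists>i. (x \<in> U i) \<noteq> (y \<in> U i)"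
proof -
  obtain B :: "'a set set" where B: "countable B" "topological_basis B"
    using ex_countable_basis by blast
  then have ne: "B \<noteq> {}" by (metis UNIV_I empty_iff open_UNIV topological_basisE)
  show ?thesis
  proof (rule that[of "from_nat_into B"])
    show "open (from_nat_into B i)" for i
      using B from_nat_into[OF ne] topological_basis_open by blast
    fix x y :: 'a assume "x \<noteq> y"
    then obtain W where W: "open W" "(x \<in> W) \<noteq> (y \<in> W)" using separation_t0[of x y] by auto
    have "\<exists>b\<in>B. (x \<in> b) \<noteq> (y \<in> b)"
    proof (cases "x \<in> W")
      case True
      obtain b where "b \<in> B" "x \<in> b" "b \<subseteq> W" using topological_basisE[OF B(2) W(1) True] .
      then show ?thesis using True W(2) by auto
    next
      case False
      then have "y \<in> W" using W(2) by simp
      obtain b where "b \<in> B" "y \<in> b" "b \<subseteq> W" using topological_basisE[OF B(2) W(1) \<open>y \<in> W\<close>] .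
      then show ?thesis using False W(2) by auto
    qed
    then obtain b where b: "b \<in> B" "(x \<in> b) \<noteq> (y \<in> b)" by blast
    obtain i where "from_nat_into B i = b" using from_nat_into_surj[OF B(1) b(1)] by blast
    with b(2) show "\<exists>i. (x \<in> from_nat_into B i) \<noteq> (y \<in> from_nat_into B i)" by blast
  qed
qed

definition distinct_tuples :: "nat \<Rightarrow> (nat \<Rightarrow> 'a set) \<Rightarrow> (nat \<Rightarrow> 'a) set" where
  "distinct_tuples k A = {x \<in> (\<Pi>\<^sub>E i\<in>{..<k}. A i). inj_on x {..<k}}"

text \<open>
  Tuples whose entries are told apart by \<open>g\<close>. They split into boxes with disjoint sides, one for
  each injective choice of values of \<open>g\<close>, and joint intensities describe such boxes.
\<close>

definition separated_tuples :: "('a \<Rightarrow> 'c) \<Rightarrow> nat \<Rightarrow> (nat \<Rightarrow> 'a set) \<Rightarrow> (nat \<Rightarrow> 'a) set" where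
  "separated_tuples g k A = {x \<in> (\<Pi>\<^sub>E i\<in>{..<k}. A i). inj_on (g \<circ> x) {..<k}}"

lemma separated_tuples_eq_Union:
  assumes "range g \<subseteq> C"
  shows "separated_tuples g k A =
    (\<Union>c\<in>distinct_tuples k (\<lambda>_. C). \<Pi>\<^sub>E i\<in>{..<k}. A i \<inter> g -` {c i})" (is "?L = ?R")
proof
  show "?L \<subseteq> ?R"
  proof
    fix x assume x: "x \<in> ?L"
    have "restrict (g \<circ> x) {..<k} \<in> distinct_tuples k (\<lambda>_. C)"
      using x assms by (auto simp: distinct_tuples_def separated_tuples_def inj_on_def)
    moreover have "x \<in> (\<Pi>\<^sub>E i\<in>{..<k}. A i \<inter> g -` {restrict (g \<circ> x) {..<k} i})"
      using x by (auto simp: separated_tuples_def PiE_iff)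
    ultimately show "x \<in> ?R" by blast
  qed
  show "?R \<subseteq> ?L"
    by (auto simp: distinct_tuples_def separated_tuples_def PiE_iff inj_on_def)
qed

lemma disjoint_cells:
  "disjoint_family_on (\<lambda>c. \<Pi>\<^sub>E i\<in>{..<k}. A i \<inter> g -` {c i}) (distinct_tuples k (\<lambda>_. C))"
proof -
  have "c = d" if "c \<in> distinct_tuples k (\<lambda>_. C)" "d \<in> distinct_tuples k (\<lambda>_. C)"
    "x \<in> (\<Pi>\<^sub>E i\<in>{..<k}. A i \<inter> g -` {c i})" "x \<in> (\<Pi>\<^sub>E i\<in>{..<k}. A i \<inter> g -` {d i})" for c d x
  proof (rule PiE_ext)
    show "c \<in> (\<Pi>\<^sub>E i\<in>{..<k}. C)" "d \<in> (\<Pi>\<^sub>E i\<in>{..<k}. C)" using that by (auto simp: distinct_tuples_def)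
    show "c i = d i" if "i \<in> {..<k}" for i
      using \<open>x \<in> (\<Pi>\<^sub>E i\<in>{..<k}. A i \<inter> g -` {c i})\<close> \<open>x \<in> (\<Pi>\<^sub>E i\<in>{..<k}. A i \<inter> g -` {d i})\<close> that
      by (auto simp: PiE_iff)
  qed
  then show ?thesis unfolding disjoint_family_on_def by blast
qed

lemma finite_distinct_tuples: "(\<And>i. i < k \<Longrightarrow> finite (A i)) \<Longrightarrow> finite (distinct_tuples k A)"
  unfolding distinct_tuples_def by (rule finite_subset[OF _ finite_PiE[of "{..<k}" A]]) auto

lemma card_separated_tuples:
  assumes "range g \<subseteq> C" "finite C" "\<And>i. i < k \<Longrightarrow> finite (A i)"
  shows "card (separated_tuples g k A) = (\<Sum>c\<in>distinct_tuples k (\<lambda>_. C). \<Prod>i<k. card (A i \<inter> g -` {c i}))"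
proof -
  have "card (separated_tuples g k A) = (\<Sum>c\<in>distinct_tuples k (\<lambda>_. C). card (\<Pi>\<^sub>E i\<in>{..<k}. A i \<inter> g -` {c i}))"
    unfolding separated_tuples_eq_Union[OF assms(1)]
  proof (rule card_UN_disjoint)
    show "finite (distinct_tuples k (\<lambda>_. C))" using assms by (intro finite_distinct_tuples)
    show "\<forall>c\<in>distinct_tuples k (\<lambda>_. C). finite (\<Pi>\<^sub>E i\<in>{..<k}. A i \<inter> g -` {c i})"
      using assms by (intro ballI finite_PiE) auto
    show "\<forall>c\<in>distinct_tuples k (\<lambda>_. C). \<forall>d\<in>distinct_tuples k (\<lambda>_. C). c \<noteq> d \<longrightarrow>
        (\<Pi>\<^sub>E i\<in>{..<k}. A i \<inter> g -` {c i}) \<inter> (\<Pi>\<^sub>E i\<in>{..<k}. A i \<inter> g -` {d i}) = {}"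
      using disjoint_cells[where A = A and g = g and k = k and C = C]
      unfolding disjoint_family_on_def .
  qed
  then show ?thesis by (simp add: card_PiE)
qed

lemma sum_indicator_cells:
  fixes A :: "nat \<Rightarrow> 'a set"
  assumes "range g \<subseteq> C" "finite C"
  shows "(\<Sum>c\<in>distinct_tuples k (\<lambda>_. C). indicator (\<Pi>\<^sub>E i\<in>{..<k}. A i \<inter> g -` {c i}) x) =
    (indicator (separated_tuples g k A) x :: ennreal)"
  unfolding separated_tuples_eq_Union[OF assms(1)]
  by (rule indicator_UN_disjoint[symmetric, OF finite_distinct_tuples disjoint_cells]) (rule assms(2))

text \<open>
  The label of the cell of \<open>x\<close> at stage \<open>m\<close>: only finitely many cells per stage, each stage refining
  the earlier ones, and any two points are separated eventually if \<open>U\<close> separates points.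
\<close>

definition cell :: "(nat \<Rightarrow> 'a set) \<Rightarrow> nat \<Rightarrow> 'a \<Rightarrow> nat set" where
  "cell U m x = {i. i < m \<and> x \<in> U i}"

lemma cell_mono: "m \<le> m' \<Longrightarrow> cell U m x \<noteq> cell U m y \<Longrightarrow> cell U m' x \<noteq> cell U m' y"
proof -
  assume "m \<le> m'"
  then have "cell U m z = cell U m' z \<inter> {..<m}" for z by (auto simp: cell_def)
  then show "cell U m x \<noteq> cell U m y \<Longrightarrow> cell U m' x \<noteq> cell U m' y" by metis
qed

lemma separated_tuples_mono:
  assumes "m \<le> m'"
  shows "separated_tuples (cell U m) k A \<subseteq> separated_tuples (cell U m') k A"
proof
  fix x assume x: "x \<in> separated_tuples (cell U m) k A"
  have "inj_on (cell U m' \<circ> x) {..<k}"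
  proof (rule inj_onI, rule ccontr)
    fix i j assume ij: "i \<in> {..<k}" "j \<in> {..<k}" "(cell U m' \<circ> x) i = (cell U m' \<circ> x) j" "i \<noteq> j"
    then have "cell U m (x i) \<noteq> cell U m (x j)" using x by (auto simp: separated_tuples_def inj_on_def)
    from cell_mono[OF assms this] show False using ij by simp
  qed
  then show "x \<in> separated_tuples (cell U m') k A" using x by (simp add: separated_tuples_def)
qed

lemma Union_separated_tuples:
  assumes U: "\<And>x y. x \<noteq> y \<Longrightarrow> \<exists>i. (x \<in> U i) \<noteq> (y \<in> U i)"
  shows "(\<Union>m. separated_tuples (cell U m) k A) = distinct_tuples k A"
proof
  show "(\<Union>m. separated_tuples (cell U m) k A) \<subseteq> distinct_tuples k A"
    by (auto simp: separated_tuples_def distinct_tuples_def inj_on_def)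
  show "distinct_tuples k A \<subseteq> (\<Union>m. separated_tuples (cell U m) k A)"
  proof
    fix x assume x: "x \<in> distinct_tuples k A"
    have "\<exists>l. x i \<noteq> x j \<longrightarrow> (x i \<in> U l) \<noteq> (x j \<in> U l)" for i j using U[of "x i" "x j"] by blast
    then obtain l where l: "\<And>i j. x i \<noteq> x j \<Longrightarrow> (x i \<in> U (l i j)) \<noteq> (x j \<in> U (l i j))" by metis
    define m where "m = Suc (Max ((\<lambda>(i, j). l i j) ` ({..<k} \<times> {..<k})))"
    have lm: "l i j < m" if "i < k" "j < k" for i j
      unfolding m_def less_Suc_eq_le using that by (intro Max_ge) auto
    have "inj_on (cell U m \<circ> x) {..<k}"
    proof (rule inj_onI, rule ccontr)
      fix i j assume ij: "i \<in> {..<k}" "j \<in> {..<k}" "(cell U m \<circ> x) i = (cell U m \<circ> x) j" "i \<noteq> j"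
      then have "x i \<noteq> x j" using x by (auto simp: distinct_tuples_def inj_on_def)
      from l[OF this] show False using ij lm[of i j] by (auto simp: cell_def set_eq_iff)
    qed
    then show "x \<in> (\<Union>m. separated_tuples (cell U m) k A)"
      using x by (auto simp: separated_tuples_def distinct_tuples_def)
  qed
qed

text \<open>
  This is continuity from below of the counting measure.
\<close>

lemma SUP_card_separated_tuples:
  assumes U: "\<And>x y. x \<noteq> y \<Longrightarrow> \<exists>i. (x \<in> U i) \<noteq> (y \<in> U i)" and fin: "\<And>i. i < k \<Longrightarrow> finite (A i)"
  shows "(SUP m. of_nat (card (separated_tuples (cell U m) k A)) :: ennreal) = of_nat (card (distinct_tuples k A))"
proof -
  let ?N = "count_space (UNIV :: (nat \<Rightarrow> 'a) set)"
  have inc: "incseq (\<lambda>m. separated_tuples (cell U m) k A)"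
    using separated_tuples_mono by (intro monoI) blast
  have sub: "separated_tuples (cell U m) k A \<subseteq> distinct_tuples k A" for m
    using Union_separated_tuples[OF U, of k A] by auto
  have f: "finite (distinct_tuples k A)" using fin by (rule finite_distinct_tuples)
  have "(SUP m. emeasure ?N (separated_tuples (cell U m) k A)) = emeasure ?N (distinct_tuples k A)"
    using SUP_emeasure_incseq[OF _ inc, of ?N] Union_separated_tuples[OF U, of k A] by simp
  then show ?thesis using f finite_subset[OF sub f] by simp
qed

text \<open>
  At each stage the expected number of separated tuples of points is a finite sum over boxes with
  disjoint sides, for which the intensity gives the value by definition. Both sides increase with the
  stage, so monotone convergence gives the claim. Simplicity of the process enters through the
  representation of \<open>X \<omega>\<close> as the counting measure of a finite set; without it, coinciding points
  would never be separated.
\<close>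

theorem factorial_moment_eq_integral_intensity:
  fixes X :: "'w \<Rightarrow> 'a::euclidean_space measure"
  assumes X: "X \<in> M \<rightarrow>\<^sub>M measure_algebra"
    and reg: "AE \<omega> in M. sets (X \<omega>) = sets borel \<and> (\<forall>D\<in>sets borel. emeasure (X \<omega>) D \<in> \<nat>) \<and>
        (\<forall>x. emeasure (X \<omega>) {x} \<le> 1)"
    and \<mu>: "sets \<mu> = sets borel" and \<rho>: "joint_intensities M X \<mu> \<rho>"
    and "1 \<le> k" and A: "\<And>i. i < k \<Longrightarrow> A i \<in> sets borel"
  shows "(\<integral>\<^sup>+\<omega>. of_nat (card (distinct_tuples k (\<lambda>i. {x. emeasure (X \<omega>) {x} \<noteq> 0} \<inter> A i))) \<partial>M) =
    (\<integral>\<^sup>+x\<in>distinct_tuples k A. ennreal (\<rho> k x) \<partial>(\<Pi>\<^sub>M i\<in>{..<k}. \<mu>))"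
proof -
  obtain U :: "nat \<Rightarrow> 'a set" where U: "\<And>i. open (U i)" "\<And>x y. x \<noteq> y \<Longrightarrow> \<exists>i. (x \<in> U i) \<noteq> (y \<in> U i)"
    using ex_separating_sequence by blast
  let ?P = "\<Pi>\<^sub>M i\<in>{..<k}. \<mu>"
  let ?S = "\<lambda>\<omega>. {x. emeasure (X \<omega>) {x} \<noteq> 0}"
  let ?T = "\<lambda>\<omega> i. ?S \<omega> \<inter> A i"
  let ?sep = "\<lambda>m. separated_tuples (cell U m) k A"
  let ?C = "\<lambda>m. distinct_tuples k (\<lambda>_. Pow {..<m :: nat})"
  let ?A = "\<lambda>m c i. A i \<inter> cell U m -` {c i}"
  have range: "range (cell U m) \<subseteq> Pow {..<m}" "finite (Pow {..<m :: nat})" for m by (auto simp: cell_def)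
  have cell_meas: "cell U m -` {s} \<in> sets borel" for m s
  proof -
    have U' [measurable]: "U i \<in> sets borel" for i using U(1) by (rule borel_open)
    have "Measurable.pred borel (\<lambda>x. \<forall>i. (i < m \<and> x \<in> U i) = (i \<in> s))" by measurable
    moreover have "cell U m -` {s} = {x. \<forall>i. (i < m \<and> x \<in> U i) = (i \<in> s)}"
      unfolding cell_def vimage_def by (simp add: set_eq_iff)
    ultimately show ?thesis by (simp add: pred_def)
  qed
  have A_meas: "?A m c i \<in> sets borel" if "i < k" for m c i
    using A[OF that] cell_meas by (rule sets.Int)
  have \<rho>_meas: "\<rho> k \<in> borel_measurable ?P" using \<rho> \<open>1 \<le> k\<close> by (auto simp: joint_intensities_def)
  have box: "(\<integral>\<^sup>+\<omega>. (\<Prod>i<k. emeasure (X \<omega>) (D i)) \<partial>M) =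
      (\<integral>\<^sup>+x. ennreal (\<rho> k x) * indicator (\<Pi>\<^sub>E i\<in>{..<k}. D i) x \<partial>?P)"
    if "\<And>i. i < k \<Longrightarrow> D i \<in> sets borel" "disjoint_family_on D {..<k}" for D
    using \<rho> \<open>1 \<le> k\<close> that by (simp add: joint_intensities_def)
  have box_meas: "(\<Pi>\<^sub>E i\<in>{..<k}. ?A m c i) \<in> sets ?P" for m c
    using A_meas \<mu> by (intro sets_PiM_I_finite) auto
  have X_meas: "(\<lambda>\<omega>. emeasure (X \<omega>) (?A m c i)) \<in> borel_measurable M" if "i < k" for m c i
    using measurable_compose[OF X measurable_emeasure_measure_algebra[OF A_meas[OF that]]] .
  have sep_meas: "?sep m \<in> sets ?P" for m
    unfolding separated_tuples_eq_Union[OF range(1)]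
    using box_meas finite_distinct_tuples[of k "\<lambda>_. Pow {..<m}"] by (intro sets.finite_UN) auto
  have Un: "(\<Union>m. ?sep m) = distinct_tuples k A"
    by (rule Union_separated_tuples[OF U(2)])
  define F where "F m \<omega> = (\<Sum>c\<in>?C m. \<Prod>i<k. emeasure (X \<omega>) (?A m c i))" for m \<omega>
  have F_meas: "F m \<in> borel_measurable M" for m
    unfolding F_def using X_meas by (intro borel_measurable_sum borel_measurable_prod) auto
  have F_int: "(\<integral>\<^sup>+\<omega>. F m \<omega> \<partial>M) = (\<integral>\<^sup>+x\<in>?sep m. ennreal (\<rho> k x) \<partial>?P)" for m
  proof -
    have "(\<integral>\<^sup>+\<omega>. F m \<omega> \<partial>M) = (\<Sum>c\<in>?C m. \<integral>\<^sup>+\<omega>. (\<Prod>i<k. emeasure (X \<omega>) (?A m c i)) \<partial>M)"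
      unfolding F_def using X_meas by (intro nn_integral_sum borel_measurable_prod) auto
    also have "\<dots> = (\<Sum>c\<in>?C m. \<integral>\<^sup>+x. ennreal (\<rho> k x) * indicator (\<Pi>\<^sub>E i\<in>{..<k}. ?A m c i) x \<partial>?P)"
    proof (rule sum.cong[OF refl])
      fix c assume "c \<in> ?C m"
      then have "disjoint_family_on (?A m c) {..<k}"
        by (auto simp: disjoint_family_on_def distinct_tuples_def inj_on_def)
      with A_meas show "(\<integral>\<^sup>+\<omega>. (\<Prod>i<k. emeasure (X \<omega>) (?A m c i)) \<partial>M) =
          (\<integral>\<^sup>+x. ennreal (\<rho> k x) * indicator (\<Pi>\<^sub>E i\<in>{..<k}. ?A m c i) x \<partial>?P)"
        by (rule box)
    qed
    also have "\<dots> = (\<integral>\<^sup>+x. (\<Sum>c\<in>?C m. ennreal (\<rho> k x) * indicator (\<Pi>\<^sub>E i\<in>{..<k}. ?A m c i) x) \<partial>?P)"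
      using \<rho>_meas box_meas by (intro nn_integral_sum[symmetric]) auto
    also have "\<dots> = (\<integral>\<^sup>+x\<in>?sep m. ennreal (\<rho> k x) \<partial>?P)"
      unfolding sum_distrib_left[symmetric] sum_indicator_cells[OF range] ..
    finally show ?thesis .
  qed
  \<comment> \<open>On a simple configuration the cell sums count separated tuples of points.\<close>
  have F_card: "AE \<omega> in M. \<forall>m. F m \<omega> = of_nat (card (separated_tuples (cell U m) k (?T \<omega>)))"
    using reg
  proof eventually_elim
    fix \<omega> assume \<omega>: "sets (X \<omega>) = sets borel \<and> (\<forall>D\<in>sets borel. emeasure (X \<omega>) D \<in> \<nat>) \<and>
        (\<forall>x. emeasure (X \<omega>) {x} \<le> 1)"
    have fin: "finite (?S \<omega>)"
      by (rule simple_integer_valued_eq_card(1)) (use \<omega> in auto)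
    have card: "emeasure (X \<omega>) D = of_nat (card (?S \<omega> \<inter> D))" if "D \<in> sets borel" for D
      by (rule simple_integer_valued_eq_card(2)) (use \<omega> that in auto)
    show "\<forall>m. F m \<omega> = of_nat (card (separated_tuples (cell U m) k (?T \<omega>)))"
    proof
      fix m
      have "F m \<omega> = (\<Sum>c\<in>?C m. \<Prod>i<k. of_nat (card (?S \<omega> \<inter> ?A m c i)))"
        unfolding F_def by (intro sum.cong prod.cong refl card A_meas) simp
      also have "\<dots> = of_nat (\<Sum>c\<in>?C m. \<Prod>i<k. card ((?S \<omega> \<inter> A i) \<inter> cell U m -` {c i}))"
        by (simp add: Int_assoc)
      also have "\<dots> = of_nat (card (separated_tuples (cell U m) k (?T \<omega>)))"
        using fin by (subst card_separated_tuples[OF range]) auto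
      finally show "F m \<omega> = of_nat (card (separated_tuples (cell U m) k (?T \<omega>)))" .
    qed
  qed
  have fin: "AE \<omega> in M. finite (?S \<omega>)"
    using reg by eventually_elim (rule simple_integer_valued_eq_card(1), auto)
  have "(\<integral>\<^sup>+\<omega>. of_nat (card (distinct_tuples k (?T \<omega>))) \<partial>M) = (\<integral>\<^sup>+\<omega>. (SUP m. F m \<omega>) \<partial>M)"
  proof (rule nn_integral_cong_AE)
    show "AE \<omega> in M. of_nat (card (distinct_tuples k (?T \<omega>))) = (SUP m. F m \<omega>)"
      using F_card fin
    proof eventually_elim
      case (elim \<omega>)
      then show ?case using SUP_card_separated_tuples[OF U(2), of k "?T \<omega>"] by simp
    qed
  qed
  also have "\<dots> = (SUP m. \<integral>\<^sup>+\<omega>. F m \<omega> \<partial>M)"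
  proof (rule nn_integral_monotone_convergence_SUP_AE)
    fix m
    show "AE \<omega> in M. F m \<omega> \<le> F (Suc m) \<omega>"
      using F_card fin
    proof eventually_elim
      case (elim \<omega>)
      have "finite (separated_tuples (cell U (Suc m)) k (?T \<omega>))"
        using elim(2) unfolding separated_tuples_def
        by (intro finite_subset[OF _ finite_PiE[of "{..<k}" "?T \<omega>"]]) auto
      then have "card (separated_tuples (cell U m) k (?T \<omega>)) \<le>
          card (separated_tuples (cell U (Suc m)) k (?T \<omega>))"
        by (intro card_mono separated_tuples_mono) auto
      then show ?case using elim(1) by simp
    qed
  qed (rule F_meas)
  also have "\<dots> = (SUP m. \<integral>\<^sup>+x\<in>?sep m. ennreal (\<rho> k x) \<partial>?P)"
    unfolding F_int ..
  also have "\<dots> = (\<integral>\<^sup>+x. (SUP m. ennreal (\<rho> k x) * indicator (?sep m) x) \<partial>?P)"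
  proof (rule nn_integral_monotone_convergence_SUP[symmetric])
    show "incseq (\<lambda>m x. ennreal (\<rho> k x) * indicator (?sep m) x)"
      using separated_tuples_mono[of _ _ U k A]
      by (intro monoI le_funI mult_left_mono) (auto simp: indicator_def)
  qed (use \<rho>_meas sep_meas in auto)
  also have "\<dots> = (\<integral>\<^sup>+x\<in>distinct_tuples k A. ennreal (\<rho> k x) \<partial>?P)"
  proof (rule nn_integral_cong)
    fix x
    have "(SUP m. ennreal (\<rho> k x) * indicator (?sep m) x) =
        ennreal (\<rho> k x) * (SUP m. indicator (?sep m) x)"
      by (rule SUP_mult_left_ennreal[symmetric])
    also have "(SUP m. indicator (?sep m) x) = (indicator (distinct_tuples k A) x :: ennreal)"
    proof (rule antisym)
      show "(SUP m. indicator (?sep m) x) \<le> (indicator (distinct_tuples k A) x :: ennreal)"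
        by (intro SUP_least) (auto simp: indicator_def Un[symmetric])
      show "(indicator (distinct_tuples k A) x :: ennreal) \<le> (SUP m. indicator (?sep m) x)"
      proof (cases "x \<in> distinct_tuples k A")
        case True
        then obtain m where "x \<in> ?sep m"
          unfolding Un[symmetric] by blast
        then show ?thesis using True by (intro SUP_upper2[of m]) auto
      qed simp
    qed
    finally show "(SUP m. ennreal (\<rho> k x) * indicator (?sep m) x) =
        ennreal (\<rho> k x) * indicator (distinct_tuples k A) x" .
  qed
  finally show ?thesis .
qed

section \<open>Integrals of determinants of radial kernels\<close>

lemma borel_measurable_cnj [measurable]: "cnj \<in> borel_measurable borel"
  by (intro borel_measurable_continuous_onI continuous_intros)

definition rotation_invariant :: "complex set \<Rightarrow> bool" where
  "rotation_invariant A \<longleftrightarrow> A \<in> sets borel \<and> (\<forall>\<theta> z. cis \<theta> * z \<in> A \<longleftrightarrow> z \<in> A)"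

text \<open>
  The reference measure and the kernel of the theorem, without the process.
\<close>

locale radial_kernel_data =
  fixes \<mu> :: "complex measure" and n :: enat and lam a :: "nat \<Rightarrow> real"
  assumes n_ge_1: "n \<ge> 1"
    and sets_\<mu> [measurable_cong, simp]: "sets \<mu> = sets borel"
    and symmetric: "radially_symmetric \<mu>"
    and a_pos: "enat k < n \<Longrightarrow> a k > 0"
    and lam01: "enat k < n \<Longrightarrow> lam k \<in> {0..1}"
    and norm_1: "enat k < n \<Longrightarrow> has_bochner_integral \<mu> (\<lambda>z. (cmod (complex_of_real (a k) * z ^ k))\<^sup>2) 1"
    and lam_summable: "lam summable_on {k. enat k < n}"
begin

abbreviation \<mu>_power :: "nat \<Rightarrow> (nat \<Rightarrow> complex) measure" where
  "\<mu>_power k \<equiv> \<Pi>\<^sub>M i\<in>{..<k}. \<mu>"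

abbreviation eigen_density :: "nat \<Rightarrow> complex \<Rightarrow> real" where
  "eigen_density k z \<equiv> (a k)\<^sup>2 * cmod z ^ (2 * k)"

text \<open>
  This will be the probability of \<open>Q\<^sub>k \<in> D\<close> when \<open>A\<close> is the preimage of \<open>D\<close> under \<open>|z|\<^sup>2\<close>.
\<close>

definition annulus_weight :: "nat \<Rightarrow> complex set \<Rightarrow> real" where
  "annulus_weight k A = (\<integral>z. indicator A z * eigen_density k z \<partial>\<mu>)"

lemma norm_1': "enat k < n \<Longrightarrow> has_bochner_integral \<mu> (\<lambda>z. eigen_density k z) 1"
  using norm_1[of k] a_pos[of k] by (simp add: norm_mult norm_power power_mult_distrib power_mult[symmetric] mult.commute[of 2])

lemma zero_less_n: "enat 0 < n"
  using n_ge_1 by (cases n) (auto simp: one_enat_def)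

lemma integrable_moment: "enat k < n \<Longrightarrow> integrable \<mu> (\<lambda>z. cmod z ^ (2 * k))"
  using norm_1'[of k] a_pos[of k] by (auto simp: has_bochner_integral_iff)

lemma space_\<mu> [simp]: "space \<mu> = UNIV"
  using sets_eq_imp_space_eq[OF sets_\<mu>] by simp

sublocale finite_measure \<mu>
proof
  \<comment> \<open>The eigenfunction of index 0 is constant and square integrable.\<close>
  have "integrable \<mu> (\<lambda>z. 1 :: real)" using integrable_moment[OF zero_less_n] by simp
  then show "emeasure \<mu> (space \<mu>) \<noteq> \<infinity>"
    by (auto simp: integrable_iff_bounded)
qed

lemma integrable_weight:
  assumes "enat k < n" and [measurable]: "A \<in> sets borel"
  shows "integrable \<mu> (\<lambda>z. indicator A z * eigen_density k z)"
  using norm_1'[OF assms(1)] by (intro integrable_mult_indicator[where 'b = real, simplified]) (auto simp: has_bochner_integral_iff)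

lemma annulus_weight_nonneg: "0 \<le> annulus_weight k A"
  unfolding annulus_weight_def by (intro Bochner_Integration.integral_nonneg) (auto simp: indicator_def)

lemma annulus_weight_le_1:
  assumes "enat k < n" "A \<in> sets borel" shows "annulus_weight k A \<le> 1"
proof -
  have "annulus_weight k A \<le> (\<integral>z. eigen_density k z \<partial>\<mu>)"
    unfolding annulus_weight_def
  proof (rule integral_mono[OF integrable_weight[OF assms]])
    show "integrable \<mu> (\<lambda>z. eigen_density k z)"
      using norm_1'[OF assms(1)] unfolding has_bochner_integral_iff by (rule conjunct1)
    show "indicator A z * eigen_density k z \<le> eigen_density k z" for z
      by (cases "z \<in> A") simp_all
  qed
  also have "\<dots> = 1" using norm_1'[OF assms(1)] unfolding has_bochner_integral_iff by (rule conjunct2)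
  finally show ?thesis .
qed

lemma integrable_monomial:
  assumes "enat p < n" "enat q < n" and [measurable]: "A \<in> sets borel"
  shows "integrable \<mu> (\<lambda>z. indicator A z * (z ^ p * cnj z ^ q) :: complex)"
proof (rule Bochner_Integration.integrable_bound)
  show "integrable \<mu> (\<lambda>z. cmod z ^ (2 * p) + cmod z ^ (2 * q))"
    using assms integrable_moment by (intro Bochner_Integration.integrable_add)
  show "(\<lambda>z. indicator A z * (z ^ p * cnj z ^ q) :: complex) \<in> borel_measurable \<mu>" by measurable
  show "AE z in \<mu>. norm (indicator A z * (z ^ p * cnj z ^ q) :: complex) \<le> norm (cmod z ^ (2 * p) + cmod z ^ (2 * q))"
  proof (rule AE_I2)
    fix z :: complex
    have "2 * (cmod z ^ p * cmod z ^ q) \<le> cmod z ^ (2 * p) + cmod z ^ (2 * q)"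
      using sum_squares_bound[of "cmod z ^ p" "cmod z ^ q"] by (simp only: power_even_eq mult.assoc)
    moreover have "0 \<le> cmod z ^ p * cmod z ^ q" by simp
    ultimately have "cmod z ^ p * cmod z ^ q \<le> cmod z ^ (2 * p) + cmod z ^ (2 * q)" by linarith
    then show "norm (indicator A z * (z ^ p * cnj z ^ q) :: complex) \<le> norm (cmod z ^ (2 * p) + cmod z ^ (2 * q))"
      by (auto simp: norm_mult norm_power indicator_def)
  qed
qed

text \<open>
  Orthogonality on rotation invariant sets: a suitable rotation preserves \<open>\<mu>\<close> and \<open>A\<close> but
  multiplies the integrand by \<open>-1\<close>.
\<close>

lemma integral_monomial:
  assumes A: "rotation_invariant A" and pq: "enat p < n" "enat q < n"
  shows "(\<integral>z. indicator A z * (z ^ p * cnj z ^ q) \<partial>\<mu>) =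
     complex_of_real (of_bool (p = q) * (\<integral>z. indicator A z * cmod z ^ (2 * p) \<partial>\<mu>))"
proof (cases "p = q")
  case True
  have zz: "z ^ p * cnj z ^ p = complex_of_real (cmod z ^ (2 * p))" for z
    by (simp add: power_mult_distrib[symmetric] complex_norm_square[symmetric] power_mult)
  have eq: "indicator A z * (z ^ p * cnj z ^ p) = complex_of_real (indicator A z * cmod z ^ (2 * p))" for z
    unfolding zz of_real_mult by (cases "z \<in> A") simp_all
  show ?thesis
    unfolding True[symmetric] eq integral_complex_of_real by simp
next
  case False
  let ?f = "\<lambda>z. indicator A z * (z ^ p * cnj z ^ q) :: complex"
  have [measurable]: "A \<in> sets borel" using A by (simp add: rotation_invariant_def)
  \<comment> \<open>Rotating by this angle multiplies the monomial by \<open>cis pi\<close>.\<close>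
  define \<theta> where "\<theta> = pi / (real p - real q)"
  have rot: "cis \<theta> ^ p * cnj (cis \<theta>) ^ q = -1"
  proof -
    have "cis \<theta> ^ p * cnj (cis \<theta>) ^ q = cis (real p * \<theta> + real q * (- \<theta>))"
      by (simp only: Complex.DeMoivre cis_cnj cis_mult)
    also have "real p * \<theta> + real q * (- \<theta>) = pi"
    proof -
      have "real p - real q \<noteq> 0" using False by simp
      moreover have "real p * \<theta> + real q * (- \<theta>) = (real p - real q) * \<theta>" by (simp add: left_diff_distrib)
      ultimately show ?thesis by (simp add: \<theta>_def)
    qed
    finally show ?thesis by simp
  qed
  have "integral\<^sup>L \<mu> ?f = integral\<^sup>L (distr \<mu> borel (\<lambda>z. cis \<theta> * z)) ?f"
    using symmetric by (simp add: radially_symmetric_def)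
  also have "\<dots> = (\<integral>z. ?f (cis \<theta> * z) \<partial>\<mu>)" by (rule integral_distr) measurable
  also have "\<dots> = (\<integral>z. - ?f z \<partial>\<mu>)"
  proof (rule Bochner_Integration.integral_cong[OF refl])
    fix z
    have "indicator A (cis \<theta> * z) = (indicator A z :: complex)"
      using A by (simp add: rotation_invariant_def indicator_def)
    moreover have "(cis \<theta> * z) ^ p * cnj (cis \<theta> * z) ^ q = (cis \<theta> ^ p * cnj (cis \<theta>) ^ q) * (z ^ p * cnj z ^ q)"
      by (simp only: power_mult_distrib complex_cnj_mult mult_ac)
    ultimately show "?f (cis \<theta> * z) = - ?f z" unfolding rot by simp
  qed
  also have "\<dots> = - integral\<^sup>L \<mu> ?f" by simp
  finally have "integral\<^sup>L \<mu> ?f = 0" by simp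
  then show ?thesis using False by simp
qed

definition truncated_kernel :: "nat \<Rightarrow> complex \<Rightarrow> complex \<Rightarrow> complex" where
  "truncated_kernel N z w = (\<Sum>k | enat k < n \<and> k < N. complex_of_real (lam k * (a k)\<^sup>2) * (z * cnj w) ^ k)"

text \<open>
  One term of the expanded determinant. Regrouping the conjugate factors by their variable turns the
  exponent \<open>t i\<close> of \<open>cnj (x (p i))\<close> into an exponent \<open>t (p\<^sup>-\<^sup>1 i)\<close> of \<open>cnj (x i)\<close>, and the integral
  factorises over the variables.
\<close>

lemma integral_prod_monomials:
  fixes k :: nat
  assumes A: "\<And>i. i < k \<Longrightarrow> rotation_invariant (A i)" and t: "\<And>i. i < k \<Longrightarrow> enat (t i) < n"
    and p: "p permutes {..<k}"
  defines "f \<equiv> \<lambda>x. \<Prod>i<k. indicator (A i) (x i) *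
    (complex_of_real (lam (t i) * (a (t i))\<^sup>2) * (x i * cnj (x (p i))) ^ t i)"
  shows "integrable (\<mu>_power k) f"
    and "(\<integral>x. f x \<partial>(\<mu>_power k)) =
      complex_of_real ((\<Prod>i<k. lam (t i) * annulus_weight (t i) (A i)) * (\<Prod>i<k. of_bool (t i = t (Hilbert_Choice.inv p i))))"
proof -
  interpret PiM: product_sigma_finite "\<lambda>_ :: nat. \<mu>" by standard
  let ?q = "Hilbert_Choice.inv p"
  have q: "?q i < k" if "i < k" for i
    using permutes_in_image[OF permutes_inv[OF p], of i] that by simp
  define g where "g = (\<lambda>i z. complex_of_real (lam (t i) * (a (t i))\<^sup>2) *
      (indicator (A i) z * (z ^ t i * cnj z ^ t (?q i))))"
  have f: "f x = (\<Prod>i<k. g i (x i))" for x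
  proof -
    have "(\<Prod>i<k. cnj (x (p i)) ^ t i) = (\<Prod>i<k. cnj (x i) ^ t (?q i))"
      using prod.permute[OF p, of "\<lambda>i. cnj (x i) ^ t (?q i)"] permutes_inverses(2)[OF p] by (simp add: o_def)
    then show ?thesis
      unfolding f_def g_def by (simp add: prod.distrib power_mult_distrib mult_ac)
  qed
  have g_int: "integrable \<mu> (g i)" if "i < k" for i
    unfolding g_def using A[OF that] t q that
    by (intro integrable_mult_right integrable_monomial) (auto simp: rotation_invariant_def)
  show "integrable (\<mu>_power k) f"
    unfolding f by (rule PiM.product_integrable_prod[of "{..<k}" g]) (use g_int in auto)
  have "(\<integral>x. f x \<partial>(\<mu>_power k)) = (\<Prod>i<k. \<integral>z. g i z \<partial>\<mu>)"
    unfolding f by (rule PiM.product_integral_prod) (use g_int in auto)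
  also have "\<dots> = (\<Prod>i<k. complex_of_real (lam (t i) * annulus_weight (t i) (A i) * of_bool (t i = t (?q i))))"
  proof (rule prod.cong[OF refl])
    fix i assume "i \<in> {..<k}"
    then have i: "i < k" by simp
    have "(\<integral>z. g i z \<partial>\<mu>) = complex_of_real (lam (t i) * (a (t i))\<^sup>2) *
        complex_of_real (of_bool (t i = t (?q i)) * (\<integral>z. indicator (A i) z * cmod z ^ (2 * t i) \<partial>\<mu>))"
      unfolding g_def using integral_monomial[OF A[OF i] t[OF i] t[OF q[OF i]]] by simp
    also have "\<dots> = complex_of_real (lam (t i) * annulus_weight (t i) (A i) * of_bool (t i = t (?q i)))"
    proof -
      have "annulus_weight (t i) (A i) = (\<integral>z. (a (t i))\<^sup>2 * (indicator (A i) z * cmod z ^ (2 * t i)) \<partial>\<mu>)"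
        unfolding annulus_weight_def by (simp add: mult_ac)
      also have "\<dots> = (a (t i))\<^sup>2 * (\<integral>z. indicator (A i) z * cmod z ^ (2 * t i) \<partial>\<mu>)" by simp
      finally show ?thesis by (simp add: mult_ac)
    qed
    finally show "(\<integral>z. g i z \<partial>\<mu>) = complex_of_real (lam (t i) * annulus_weight (t i) (A i) * of_bool (t i = t (?q i)))" .
  qed
  also have "\<dots> = complex_of_real ((\<Prod>i<k. lam (t i) * annulus_weight (t i) (A i)) * (\<Prod>i<k. of_bool (t i = t (Hilbert_Choice.inv p i))))"
    by (simp only: of_real_prod[symmetric] prod.distrib)
  finally show "(\<integral>x. f x \<partial>(\<mu>_power k)) =
      complex_of_real ((\<Prod>i<k. lam (t i) * annulus_weight (t i) (A i)) * (\<Prod>i<k. of_bool (t i = t (Hilbert_Choice.inv p i))))" .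
qed

text \<open>
  The expected number of \<open>k\<close>-tuples of distinct included indices below \<open>N\<close> whose points lie in the
  sets \<open>A\<^sub>i\<close>; both processes have the limit for \<open>N \<rightarrow> \<infinity>\<close> as factorial moment.
\<close>

definition index_moment :: "nat \<Rightarrow> nat \<Rightarrow> (nat \<Rightarrow> complex set) \<Rightarrow> real" where
  "index_moment N k A =
     (\<Sum>t\<in>distinct_tuples k (\<lambda>_. {l. enat l < n \<and> l < N}). \<Prod>i<k. lam (t i) * annulus_weight (t i) (A i))"

lemma integral_det_truncated_kernel:
  assumes A: "\<And>i. i < k \<Longrightarrow> rotation_invariant (A i)"
  shows "(\<integral>x. (\<Prod>i<k. indicator (A i) (x i)) * Determinant.det (mat k k (\<lambda>(i, j). truncated_kernel N (x i) (x j)))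
      \<partial>(\<mu>_power k)) = complex_of_real (index_moment N k A)"
proof -
  let ?P = "\<Pi>\<^sub>M i\<in>{..<k}. \<mu>"
  let ?I = "{l. enat l < n \<and> l < N}"
  let ?T = "\<Pi>\<^sub>E i\<in>{..<k}. ?I"
  let ?S = "{p. p permutes {..<k}}"
  let ?c = "\<lambda>t. \<Prod>i<k. lam (t i) * annulus_weight (t i) (A i)"
  define f where "f p t x = (\<Prod>i<k. indicator (A i) (x i) *
    (complex_of_real (lam (t i) * (a (t i))\<^sup>2) * (x i * cnj (x (p i))) ^ t i))" for p t and x :: "nat \<Rightarrow> complex"
  have fin: "finite ?S" "finite ?T" by (auto intro!: finite_permutations finite_PiE)
  have tT: "enat (t i) < n" if "t \<in> ?T" "i < k" for t i using that by (auto simp: PiE_iff)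
  have det: "(\<Prod>i<k. indicator (A i) (x i)) * Determinant.det (mat k k (\<lambda>(i, j). truncated_kernel N (x i) (x j))) =
      (\<Sum>p\<in>?S. \<Sum>t\<in>?T. signof p * f p t x)" for x
  proof -
    have "Determinant.det (mat k k (\<lambda>(i, j). truncated_kernel N (x i) (x j))) =
        (\<Sum>p\<in>?S. signof p * (\<Prod>i<k. truncated_kernel N (x i) (x (p i))))"
      unfolding Determinant.det_def
      by (auto simp: atLeast0LessThan permutes_in_image intro!: sum.cong arg_cong2[where f = "(*)"] prod.cong)
    moreover have "(\<Prod>i<k. indicator (A i) (x i)) * (\<Prod>i<k. truncated_kernel N (x i) (x (p i))) = (\<Sum>t\<in>?T. f p t x)" for p
    proof -
      have "(\<Prod>i<k. indicator (A i) (x i)) * (\<Prod>i<k. truncated_kernel N (x i) (x (p i))) =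
          (\<Prod>i<k. \<Sum>l\<in>?I. indicator (A i) (x i) * (complex_of_real (lam l * (a l)\<^sup>2) * (x i * cnj (x (p i))) ^ l))"
        unfolding truncated_kernel_def by (simp only: prod.distrib sum_distrib_left[symmetric])
      also have "\<dots> = (\<Sum>t\<in>?T. f p t x)" unfolding f_def by (rule prod_sum_PiE) auto
      finally show ?thesis .
    qed
    ultimately show ?thesis
      by (simp add: sum_distrib_left mult.left_commute[of _ "of_int _"])
  qed
  have f_int: "integrable ?P (f p t)" and
    f_val: "(\<integral>x. f p t x \<partial>?P) = complex_of_real (?c t * (\<Prod>i<k. of_bool (t i = t (Hilbert_Choice.inv p i))))"
    if "p \<in> ?S" "t \<in> ?T" for p t
    using integral_prod_monomials[of k A t p] A tT that unfolding f_def by auto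
  have "(\<integral>x. (\<Sum>p\<in>?S. \<Sum>t\<in>?T. signof p * f p t x) \<partial>?P) = (\<Sum>p\<in>?S. \<Sum>t\<in>?T. signof p * (\<integral>x. f p t x \<partial>?P))"
    using f_int by (subst Bochner_Integration.integral_sum; simp)+
  also have "\<dots> = (\<Sum>p\<in>?S. \<Sum>t\<in>?T. complex_of_real (?c t * (signof p * (\<Prod>i<k. of_bool (t i = t (Hilbert_Choice.inv p i))))))"
    using f_val by (intro sum.cong refl) simp
  also have "\<dots> = (\<Sum>t\<in>?T. \<Sum>p\<in>?S. complex_of_real (?c t * (signof p * (\<Prod>i<k. of_bool (t i = t (Hilbert_Choice.inv p i))))))"
    by (rule sum.swap)
  also have "\<dots> = complex_of_real (\<Sum>t\<in>?T. ?c t * (\<Sum>p\<in>?S. signof p * (\<Prod>i<k. of_bool (t i = t (Hilbert_Choice.inv p i)))))"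
    by (simp only: of_real_sum sum_distrib_left)
  also have "(\<Sum>t\<in>?T. ?c t * (\<Sum>p\<in>?S. signof p * (\<Prod>i<k. of_bool (t i = t (Hilbert_Choice.inv p i))))) = (\<Sum>t\<in>?T. ?c t * of_bool (inj_on t {..<k}))"
  proof (intro sum.cong refl arg_cong2[where f = "(*)"])
    fix t :: "nat \<Rightarrow> nat"
    have "(\<Sum>p\<in>?S. signof p * (\<Prod>i<k. of_bool (t i = t (Hilbert_Choice.inv p i)))) =
        (\<Sum>p\<in>?S. signof (Hilbert_Choice.inv p) * (\<Prod>i<k. of_bool (t i = t (p i))) :: real)"
      by (subst sum_permutations_inverse) (auto intro!: sum.cong simp: inv_inv_eq permutes_bij)
    also have "\<dots> = (\<Sum>p\<in>?S. signof p * (\<Prod>i<k. of_bool (t i = t (p i))))"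
    proof (intro sum.cong refl arg_cong2[where f = "(*)"])
      fix p assume "p \<in> ?S"
      then have "permutation p" by (auto simp: permutation_permutes)
      then show "signof (Hilbert_Choice.inv p) = (signof p :: real)" by (simp add: sign_inverse)
    qed
    finally show "(\<Sum>p\<in>?S. signof p * (\<Prod>i<k. of_bool (t i = t (Hilbert_Choice.inv p i)))) = (of_bool (inj_on t {..<k}) :: real)"
      using sum_sign_stabilizer[where t = t and k = k and 'b = real] by (simp add: atLeast0LessThan)
  qed
  also have "\<dots> = index_moment N k A"
    unfolding index_moment_def distinct_tuples_def using fin
    by (simp add: sum.inter_filter[symmetric] of_bool_def if_distrib cong: if_cong)
  finally show ?thesis unfolding det .
qed

end

section \<open>Kernels with infinitely many terms\<close>

context radial_kernel_data begin

definition diagonal_term :: "nat \<Rightarrow> complex \<Rightarrow> real" where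
  "diagonal_term k z = (if enat k < n then lam k * eigen_density k z else 0)"

text \<open>
  The kernel on the diagonal, as a series over all natural numbers also for finite \<open>n\<close>.
\<close>

definition diagonal :: "complex \<Rightarrow> real" where
  "diagonal z = (\<Sum>k. diagonal_term k z)"

definition lam0 :: "nat \<Rightarrow> real" where
  "lam0 k = (if enat k < n then lam k else 0)"

lemma lam0_nonneg: "0 \<le> lam0 k"
  using lam01[of k] by (simp add: lam0_def)

lemma diagonal_term_nonneg: "0 \<le> diagonal_term k z"
  using lam01[of k] by (simp add: diagonal_term_def)

lemma summable_lam0: "summable lam0"
proof -
  have "lam0 summable_on UNIV"
    using lam_summable by (subst summable_on_cong_neutral[where T = "{k. enat k < n}" and g = lam]) (auto simp: lam0_def)
  then show ?thesis by (rule summable_on_imp_summable)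
qed

lemma has_integral_diagonal_term: "has_bochner_integral \<mu> (diagonal_term k) (lam0 k)"
proof (cases "enat k < n")
  case True
  then have "diagonal_term k = (\<lambda>z. lam k * eigen_density k z)" by (auto simp: diagonal_term_def)
  moreover have "has_bochner_integral \<mu> (\<lambda>z. lam k * eigen_density k z) (lam k * 1)"
    by (intro has_bochner_integral_mult_right norm_1'[OF True])
  ultimately show ?thesis using True by (simp add: lam0_def)
next
  case False
  then have "diagonal_term k = (\<lambda>z. 0)" by (auto simp: diagonal_term_def)
  then show ?thesis using False by (simp add: lam0_def has_bochner_integral_zero)
qed

lemma diagonal_term_measurable [measurable]: "diagonal_term k \<in> borel_measurable \<mu>"
  using has_integral_diagonal_term[of k] by (auto simp: has_bochner_integral_iff)

lemma AE_summable_diagonal: "AE z in \<mu>. summable (\<lambda>k. diagonal_term k z)"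
proof -
  have "(\<integral>\<^sup>+z. (\<Sum>k. ennreal (diagonal_term k z)) \<partial>\<mu>) = (\<Sum>k. \<integral>\<^sup>+z. ennreal (diagonal_term k z) \<partial>\<mu>)"
    by (rule nn_integral_suminf) measurable
  also have "\<dots> = (\<Sum>k. ennreal (lam0 k))"
  proof (intro arg_cong[where f = suminf] ext)
    fix k
    have i: "integrable \<mu> (diagonal_term k)" "integral\<^sup>L \<mu> (diagonal_term k) = lam0 k"
      using has_integral_diagonal_term[of k] by (auto simp: has_bochner_integral_iff)
    show "(\<integral>\<^sup>+z. ennreal (diagonal_term k z) \<partial>\<mu>) = ennreal (lam0 k)"
      using nn_integral_eq_integral[OF i(1)] diagonal_term_nonneg i(2) by simp
  qed
  also have "\<dots> \<noteq> \<infinity>" by (simp add: suminf_ennreal2[OF lam0_nonneg summable_lam0])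
  finally have "AE z in \<mu>. (\<Sum>k. ennreal (diagonal_term k z)) \<noteq> \<infinity>"
    by (intro nn_integral_noteq_infinite) measurable
  then show ?thesis
    by eventually_elim (auto intro: summable_suminf_not_top diagonal_term_nonneg)
qed

lemma integrable_diagonal: "integrable \<mu> diagonal"
  unfolding diagonal_def[abs_def]
proof (rule integrable_suminf)
  show "integrable \<mu> (diagonal_term k)" for k
    using has_integral_diagonal_term[of k] by (auto simp: has_bochner_integral_iff)
  show "AE z in \<mu>. summable (\<lambda>k. norm (diagonal_term k z))"
    using AE_summable_diagonal diagonal_term_nonneg by simp
  have "(\<integral>z. norm (diagonal_term k z) \<partial>\<mu>) = lam0 k" for k
    using has_integral_diagonal_term[of k] diagonal_term_nonneg by (simp add: has_bochner_integral_iff)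
  then show "summable (\<lambda>k. \<integral>z. norm (diagonal_term k z) \<partial>\<mu>)" using summable_lam0 by simp
qed

definition kernel_term :: "nat \<Rightarrow> complex \<Rightarrow> complex \<Rightarrow> complex" where
  "kernel_term k z w = (if enat k < n then complex_of_real (lam k * (a k)\<^sup>2) * (z * cnj w) ^ k else 0)"

lemma truncated_kernel_eq_sum: "truncated_kernel N z w = (\<Sum>k<N. kernel_term k z w)"
proof -
  have "truncated_kernel N z w = (\<Sum>k\<in>{k\<in>{..<N}. enat k < n}. complex_of_real (lam k * (a k)\<^sup>2) * (z * cnj w) ^ k)"
    unfolding truncated_kernel_def by (intro sum.cong) auto
  then show ?thesis unfolding kernel_term_def by (simp only: sum.inter_filter[OF finite_lessThan])
qed

lemma norm_kernel_term: "cmod (kernel_term k z w) = sqrt (diagonal_term k z) * sqrt (diagonal_term k w)"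
proof (cases "enat k < n")
  case True
  then have l: "0 \<le> lam k" "0 < a k" using lam01 a_pos by auto
  have "diagonal_term k z * diagonal_term k w = (lam k * (a k)\<^sup>2 * (cmod z * cmod w) ^ k)\<^sup>2"
    unfolding diagonal_term_def power_even_eq using True
    by (simp only: if_True power_mult_distrib power2_eq_square mult_ac)
  then have "sqrt (diagonal_term k z) * sqrt (diagonal_term k w) = sqrt ((lam k * (a k)\<^sup>2 * (cmod z * cmod w) ^ k)\<^sup>2)"
    by (simp only: real_sqrt_mult[symmetric])
  also have "\<dots> = lam k * (a k)\<^sup>2 * (cmod z * cmod w) ^ k" using l by simp
  also have "\<dots> = cmod (kernel_term k z w)" using True l by (simp add: kernel_term_def norm_mult norm_power)
  finally show ?thesis by simp
qed (simp add: kernel_term_def diagonal_term_def)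

text \<open>
  Cauchy-Schwarz for the kernel as a sum of positive semidefinite terms.
\<close>

lemma norm_truncated_kernel_le:
  assumes "summable (\<lambda>k. diagonal_term k z)" "summable (\<lambda>k. diagonal_term k w)"
  shows "cmod (truncated_kernel N z w) \<le> sqrt (diagonal z) * sqrt (diagonal w)"
proof -
  have L2: "L2_set (\<lambda>k. sqrt (diagonal_term k u)) {..<N} \<le> sqrt (diagonal u)"
    if "summable (\<lambda>k. diagonal_term k u)" for u
    unfolding L2_set_def diagonal_def using diagonal_term_nonneg that by (simp add: sum_le_suminf)
  have "cmod (truncated_kernel N z w) \<le> (\<Sum>k<N. \<bar>sqrt (diagonal_term k z)\<bar> * \<bar>sqrt (diagonal_term k w)\<bar>)"
    unfolding truncated_kernel_eq_sum
    by (rule sum_norm_le) (simp add: norm_kernel_term diagonal_term_nonneg)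
  also have "\<dots> \<le> L2_set (\<lambda>k. sqrt (diagonal_term k z)) {..<N} * L2_set (\<lambda>k. sqrt (diagonal_term k w)) {..<N}"
    by (rule L2_set_mult_ineq)
  also have "\<dots> \<le> sqrt (diagonal z) * sqrt (diagonal w)"
    using assms L2 by (intro mult_mono) (auto simp: diagonal_def suminf_nonneg diagonal_term_nonneg)
  finally show ?thesis .
qed

lemma truncated_kernel_tendsto:
  assumes "summable (\<lambda>k. diagonal_term k z)" "summable (\<lambda>k. diagonal_term k w)"
  shows "(\<lambda>N. truncated_kernel N z w) \<longlonglongrightarrow> radial_kernel n lam a z w"
proof -
  have summ: "summable (\<lambda>k. norm (kernel_term k z w))"
  proof (rule summable_comparison_test'[OF summable_add[OF assms]])
    fix k
    have "2 * sqrt (diagonal_term k z) * sqrt (diagonal_term k w) \<le> diagonal_term k z + diagonal_term k w"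
      using sum_squares_bound[of "sqrt (diagonal_term k z)" "sqrt (diagonal_term k w)"]
      by (simp add: diagonal_term_nonneg)
    moreover have "0 \<le> sqrt (diagonal_term k z) * sqrt (diagonal_term k w)" by (simp add: diagonal_term_nonneg)
    ultimately show "norm (norm (kernel_term k z w)) \<le> diagonal_term k z + diagonal_term k w"
      unfolding real_norm_def abs_norm_cancel norm_kernel_term by linarith
  qed
  have sums: "(\<lambda>k. kernel_term k z w) sums (\<Sum>k. kernel_term k z w)"
    using summable_norm_cancel[OF summ] by (rule summable_sums)
  have "radial_kernel n lam a z w = (\<Sum>\<^sub>\<infinity>k. kernel_term k z w)"
    unfolding radial_kernel_def by (rule infsum_cong_neutral) (auto simp: kernel_term_def)
  also have "\<dots> = (\<Sum>k. kernel_term k z w)"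
    using norm_summable_imp_has_sum[OF summ sums] by (rule infsumI)
  finally show ?thesis using sums unfolding truncated_kernel_eq_sum sums_def by simp
qed

lemma AE_component:
  fixes k :: nat
  assumes P: "AE z in \<mu>. P z" and "i < k"
  shows "AE x in (\<mu>_power k). P (x i)"
proof -
  interpret PiM: product_sigma_finite "\<lambda>_ :: nat. \<mu>" by standard
  obtain N where N: "\<And>z. z \<notin> N \<Longrightarrow> P z" "N \<in> null_sets \<mu>" using AE_E3[OF P] by (metis DiffI UNIV_I space_\<mu>)
  have N0: "N \<in> sets \<mu>" "emeasure \<mu> N = 0" using N(2) by auto
  let ?B = "\<lambda>j. if j = i then N else UNIV"
  have B: "?B j \<in> sets \<mu>" for j using N0 by simp
  have "emeasure (\<mu>_power k) (Pi\<^sub>E {..<k} ?B) = (\<Prod>j<k. emeasure \<mu> (?B j))"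
    by (rule PiM.emeasure_PiM) (use B in auto)
  also have "\<dots> = 0" by (rule prod_zero) (use N0 \<open>i < k\<close> in \<open>auto intro!: bexI[of _ i]\<close>)
  finally have "Pi\<^sub>E {..<k} ?B \<in> null_sets (\<mu>_power k)"
    by (rule null_setsI) (rule sets_PiM_I_finite[OF finite_lessThan B])
  moreover have "{x \<in> space (\<mu>_power k). \<not> P (x i)} \<subseteq> Pi\<^sub>E {..<k} ?B"
  proof
    fix x assume x: "x \<in> {x \<in> space (\<mu>_power k). \<not> P (x i)}"
    then have "x i \<in> N" using N(1) by auto
    moreover have "x \<in> extensional {..<k}" using x by (simp add: space_PiM PiE_def)
    ultimately show "x \<in> Pi\<^sub>E {..<k} ?B" by (simp add: PiE_def Pi_def)
  qed
  ultimately show ?thesis by (rule AE_I')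
qed

lemma AE_summable_diagonal_components:
  fixes k :: nat
  shows "AE x in (\<mu>_power k). \<forall>i\<in>{..<k}. summable (\<lambda>l. diagonal_term l (x i))"
  using AE_component[OF AE_summable_diagonal] by (intro AE_finite_allI) auto

lemma lam_weight_nonneg: "enat l < n \<Longrightarrow> 0 \<le> lam l * annulus_weight l A"
  using lam01[of l] annulus_weight_nonneg by simp

lemma index_moment_le:
  assumes A: "\<And>i. i < k \<Longrightarrow> A i \<in> sets borel"
  shows "index_moment N k A \<le> suminf lam0 ^ k"
proof -
  let ?I = "{l. enat l < n \<and> l < N}"
  have "index_moment N k A \<le> (\<Sum>t\<in>(\<Pi>\<^sub>E i\<in>{..<k}. ?I). \<Prod>i<k. lam (t i) * annulus_weight (t i) (A i))"
    unfolding index_moment_def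
  proof (intro sum_mono2 prod_nonneg)
    show "finite (\<Pi>\<^sub>E i\<in>{..<k}. ?I)" by (intro finite_PiE) auto
    show "distinct_tuples k (\<lambda>_. ?I) \<subseteq> (\<Pi>\<^sub>E i\<in>{..<k}. ?I)" by (auto simp: distinct_tuples_def)
    fix t i assume "t \<in> (\<Pi>\<^sub>E i\<in>{..<k}. ?I) - distinct_tuples k (\<lambda>_. ?I)" "i \<in> {..<k}"
    then have "enat (t i) < n" by (auto simp: PiE_iff)
    then show "0 \<le> lam (t i) * annulus_weight (t i) (A i)" by (rule lam_weight_nonneg)
  qed
  also have "\<dots> \<le> (\<Sum>t\<in>(\<Pi>\<^sub>E i\<in>{..<k}. ?I). \<Prod>i<k. lam (t i))"
  proof (intro sum_mono prod_mono conjI)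
    fix t i assume ti: "t \<in> (\<Pi>\<^sub>E i\<in>{..<k}. ?I)" "i \<in> {..<k}"
    then have l: "enat (t i) < n" by auto
    show "0 \<le> lam (t i) * annulus_weight (t i) (A i)" by (rule lam_weight_nonneg[OF l])
    have "lam (t i) * annulus_weight (t i) (A i) \<le> lam (t i) * 1"
      using lam01[OF l] annulus_weight_le_1[OF l] A ti by (intro mult_left_mono) auto
    then show "lam (t i) * annulus_weight (t i) (A i) \<le> lam (t i)" by simp
  qed
  also have "\<dots> = (\<Prod>i<k. \<Sum>l\<in>?I. lam l)" by (rule prod_sum_PiE[symmetric]) auto
  also have "\<dots> = (\<Sum>l\<in>?I. lam l) ^ k" by simp
  also have "\<dots> \<le> suminf lam0 ^ k"
  proof (rule power_mono)
    have "(\<Sum>l\<in>?I. lam l) = (\<Sum>l\<in>?I. lam0 l)" by (intro sum.cong) (auto simp: lam0_def)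
    also have "\<dots> \<le> suminf lam0" using summable_lam0 lam0_nonneg by (intro sum_le_suminf) auto
    finally show "(\<Sum>l\<in>?I. lam l) \<le> suminf lam0" .
    show "0 \<le> (\<Sum>l\<in>?I. lam l)" using lam01 by (intro sum_nonneg) auto
  qed
  finally show ?thesis .
qed

text \<open>
  The determinant of the truncated kernel is dominated by \<open>fact k * (\<Prod>i<k. diagonal (x i))\<close>, because
  in each term of its expansion every variable occurs once as first and once as second argument.
  The restriction to distinct tuples costs nothing: if two points coincide, the matrix has two equal
  rows.
\<close>

theorem integral_intensity_eq_limit:
  fixes \<rho> :: "(nat \<Rightarrow> complex) \<Rightarrow> real"
  assumes \<rho>: "\<rho> \<in> borel_measurable (\<mu>_power k)" "\<And>x. 0 \<le> \<rho> x"
    and det: "AE x in (\<mu>_power k).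
           complex_of_real (\<rho> x) = Determinant.det (mat k k (\<lambda>(i, j). radial_kernel n lam a (x i) (x j)))"
    and A: "\<And>i. i < k \<Longrightarrow> rotation_invariant (A i)"
  shows "(\<lambda>N. ennreal (index_moment N k A)) \<longlonglongrightarrow> (\<integral>\<^sup>+x\<in>distinct_tuples k A. ennreal (\<rho> x) \<partial>(\<mu>_power k))"
proof -
  let ?P = "\<Pi>\<^sub>M i\<in>{..<k}. \<mu>"
  interpret PiM: product_sigma_finite "\<lambda>_ :: nat. \<mu>" by standard
  let ?ind = "\<lambda>x :: nat \<Rightarrow> complex. \<Prod>i<k. indicator (A i) (x i) :: real"
  let ?cind = "\<lambda>x :: nat \<Rightarrow> complex. \<Prod>i<k. indicator (A i) (x i) :: complex"
  let ?K = "\<lambda>x. mat k k (\<lambda>(i, j). radial_kernel n lam a (x i) (x j))"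
  let ?KN = "\<lambda>N x. mat k k (\<lambda>(i, j). truncated_kernel N (x i) (x j))"
  let ?S = "{p. p permutes {..<k}}"
  have A_meas [measurable]: "A i \<in> sets borel" if "i < k" for i using A[OF that] by (simp add: rotation_invariant_def)
  have det_perm: "Determinant.det (mat k k (\<lambda>(i, j). B (x i) (x j))) = (\<Sum>p\<in>?S. signof p * (\<Prod>i<k. B (x i) (x (p i))))"
    for B :: "complex \<Rightarrow> complex \<Rightarrow> complex" and x :: "nat \<Rightarrow> complex"
    unfolding Determinant.det_def
    by (auto simp: atLeast0LessThan permutes_in_image intro!: sum.cong arg_cong2[where f = "(*)"] prod.cong)
  have pk: "p i < k" if "p \<in> ?S" "i < k" for p i using permutes_in_image[of p "{..<k}" i] that by auto
  have cind: "?cind x = complex_of_real (?ind x)" for x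
    unfolding of_real_prod by (intro prod.cong refl) (simp add: indicator_def)
  have cind_le: "cmod (?cind x) \<le> 1" for x
    unfolding cind norm_of_real by (auto intro!: prod_le_1 simp: abs_prod)
  have dom_int: "integrable ?P (\<lambda>x. fact k * (\<Prod>i<k. diagonal (x i)))"
    by (intro integrable_mult_right PiM.product_integrable_prod[of "{..<k}" "\<lambda>_. diagonal"] integrable_diagonal) auto
  have comp: "(\<lambda>x. x i) \<in> borel_measurable ?P" if "i < k" for i
    using measurable_component_singleton[of i "{..<k}" "\<lambda>_. \<mu>"] that
    by (simp add: measurable_cong_sets[OF refl sets_\<mu>])
  have trunc_meas: "(\<lambda>x. truncated_kernel N (x i) (x j)) \<in> borel_measurable ?P" if "i < k" "j < k" for N i j
  proof -
    have [measurable]: "(\<lambda>x. x i) \<in> borel_measurable ?P" "(\<lambda>x. x j) \<in> borel_measurable ?P" using comp that by auto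
    show ?thesis unfolding truncated_kernel_def by measurable
  qed
  have cind_meas: "?cind \<in> borel_measurable ?P" and ind_meas: "?ind \<in> borel_measurable ?P"
  proof -
    have "(\<lambda>x. indicator (A i) (x i) :: complex) \<in> borel_measurable ?P"
      "(\<lambda>x. indicator (A i) (x i) :: real) \<in> borel_measurable ?P" if "i < k" for i
      using measurable_compose[OF comp[OF that] borel_measurable_indicator[OF A_meas[OF that]]] by auto
    then show "?cind \<in> borel_measurable ?P" "?ind \<in> borel_measurable ?P"
      by (intro borel_measurable_prod; simp)+
  qed
  have lim: "(\<lambda>N. \<integral>x. ?cind x * Determinant.det (?KN N x) \<partial>?P) \<longlonglongrightarrow> (\<integral>x. ?cind x * complex_of_real (\<rho> x) \<partial>?P)"
    and int: "integrable ?P (\<lambda>x. ?cind x * complex_of_real (\<rho> x))"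
  proof -
    have 1: "(\<lambda>x. ?cind x * complex_of_real (\<rho> x)) \<in> borel_measurable ?P" using cind_meas \<rho>(1) by measurable
    have 2: "(\<lambda>x. ?cind x * Determinant.det (?KN N x)) \<in> borel_measurable ?P" for N
      unfolding det_perm using cind_meas trunc_meas pk
      by (intro borel_measurable_times borel_measurable_sum borel_measurable_prod borel_measurable_const) auto
    have 3: "AE x in ?P. (\<lambda>N. ?cind x * Determinant.det (?KN N x)) \<longlonglongrightarrow> ?cind x * complex_of_real (\<rho> x)"
      using det AE_summable_diagonal_components
    proof eventually_elim
      case (elim x)
      have "(\<lambda>N. Determinant.det (?KN N x)) \<longlonglongrightarrow> Determinant.det (?K x)"
        unfolding det_perm using elim(2) pk
        by (intro tendsto_sum tendsto_mult tendsto_const tendsto_prod truncated_kernel_tendsto) auto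
      then show ?case unfolding elim(1) by (intro tendsto_mult tendsto_const)
    qed
    have 4: "AE x in ?P. norm (?cind x * Determinant.det (?KN N x)) \<le> fact k * (\<Prod>i<k. diagonal (x i))" for N
      using AE_summable_diagonal_components
    proof eventually_elim
      case (elim x)
      have diag0: "0 \<le> diagonal (x i)" if "i < k" for i
        using elim that unfolding diagonal_def by (intro suminf_nonneg diagonal_term_nonneg) auto
      have "cmod (Determinant.det (?KN N x)) \<le> (\<Sum>p\<in>?S. \<Prod>i<k. diagonal (x i))"
        unfolding det_perm
      proof (rule sum_norm_le)
        fix p assume p: "p \<in> ?S"
        have "cmod (signof p * (\<Prod>i<k. truncated_kernel N (x i) (x (p i)))) = (\<Prod>i<k. cmod (truncated_kernel N (x i) (x (p i))))"
          by (simp add: norm_mult prod_norm sign_def)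
        also have "\<dots> \<le> (\<Prod>i<k. sqrt (diagonal (x i)) * sqrt (diagonal (x (p i))))"
          using elim pk[OF p] by (intro prod_mono conjI norm_truncated_kernel_le) auto
        also have "\<dots> = (\<Prod>i<k. sqrt (diagonal (x i))) * (\<Prod>i<k. sqrt (diagonal (x (p i))))" by (rule prod.distrib)
        also have "(\<Prod>i<k. sqrt (diagonal (x (p i)))) = (\<Prod>i<k. sqrt (diagonal (x i)))"
          using prod.permute[of p "{..<k}" "\<lambda>i. sqrt (diagonal (x i))"] p by (simp add: o_def)
        also have "(\<Prod>i<k. sqrt (diagonal (x i))) * (\<Prod>i<k. sqrt (diagonal (x i))) = (\<Prod>i<k. diagonal (x i))"
          using diag0 by (simp add: prod.distrib[symmetric])
        finally show "cmod (signof p * (\<Prod>i<k. truncated_kernel N (x i) (x (p i)))) \<le> (\<Prod>i<k. diagonal (x i))" .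
      qed
      also have "\<dots> = fact k * (\<Prod>i<k. diagonal (x i))"
        by (simp add: card_permutations[of "{..<k}" k])
      finally have b: "cmod (Determinant.det (?KN N x)) \<le> fact k * (\<Prod>i<k. diagonal (x i))" .
      have "norm (?cind x * Determinant.det (?KN N x)) \<le> 1 * cmod (Determinant.det (?KN N x))"
        unfolding norm_mult by (intro mult_right_mono cind_le) auto
      with b show ?case by simp
    qed
    show "(\<lambda>N. \<integral>x. ?cind x * Determinant.det (?KN N x) \<partial>?P) \<longlonglongrightarrow> (\<integral>x. ?cind x * complex_of_real (\<rho> x) \<partial>?P)"
      by (rule integral_dominated_convergence[OF 1 2 dom_int 3 4])
    show "integrable ?P (\<lambda>x. ?cind x * complex_of_real (\<rho> x))"
      by (rule integrable_dominated_convergence[OF 1 2 dom_int 3 4])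
  qed
  have rint: "integrable ?P (\<lambda>x. ?ind x * \<rho> x)"
    using int unfolding cind of_real_mult[symmetric] complex_of_real_integrable_eq .
  have "(\<lambda>N. complex_of_real (index_moment N k A)) \<longlonglongrightarrow> complex_of_real (\<integral>x. ?ind x * \<rho> x \<partial>?P)"
  proof -
    have "(\<integral>x. ?cind x * complex_of_real (\<rho> x) \<partial>?P) = complex_of_real (\<integral>x. ?ind x * \<rho> x \<partial>?P)"
      unfolding cind of_real_mult[symmetric] by (rule integral_complex_of_real)
    moreover have "(\<integral>x. ?cind x * Determinant.det (?KN N x) \<partial>?P) = complex_of_real (index_moment N k A)" for N
      by (rule integral_det_truncated_kernel[OF A])
    ultimately show ?thesis using lim by (simp only:)
  qed
  then have "(\<lambda>N. index_moment N k A) \<longlonglongrightarrow> (\<integral>x. ?ind x * \<rho> x \<partial>?P)"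
    by (simp only: tendsto_of_real_iff)
  then have "(\<lambda>N. ennreal (index_moment N k A)) \<longlonglongrightarrow> ennreal (\<integral>x. ?ind x * \<rho> x \<partial>?P)"
    by (rule tendsto_ennrealI)
  also have "ennreal (\<integral>x. ?ind x * \<rho> x \<partial>?P) = (\<integral>\<^sup>+x. ennreal (?ind x * \<rho> x) \<partial>?P)"
    using rint \<rho>(2) by (intro nn_integral_eq_integral[symmetric]) (auto intro!: mult_nonneg_nonneg prod_nonneg)
  also have "\<dots> = (\<integral>\<^sup>+x\<in>distinct_tuples k A. ennreal (\<rho> x) \<partial>?P)"
  proof (rule nn_integral_cong_AE)
    show "AE x in ?P. ennreal (?ind x * \<rho> x) = ennreal (\<rho> x) * indicator (distinct_tuples k A) x"
      using det AE_space
    proof eventually_elim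
      case (elim x)
      have ext: "x \<in> extensional {..<k}" using elim(2) by (auto simp: space_PiM PiE_iff)
      show ?case
      proof (cases "inj_on x {..<k}")
        case True
        have "?ind x = indicator (distinct_tuples k A) x"
        proof (cases "\<forall>i<k. x i \<in> A i")
          case True
          then have "x \<in> distinct_tuples k A" using ext \<open>inj_on x {..<k}\<close> by (auto simp: distinct_tuples_def PiE_iff)
          then show ?thesis using True by simp
        next
          case False
          then have "x \<notin> distinct_tuples k A" by (auto simp: distinct_tuples_def PiE_iff)
          moreover obtain i where "i < k" "x i \<notin> A i" using False by auto
          then have "?ind x = 0" by (intro prod_zero bexI[of _ i]) auto
          ultimately show ?thesis by simp
        qed
        then show ?thesis by (simp add: indicator_def)
      next
        case False
        then obtain i j where ij: "i < k" "j < k" "i \<noteq> j" "x i = x j" by (auto simp: inj_on_def)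
        have "row (?K x) i = row (?K x) j" using ij by (intro eq_vecI) auto
        then have "Determinant.det (?K x) = 0"
          using det_identical_rows[of "?K x" k, OF _ ij(3,1,2)] by simp
        then have "\<rho> x = 0" using elim(1) by simp
        then show ?thesis by simp
      qed
    qed
  qed
  finally show ?thesis .
qed

end

section \<open>The thinned process\<close>

lemma radial_construction_prob_space: "radial_construction \<mu> n lam a P Z Q B \<Longrightarrow> prob_space P"
  by (simp add: radial_construction_def)

lemma radial_construction_indep:
  "radial_construction \<mu> n lam a P Z Q B \<Longrightarrow>
    prob_space.indep_vars P (\<lambda>_. borel) (case_sum Q (\<lambda>k \<omega>. of_bool (B k \<omega>))) ({k. enat k < n} <+> {k. enat k < n})"
  by (simp add: radial_construction_def)

lemma radial_construction_measurable:
  assumes "radial_construction \<mu> n lam a P Z Q B" and "enat k < n"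
  shows "Q k \<in> borel_measurable P" "Measurable.pred P (B k)"
proof -
  interpret P: prob_space P using assms(1) by (rule radial_construction_prob_space)
  have rv: "case_sum Q (\<lambda>k \<omega>. of_bool (B k \<omega>)) j \<in> borel_measurable P"
    if "j \<in> {k. enat k < n} <+> {k. enat k < n}" for j
    using radial_construction_indep[OF assms(1)] that by (simp add: P.indep_vars_def)
  show "Q k \<in> borel_measurable P" using rv[of "Inl k"] assms(2) by auto
  have [measurable]: "(\<lambda>\<omega>. of_bool (B k \<omega>) :: real) \<in> borel_measurable P" using rv[of "Inr k"] assms(2) by auto
  have "Measurable.pred P (\<lambda>\<omega>. (of_bool (B k \<omega>) :: real) = 1)" by measurable
  then show "Measurable.pred P (B k)" by simp
qed

text \<open>
  The included indices whose point lies in \<open>D\<close>. Indices are counted rather than points, so that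
  coinciding points keep their multiplicity.
\<close>

definition included :: "enat \<Rightarrow> (nat \<Rightarrow> 's \<Rightarrow> real) \<Rightarrow> (nat \<Rightarrow> 's \<Rightarrow> bool) \<Rightarrow> 's \<Rightarrow> real set \<Rightarrow> nat set" where
  "included n Q B \<omega> D = {l. enat l < n \<and> B l \<omega> \<and> Q l \<omega> \<in> D}"

lemma sets_thinned_process [simp]: "sets (thinned_process n Q B \<omega>) = sets borel"
  by (simp add: thinned_process_def)

lemma emeasure_thinned_process:
  "D \<in> sets borel \<Longrightarrow> emeasure (thinned_process n Q B \<omega>) D = emeasure (count_space UNIV) (included n Q B \<omega> D)"
proof -
  assume D: "D \<in> sets borel"
  have "(\<lambda>k. Q k \<omega>) -` D \<inter> {k. enat k < n \<and> B k \<omega>} = included n Q B \<omega> D" by (auto simp: included_def)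
  then show ?thesis
    unfolding thinned_process_def using D by (simp add: emeasure_distr emeasure_count_space included_def Collect_mono subset_eq)
qed

lemma measurable_thinned_process:
  assumes rc: "radial_construction \<mu> n lam a P Z Q B"
  shows "thinned_process n Q B \<in> P \<rightarrow>\<^sub>M measure_algebra"
proof (rule measurable_measure_algebraI)
  fix D :: "real set" assume D [measurable]: "D \<in> sets borel"
  have "emeasure (thinned_process n Q B \<omega>) D = (\<Sum>l. if enat l < n \<and> B l \<omega> \<and> Q l \<omega> \<in> D then 1 else 0)" for \<omega>
  proof -
    have "emeasure (thinned_process n Q B \<omega>) D = (\<integral>\<^sup>+l. indicator (included n Q B \<omega> D) l \<partial>count_space UNIV)"
      by (simp add: emeasure_thinned_process[OF D])
    also have "\<dots> = (\<Sum>l. indicator (included n Q B \<omega> D) l)" by (rule nn_integral_count_space_nat)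
    finally show ?thesis by (simp add: indicator_def included_def of_bool_def)
  qed
  then have eq: "(\<lambda>\<omega>. emeasure (thinned_process n Q B \<omega>) D) =
      (\<lambda>\<omega>. \<Sum>l. if enat l < n \<and> B l \<omega> \<and> Q l \<omega> \<in> D then 1 else 0)" by (rule ext)
  have "(\<lambda>\<omega>. if enat l < n \<and> B l \<omega> \<and> Q l \<omega> \<in> D then 1 else 0 :: ennreal) \<in> borel_measurable P" for l
  proof (cases "enat l < n")
    case True
    note [measurable] = radial_construction_measurable[OF rc True]
    show ?thesis by measurable
  qed simp
  then show "(\<lambda>\<omega>. emeasure (thinned_process n Q B \<omega>) D) \<in> borel_measurable P"
    unfolding eq by (rule borel_measurable_suminf_order)
qed simp

context radial_kernel_data begin

abbreviation sq_annulus :: "real set \<Rightarrow> complex set" where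
  "sq_annulus D \<equiv> {z. (cmod z)\<^sup>2 \<in> D}"

lemma sets_sq_annulus: "D \<in> sets borel \<Longrightarrow> sq_annulus D \<in> sets borel"
proof -
  assume [measurable]: "D \<in> sets borel"
  have "Measurable.pred borel (\<lambda>z :: complex. (cmod z)\<^sup>2 \<in> D)" by measurable
  then show ?thesis by (simp add: pred_def)
qed

lemma rotation_invariant_sq_annulus: "D \<in> sets borel \<Longrightarrow> rotation_invariant (sq_annulus D)"
  by (auto simp: rotation_invariant_def norm_mult sets_sq_annulus)

text \<open>
  The squared modulus of the normalised eigenfunction, as a probability density with respect to \<open>\<mu>\<close>.
\<close>

definition tilted_law :: "nat \<Rightarrow> complex measure" where
  "tilted_law k = density \<mu> (\<lambda>z. ennreal (eigen_density k z))"

definition radial_law :: "nat \<Rightarrow> real measure" where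
  "radial_law k = distr (tilted_law k) borel (\<lambda>z. (cmod z)\<^sup>2)"

lemma emeasure_UNIV_\<mu>: "1 / emeasure \<mu> UNIV = ennreal ((a 0)\<^sup>2)"
proof -
  have "(a 0)\<^sup>2 * measure \<mu> UNIV = 1"
    using norm_1'[OF zero_less_n] by (simp add: has_bochner_integral_iff mult.commute)
  moreover have "0 < a 0" by (rule a_pos[OF zero_less_n])
  ultimately have m: "measure \<mu> UNIV = 1 / (a 0)\<^sup>2" by (simp add: field_simps)
  have "1 / emeasure \<mu> UNIV = ennreal 1 / ennreal (1 / (a 0)\<^sup>2)" by (simp add: emeasure_eq_measure m)
  also have "\<dots> = ennreal (1 / (1 / (a 0)\<^sup>2))" using \<open>0 < a 0\<close> by (intro divide_ennreal) auto
  finally show ?thesis by simp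
qed

lemma radial_law_Suc:
  assumes "enat (Suc k) < n"
  shows "radial_law (Suc k) = density (radial_law k) (\<lambda>q. ennreal ((a (Suc k))\<^sup>2 / (a k)\<^sup>2 * q))"
proof -
  let ?c = "(a (Suc k))\<^sup>2 / (a k)\<^sup>2"
  have "enat k < n" using assms by (meson enat_ord_simps(2) lessI less_trans)
  then have a: "0 < a k" by (rule a_pos)
  have "density (radial_law k) (\<lambda>q. ennreal (?c * q)) =
      distr (density (density \<mu> (\<lambda>z. ennreal (eigen_density k z)))
        (\<lambda>z. ennreal (?c * (cmod z)\<^sup>2))) borel (\<lambda>z. (cmod z)\<^sup>2)"
    unfolding radial_law_def tilted_law_def by (rule density_distr) measurable
  also have "density (density \<mu> (\<lambda>z. ennreal (eigen_density k z)))
        (\<lambda>z. ennreal (?c * (cmod z)\<^sup>2)) =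
      density \<mu> (\<lambda>z. ennreal (eigen_density k z) * ennreal (?c * (cmod z)\<^sup>2))"
    by (rule density_density_eq) measurable
  also have "\<dots> = density \<mu> (\<lambda>z. ennreal ((a (Suc k))\<^sup>2 * cmod z ^ (2 * Suc k)))"
  proof (rule arg_cong[where f = "density \<mu>"], rule ext)
    fix z :: complex
    have "eigen_density k z * (?c * (cmod z)\<^sup>2) = (a (Suc k))\<^sup>2 * cmod z ^ (2 * Suc k)"
      using a by (simp add: field_simps power2_eq_square)
    then show "ennreal (eigen_density k z) * ennreal (?c * (cmod z)\<^sup>2) =
        ennreal ((a (Suc k))\<^sup>2 * cmod z ^ (2 * Suc k))"
      by (subst ennreal_mult[symmetric]) simp_all
  qed
  finally show ?thesis unfolding radial_law_def tilted_law_def by simp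
qed

text \<open>
  In the density of \<open>Q k\<close> all normalising constants but the last cancel.
\<close>

lemma law_Q:
  assumes rc: "radial_construction \<mu> n lam a P Z Q B" and "enat k < n"
  shows "distr P borel (Q k) = radial_law k"
  using \<open>enat k < n\<close>
proof (induction k)
  case 0
  have Z: "Z \<in> borel_measurable P" "distr P borel Z = scale_measure (ennreal ((a 0)\<^sup>2)) \<mu>"
    using rc by (auto simp: radial_construction_def emeasure_UNIV_\<mu>)
  have "distr P borel (Q 0) = distr P borel (\<lambda>\<omega>. (cmod (Z \<omega>))\<^sup>2)"
    using rc by (intro distr_cong) (auto simp: radial_construction_def)
  also have "\<dots> = distr (distr P borel Z) borel (\<lambda>z. (cmod z)\<^sup>2)"
    using Z(1) by (subst distr_distr) (auto simp: comp_def)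
  also have "distr P borel Z = density \<mu> (\<lambda>z. ennreal ((a 0)\<^sup>2 * cmod z ^ (2 * 0)))"
    unfolding Z(2) by (rule measure_eqI) (simp_all add: emeasure_density_const)
  finally show ?case unfolding radial_law_def tilted_law_def .
next
  case (Suc k)
  then have k: "enat k < n" by (meson enat_ord_simps(2) lessI less_trans)
  have "distr P borel (Q (Suc k)) = density (distr P borel (Q k)) (\<lambda>q. ennreal ((a (Suc k))\<^sup>2 / (a k)\<^sup>2 * q))"
  proof -
    have "\<forall>k. 1 \<le> k \<and> enat k < n \<longrightarrow> distr P borel (Q k) =
        density (distr P borel (Q (k - 1))) (\<lambda>q. ennreal ((a k)\<^sup>2 / (a (k - 1))\<^sup>2 * q))"
      using rc by (simp add: radial_construction_def)
    from this[rule_format, of "Suc k"] show ?thesis using Suc.prems by simp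
  qed
  also have "distr P borel (Q k) = radial_law k" by (rule Suc.IH[OF k])
  also have "density (radial_law k) (\<lambda>q. ennreal ((a (Suc k))\<^sup>2 / (a k)\<^sup>2 * q)) = radial_law (Suc k)"
    by (rule radial_law_Suc[OF Suc.prems, symmetric])
  finally show ?case .
qed

lemma emeasure_radial_law:
  assumes "enat k < n" and D [measurable]: "D \<in> sets borel"
  shows "emeasure (radial_law k) D = ennreal (annulus_weight k (sq_annulus D))"
proof -
  have [measurable]: "sq_annulus D \<in> sets \<mu>" using sets_sq_annulus[OF D] by simp
  have "emeasure (radial_law k) D = emeasure (density \<mu> (\<lambda>z. ennreal (eigen_density k z))) (sq_annulus D)"
    unfolding radial_law_def tilted_law_def by (subst emeasure_distr) (auto simp: vimage_def)
  also have "\<dots> = (\<integral>\<^sup>+z. ennreal (eigen_density k z) * indicator (sq_annulus D) z \<partial>\<mu>)"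
    by (rule emeasure_density) measurable
  also have "\<dots> = (\<integral>\<^sup>+z. ennreal (indicator (sq_annulus D) z * eigen_density k z) \<partial>\<mu>)"
    by (intro nn_integral_cong) (simp add: indicator_def)
  also have "\<dots> = ennreal (annulus_weight k (sq_annulus D))"
    unfolding annulus_weight_def
    using integrable_weight[OF assms(1) sets_sq_annulus[OF D]] by (intro nn_integral_eq_integral) auto
  finally show ?thesis .
qed

text \<open>
  Borel-Cantelli, by summability of the inclusion probabilities.
\<close>

lemma AE_finite_included:
  assumes rc: "radial_construction \<mu> n lam a P Z Q B"
  shows "AE \<omega> in P. finite (included n Q B \<omega> UNIV)"
proof -
  interpret P: prob_space P using rc by (rule radial_construction_prob_space)
  define E where "E k = (if enat k < n then {\<omega>\<in>space P. B k \<omega>} else {})" for k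
  have E: "E k \<in> sets P" for k
    using radial_construction_measurable(2)[OF rc, of k] by (simp add: E_def pred_def)
  have "measure P (E k) = lam0 k" for k
    using rc by (simp add: E_def lam0_def radial_construction_def)
  then have "AE \<omega> in P. eventually (\<lambda>k. \<omega> \<in> space P - E k) sequentially"
    using E summable_lam0 by (intro borel_cantelli_AE1) (auto simp: P.emeasure_eq_measure)
  with AE_space[of P] show ?thesis
  proof eventually_elim
    case (elim \<omega>)
    then obtain N where N: "\<And>k. k \<ge> N \<Longrightarrow> \<omega> \<notin> E k" by (auto simp: eventually_sequentially)
    have "included n Q B \<omega> UNIV \<subseteq> {..<N}"
    proof
      fix l assume "l \<in> included n Q B \<omega> UNIV"
      then have "\<omega> \<in> E l" using elim(1) by (simp add: included_def E_def)
      then show "l \<in> {..<N}" using N[of l] by (cases "l < N") auto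
    qed
    then show ?case by (rule finite_subset) simp
  qed
qed

text \<open>
  The indices are distinct, so all points and all inclusion events that occur are independent.
\<close>

lemma expectation_included_product:
  assumes rc: "radial_construction \<mu> n lam a P Z Q B"
    and D: "\<And>i. i < k \<Longrightarrow> D i \<in> sets borel"
    and t: "t \<in> distinct_tuples k (\<lambda>_. {l. enat l < n})"
  shows "(\<integral>\<^sup>+\<omega>. (\<Prod>i<k. indicator (included n Q B \<omega> (D i)) (t i)) \<partial>P) =
    ennreal (\<Prod>i<k. lam (t i) * annulus_weight (t i) (sq_annulus (D i)))"
proof -
  interpret P: prob_space P using rc by (rule radial_construction_prob_space)
  let ?T = "t ` {..<k}"
  have inj: "inj_on t {..<k}" and tn: "\<And>i. i < k \<Longrightarrow> enat (t i) < n" using t by (auto simp: distinct_tuples_def PiE_iff)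
  \<comment> \<open>The point with index \<open>l\<close> has to lie in the set that belongs to the position of \<open>l\<close> in \<open>t\<close>.\<close>
  define Y where "Y = case_sum (\<lambda>l :: nat. indicator (D (the_inv_into {..<k} t l)) :: real \<Rightarrow> ennreal) (\<lambda>_ :: nat. ennreal)"
  define W where "W = (\<lambda>j \<omega>. Y j (case_sum Q (\<lambda>k \<omega>. of_bool (B k \<omega>)) j \<omega>))"
  have inv_t: "the_inv_into {..<k} t (t i) = i" if "i < k" for i using the_inv_into_f_f[OF inj] that by simp
  have "P.indep_vars (\<lambda>_. borel) (case_sum Q (\<lambda>k \<omega>. of_bool (B k \<omega>))) (?T <+> ?T)"
    by (rule P.indep_vars_subset[OF radial_construction_indep[OF rc]]) (use tn in auto)
  then have indep: "P.indep_vars (\<lambda>_. borel) W (?T <+> ?T)"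
    unfolding W_def
  proof (rule P.indep_vars_compose2)
    fix j assume "j \<in> ?T <+> ?T"
    then show "Y j \<in> borel_measurable borel" using D inv_t by (auto simp: Y_def)
  qed
  have WQ: "W (Inl (t i)) \<omega> = indicator (D i) (Q (t i) \<omega>)" if "i < k" for i \<omega>
    using inv_t[OF that] by (simp add: W_def Y_def)
  have WB: "W (Inr (t i)) \<omega> = of_bool (B (t i) \<omega>)" for i \<omega>
    by (simp add: W_def Y_def)
  have split: "(\<Prod>j\<in>?T <+> ?T. g j) = (\<Prod>i<k. g (Inr (t i)) * g (Inl (t i)))" for g :: "nat + nat \<Rightarrow> ennreal"
    using inj by (simp add: prod.Plus prod.reindex prod.distrib mult.commute)
  have "(\<integral>\<^sup>+\<omega>. (\<Prod>i<k. indicator (included n Q B \<omega> (D i)) (t i)) \<partial>P) = (\<integral>\<^sup>+\<omega>. (\<Prod>j\<in>?T <+> ?T. W j \<omega>) \<partial>P)"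
    unfolding split using tn WQ WB by (intro nn_integral_cong prod.cong refl) (auto simp: included_def indicator_def)
  also have "\<dots> = (\<Prod>j\<in>?T <+> ?T. \<integral>\<^sup>+\<omega>. W j \<omega> \<partial>P)"
    by (rule P.indep_vars_nn_integral[OF _ indep]) auto
  also have "\<dots> = (\<Prod>i<k. (\<integral>\<^sup>+\<omega>. W (Inr (t i)) \<omega> \<partial>P) * (\<integral>\<^sup>+\<omega>. W (Inl (t i)) \<omega> \<partial>P))"
    by (rule split)
  also have "\<dots> = (\<Prod>i<k. ennreal (lam (t i) * annulus_weight (t i) (sq_annulus (D i))))"
  proof (rule prod.cong[OF refl])
    fix i assume "i \<in> {..<k}"
    then have i: "i < k" by simp
    note [measurable] = radial_construction_measurable[OF rc tn[OF i]] D[OF i]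
    have "(\<integral>\<^sup>+\<omega>. W (Inr (t i)) \<omega> \<partial>P) = (\<integral>\<^sup>+\<omega>. indicator {\<omega>\<in>space P. B (t i) \<omega>} \<omega> \<partial>P)"
      unfolding WB by (intro nn_integral_cong) (simp add: indicator_def)
    also have "\<dots> = emeasure P {\<omega>\<in>space P. B (t i) \<omega>}" by (rule nn_integral_indicator) measurable
    also have "\<dots> = ennreal (lam (t i))"
      using rc tn[OF i] by (simp add: P.emeasure_eq_measure radial_construction_def)
    finally have 1: "(\<integral>\<^sup>+\<omega>. W (Inr (t i)) \<omega> \<partial>P) = ennreal (lam (t i))" .
    have "(\<integral>\<^sup>+\<omega>. W (Inl (t i)) \<omega> \<partial>P) = (\<integral>\<^sup>+q. indicator (D i) q \<partial>distr P borel (Q (t i)))"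
      unfolding WQ[OF i] by (rule nn_integral_distr[symmetric]) measurable
    also have "\<dots> = ennreal (annulus_weight (t i) (sq_annulus (D i)))"
      using D[OF i] by (simp add: law_Q[OF rc tn[OF i]] emeasure_radial_law[OF tn[OF i]] radial_law_def[THEN arg_cong[where f = sets]])
    finally have 2: "(\<integral>\<^sup>+\<omega>. W (Inl (t i)) \<omega> \<partial>P) = ennreal (annulus_weight (t i) (sq_annulus (D i)))" .
    show "(\<integral>\<^sup>+\<omega>. W (Inr (t i)) \<omega> \<partial>P) * (\<integral>\<^sup>+\<omega>. W (Inl (t i)) \<omega> \<partial>P) = ennreal (lam (t i) * annulus_weight (t i) (sq_annulus (D i)))"
      unfolding 1 2 using lam01[OF tn[OF i]] annulus_weight_nonneg by (intro ennreal_mult[symmetric]) auto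
  qed
  also have "\<dots> = ennreal (\<Prod>i<k. lam (t i) * annulus_weight (t i) (sq_annulus (D i)))"
    using lam_weight_nonneg tn by (intro prod_ennreal) auto
  finally show ?thesis .
qed

text \<open>
  Monotone convergence as more and more indices are admitted.
\<close>

theorem factorial_moment_thinned:
  assumes rc: "radial_construction \<mu> n lam a P Z Q B"
    and D: "\<And>i. i < k \<Longrightarrow> D i \<in> sets borel"
  shows "(\<lambda>N. ennreal (index_moment N k (\<lambda>i. sq_annulus (D i)))) \<longlonglongrightarrow>
    (\<integral>\<^sup>+\<omega>. of_nat (card (distinct_tuples k (\<lambda>i. included n Q B \<omega> (D i)))) \<partial>P)"
proof -
  let ?I = "\<lambda>N. {l. enat l < n \<and> l < N}"
  let ?D = "\<lambda>N. distinct_tuples k (\<lambda>_. ?I N)"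
  let ?h = "\<lambda>\<omega> t. \<Prod>i<k. indicator (included n Q B \<omega> (D i)) (t i) :: ennreal"
  define F where "F N \<omega> = (\<Sum>t\<in>?D N. ?h \<omega> t)" for N \<omega>
  have fin: "finite (?D N)" for N by (intro finite_distinct_tuples) auto
  have mono_I: "?D N \<subseteq> ?D N'" if "N \<le> N'" for N N'
    using that by (auto simp: distinct_tuples_def PiE_iff intro: less_le_trans)
  have ind_meas: "(\<lambda>\<omega>. indicator (included n Q B \<omega> (D i)) l :: ennreal) \<in> borel_measurable P"
    if "enat l < n" "i < k" for i l
  proof -
    note [measurable] = radial_construction_measurable[OF rc that(1)] D[OF that(2)]
    have "(\<lambda>\<omega>. indicator (included n Q B \<omega> (D i)) l :: ennreal) = (\<lambda>\<omega>. if B l \<omega> \<and> Q l \<omega> \<in> D i then 1 else 0)"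
      using that by (auto simp: included_def indicator_def)
    then show ?thesis by simp
  qed
  have term_meas: "(\<lambda>\<omega>. ?h \<omega> t) \<in> borel_measurable P"
    if "t \<in> ?D N" for t N
    using that by (intro borel_measurable_prod_ennreal ind_meas) (auto simp: distinct_tuples_def PiE_iff)
  have F_meas: "F N \<in> borel_measurable P" for N
    unfolding F_def using term_meas by (intro borel_measurable_sum) auto
  have F_int: "(\<integral>\<^sup>+\<omega>. F N \<omega> \<partial>P) = ennreal (index_moment N k (\<lambda>i. sq_annulus (D i)))" for N
  proof -
    have "(\<integral>\<^sup>+\<omega>. F N \<omega> \<partial>P) = (\<Sum>t\<in>?D N. \<integral>\<^sup>+\<omega>. ?h \<omega> t \<partial>P)"
      unfolding F_def using term_meas by (intro nn_integral_sum) auto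
    also have "\<dots> = (\<Sum>t\<in>?D N. ennreal (\<Prod>i<k. lam (t i) * annulus_weight (t i) (sq_annulus (D i))))"
      by (intro sum.cong refl expectation_included_product[OF rc D]) (auto simp: distinct_tuples_def PiE_iff)
    also have "\<dots> = ennreal (index_moment N k (\<lambda>i. sq_annulus (D i)))"
      unfolding index_moment_def
      by (intro sum_ennreal prod_nonneg lam_weight_nonneg) (auto simp: distinct_tuples_def PiE_iff)
    finally show ?thesis .
  qed
  have inc: "incseq F"
    unfolding F_def using mono_I fin by (intro monoI le_funI sum_mono2) auto
  have "(\<lambda>N. \<integral>\<^sup>+\<omega>. F N \<omega> \<partial>P) \<longlonglongrightarrow> (SUP N. \<integral>\<^sup>+\<omega>. F N \<omega> \<partial>P)"
    using inc by (intro LIMSEQ_SUP incseq_nn_integral)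
  also have "(SUP N. \<integral>\<^sup>+\<omega>. F N \<omega> \<partial>P) = (\<integral>\<^sup>+\<omega>. (SUP N. F N \<omega>) \<partial>P)"
    by (rule nn_integral_monotone_convergence_SUP[OF inc F_meas, symmetric])
  also have "\<dots> = (\<integral>\<^sup>+\<omega>. of_nat (card (distinct_tuples k (\<lambda>i. included n Q B \<omega> (D i)))) \<partial>P)"
  proof (rule nn_integral_cong_AE)
    show "AE \<omega> in P. (SUP N. F N \<omega>) = of_nat (card (distinct_tuples k (\<lambda>i. included n Q B \<omega> (D i))))"
      using AE_finite_included[OF rc]
    proof eventually_elim
      case (elim \<omega>)
      let ?C = "distinct_tuples k (\<lambda>i. included n Q B \<omega> (D i))"
      have finC: "finite ?C"
        using elim by (intro finite_distinct_tuples) (auto intro: finite_subset[rotated] simp: included_def)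
      have F_card: "F N \<omega> = of_nat (card (?C \<inter> ?D N))" for N
      proof -
        have "?h \<omega> t = indicator ?C t"
          if "t \<in> ?D N" for t
        proof (cases "\<forall>i<k. t i \<in> included n Q B \<omega> (D i)")
          case True
          then have "t \<in> ?C" using that by (auto simp: distinct_tuples_def PiE_iff)
          then show ?thesis using True by simp
        next
          case False
          then obtain i where i: "i < k" "t i \<notin> included n Q B \<omega> (D i)" by auto
          then have "t \<notin> ?C" by (auto simp: distinct_tuples_def PiE_iff)
          moreover have "?h \<omega> t = 0"
            using i by (intro prod_zero bexI[of _ i]) auto
          ultimately show ?thesis by simp
        qed
        then have "F N \<omega> = (\<Sum>t\<in>?D N. indicator ?C t)"
          unfolding F_def by (intro sum.cong) auto
        also have "\<dots> = (\<Sum>t\<in>?C \<inter> ?D N. 1)"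
          using fin[of N] by (intro sum.mono_neutral_cong_right) (auto simp: indicator_def split: if_splits)
        finally show ?thesis by simp
      qed
      have "(SUP N. F N \<omega>) = of_nat (card ?C)"
      proof (rule antisym)
        show "(SUP N. F N \<omega>) \<le> of_nat (card ?C)"
        proof (rule SUP_least)
          fix N
          have "card (?C \<inter> ?D N) \<le> card ?C" using finC by (intro card_mono) auto
          then show "F N \<omega> \<le> of_nat (card ?C)" unfolding F_card by (rule of_nat_mono)
        qed
        obtain N where N: "included n Q B \<omega> UNIV \<subseteq> {..<N}" using elim finite_nat_iff_bounded by blast
        have "?C \<subseteq> ?D N"
        proof
          fix t assume t: "t \<in> ?C"
          have "t i \<in> ?I N" if "i < k" for i
          proof -
            have "t i \<in> included n Q B \<omega> (D i)" using t that by (auto simp: distinct_tuples_def PiE_iff)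
            then have "enat (t i) < n" "t i \<in> included n Q B \<omega> UNIV" by (auto simp: included_def)
            then show ?thesis using N by auto
          qed
          then show "t \<in> ?D N" using t by (auto simp: distinct_tuples_def PiE_iff)
        qed
        then have "?C \<inter> ?D N = ?C" by (rule Int_absorb2)
        then have "F N \<omega> = of_nat (card ?C)" unfolding F_card by (rule arg_cong[where f = "\<lambda>S. of_nat (card S)"])
        then show "of_nat (card ?C) \<le> (SUP N. F N \<omega>)" using SUP_upper[of N UNIV "\<lambda>N. F N \<omega>"] by (simp only: UNIV_I)
      qed
      then show ?case .
    qed
  qed
  finally show ?thesis unfolding F_int .
qed

lemma thinned_process_counts:
  assumes rc: "radial_construction \<mu> n lam a P Z Q B"
  shows "finite_counts P (thinned_process n Q B)"
    and "AE \<omega> in P. finite (included n Q B \<omega> UNIV) \<and>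
      (\<forall>D\<in>sets borel. num_points (thinned_process n Q B \<omega>) D = card (included n Q B \<omega> D))"
proof -
  have *: "AE \<omega> in P. finite (included n Q B \<omega> UNIV) \<and>
      (\<forall>D\<in>sets borel. emeasure (thinned_process n Q B \<omega>) D = of_nat (card (included n Q B \<omega> D)))"
    using AE_finite_included[OF rc]
  proof eventually_elim
    case (elim \<omega>)
    have "finite (included n Q B \<omega> D)" for D
      using elim by (rule finite_subset[rotated]) (auto simp: included_def)
    with elim show ?case by (simp add: emeasure_thinned_process)
  qed
  then show "finite_counts P (thinned_process n Q B)"
    unfolding finite_counts_def using rc measurable_thinned_process[OF rc] by (auto simp: radial_construction_def)
  show "AE \<omega> in P. finite (included n Q B \<omega> UNIV) \<and>
      (\<forall>D\<in>sets borel. num_points (thinned_process n Q B \<omega>) D = card (included n Q B \<omega> D))"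
    using * by eventually_elim (auto intro: num_points_eqI)
qed

end

section \<open>Equality in law\<close>

lemma prod_binomial_eq_card_distinct_tuples:
  fixes T :: "'j \<Rightarrow> 'b set"
  assumes "finite J" "disjoint_family_on T J" "\<And>j. j \<in> J \<Longrightarrow> finite (T j)"
    and c: "c ` {..<k} \<subseteq> J" "\<And>j. j \<in> J \<Longrightarrow> card {i\<in>{..<k}. c i = j} = \<kappa> j"
  shows "(\<Prod>j\<in>J. fact (\<kappa> j) * (card (T j) choose \<kappa> j)) = card (distinct_tuples k (\<lambda>i. T (c i)))"
proof -
  have "card (distinct_tuples k (\<lambda>i. T (c i))) =
      (\<Prod>j\<in>J. fact (card {i\<in>{..<k}. c i = j}) * (card (T j) choose card {i\<in>{..<k}. c i = j}))"
    unfolding distinct_tuples_def by (rule card_injective_tuples) (use assms in auto)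
  also have "\<dots> = (\<Prod>j\<in>J. fact (\<kappa> j) * (card (T j) choose \<kappa> j))"
    using c(2) by (intro prod.cong) auto
  finally show ?thesis by simp
qed

text \<open>
  \<open>T \<omega> D\<close> stands for the set of points, or of indices of points, that \<open>Y \<omega>\<close> counts in \<open>D\<close>.
\<close>

lemma nn_integral_prod_binomial_num_points:
  fixes Y :: "'w \<Rightarrow> real measure" and T :: "'w \<Rightarrow> real set \<Rightarrow> 'b set"
  assumes counts: "AE \<omega> in M. finite (T \<omega> UNIV) \<and> (\<forall>D\<in>sets borel. num_points (Y \<omega>) D = card (T \<omega> D))"
    and sub: "\<And>\<omega> D. T \<omega> D \<subseteq> T \<omega> UNIV"
    and disj: "\<And>\<omega> D D'. D \<inter> D' = {} \<Longrightarrow> T \<omega> D \<inter> T \<omega> D' = {}"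
    and J: "finite J" "disjoint_family_on E J" "\<And>j. j \<in> J \<Longrightarrow> E j \<in> sets borel"
    and c: "c ` {..<k} \<subseteq> J" "\<And>j. j \<in> J \<Longrightarrow> card {i\<in>{..<k}. c i = j} = \<kappa> j"
  shows "factorial_moment M Y J E \<kappa> =
    (\<integral>\<^sup>+\<omega>. of_nat (card (distinct_tuples k (\<lambda>i. T \<omega> (E (c i))))) \<partial>M)"
proof (rule nn_integral_cong_AE)
  show "AE \<omega> in M. of_nat (\<Prod>j\<in>J. fact (\<kappa> j) * (num_points (Y \<omega>) (E j) choose \<kappa> j)) =
      (of_nat (card (distinct_tuples k (\<lambda>i. T \<omega> (E (c i))))) :: ennreal)"
    using counts
  proof eventually_elim
    case (elim \<omega>)
    have fin: "finite (T \<omega> D)" for D by (rule finite_subset[OF sub conjunct1[OF elim]])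
    have "(\<Prod>j\<in>J. fact (\<kappa> j) * (num_points (Y \<omega>) (E j) choose \<kappa> j)) =
        (\<Prod>j\<in>J. fact (\<kappa> j) * (card (T \<omega> (E j)) choose \<kappa> j))"
      using elim J(3) by (intro prod.cong refl) simp
    also have "\<dots> = card (distinct_tuples k (\<lambda>i. T \<omega> (E (c i))))"
    proof (rule prod_binomial_eq_card_distinct_tuples[OF J(1) _ fin c])
      show "disjoint_family_on (\<lambda>j. T \<omega> (E j)) J"
        unfolding disjoint_family_on_def
        by (intro ballI impI disj) (rule disjoint_family_onD[OF J(2)])
    qed
    finally show ?case by simp
  qed
qed

definition support :: "'a measure \<Rightarrow> 'a set" where
  "support N = {x. emeasure N {x} \<noteq> 0}"

definition sq_modulus_process :: "('w \<Rightarrow> complex measure) \<Rightarrow> 'w \<Rightarrow> real measure" where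
  "sq_modulus_process X \<omega> = distr (X \<omega>) borel (\<lambda>z. (cmod z)\<^sup>2)"

context radial_kernel_data begin

context
  fixes M :: "'w measure" and X :: "'w \<Rightarrow> complex measure"
  assumes dp: "determinantal_process M X \<mu> (radial_kernel n lam a)"
begin

lemma process_basics:
  shows "prob_space M" "X \<in> M \<rightarrow>\<^sub>M measure_algebra" "\<And>\<omega>. \<omega> \<in> space M \<Longrightarrow> sets (X \<omega>) = sets borel"
proof -
  show "prob_space M" and X: "X \<in> M \<rightarrow>\<^sub>M measure_algebra"
    using dp by (auto simp: determinantal_process_def point_process_def)
  show "sets (X \<omega>) = sets borel" if "\<omega> \<in> space M" for \<omega>
    using measurable_space[OF X that] by (simp add: space_measure_algebra)
qed

lemma ex_intensity:
  "\<exists>\<rho>. joint_intensities M X \<mu> \<rho> \<and>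
    (\<forall>k\<ge>1. \<forall>A. (\<forall>i<k. rotation_invariant (A i)) \<longrightarrow>
      (\<lambda>N. ennreal (index_moment N k A)) \<longlonglongrightarrow> (\<integral>\<^sup>+x\<in>distinct_tuples k A. ennreal (\<rho> k x) \<partial>(\<mu>_power k)))"
proof -
  obtain \<rho> where \<rho>: "joint_intensities M X \<mu> \<rho>"
    and det: "\<And>k. 1 \<le> k \<Longrightarrow> AE x in (\<mu>_power k).
      complex_of_real (\<rho> k x) = Determinant.det (mat k k (\<lambda>(i, j). radial_kernel n lam a (x i) (x j)))"
    using dp by (auto simp: determinantal_process_def)
  have *: "\<rho> k \<in> borel_measurable (\<mu>_power k)" "0 \<le> \<rho> k x" if "1 \<le> k" for k x
    using \<rho> that unfolding joint_intensities_def by auto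
  show ?thesis
  proof (intro exI[of _ \<rho>] conjI \<rho> allI impI)
    fix k :: nat and A assume "1 \<le> k" "\<forall>i<k. rotation_invariant (A i)"
    then show "(\<lambda>N. ennreal (index_moment N k A)) \<longlonglongrightarrow> (\<integral>\<^sup>+x\<in>distinct_tuples k A. ennreal (\<rho> k x) \<partial>(\<mu>_power k))"
      by (intro integral_intensity_eq_limit *(1) *(2) det) auto
  qed
qed

text \<open>
  By the first intensity the expected total number of points is at most \<open>\<Sum>\<^sub>k lam(k)\<close>.
\<close>

lemma AE_total_finite: "AE \<omega> in M. emeasure (X \<omega>) UNIV \<noteq> \<infinity>"
proof -
  obtain \<rho> where \<rho>: "joint_intensities M X \<mu> \<rho>"
    and lim: "\<forall>k\<ge>1. \<forall>A. (\<forall>i<k. rotation_invariant (A i)) \<longrightarrow>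
      (\<lambda>N. ennreal (index_moment N k A)) \<longlonglongrightarrow> (\<integral>\<^sup>+x\<in>distinct_tuples k A. ennreal (\<rho> k x) \<partial>(\<mu>_power k))"
    using ex_intensity by blast
  have box: "(\<Pi>\<^sub>E i\<in>{..<1}. (UNIV :: complex set)) = distinct_tuples 1 (\<lambda>_. UNIV)"
    by (auto simp: distinct_tuples_def inj_on_def)
  have "(\<integral>\<^sup>+\<omega>. emeasure (X \<omega>) UNIV \<partial>M) = (\<integral>\<^sup>+\<omega>. (\<Prod>i<(1::nat). emeasure (X \<omega>) UNIV) \<partial>M)"
    by simp
  also have "\<dots> = (\<integral>\<^sup>+x\<in>(\<Pi>\<^sub>E i\<in>{..<1}. UNIV). ennreal (\<rho> 1 x) \<partial>(\<mu>_power 1))"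
  proof -
    have all_D: "\<forall>D. (\<forall>i<1. D i \<in> sets borel) \<longrightarrow> disjoint_family_on D {..<1} \<longrightarrow>
        (\<integral>\<^sup>+\<omega>. (\<Prod>i<(1::nat). emeasure (X \<omega>) (D i)) \<partial>M) =
        (\<integral>\<^sup>+x\<in>(\<Pi>\<^sub>E i\<in>{..<1}. D i). ennreal (\<rho> 1 x) \<partial>(\<mu>_power 1))"
      by (rule conjunct2[OF conjunct2[OF mp[OF spec[OF \<rho>[unfolded joint_intensities_def], of 1] order_refl]]])
    show ?thesis
      by (rule mp[OF mp[OF spec[OF all_D, of "\<lambda>_. UNIV"]]]) (auto simp: disjoint_family_on_def)
  qed
  also have "\<dots> = (\<integral>\<^sup>+x\<in>distinct_tuples 1 (\<lambda>_. UNIV). ennreal (\<rho> 1 x) \<partial>(\<mu>_power 1))"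
    unfolding box ..
  also have "\<dots> \<le> ennreal (suminf lam0 ^ 1)"
  proof (rule LIMSEQ_le_const2[OF lim[rule_format]])
    show "\<exists>N. \<forall>m\<ge>N. ennreal (index_moment m 1 (\<lambda>_. UNIV)) \<le> ennreal (suminf lam0 ^ 1)"
      by (intro exI allI impI ennreal_leI index_moment_le) auto
  qed (auto simp: rotation_invariant_def)
  also have "\<dots> < \<infinity>" by simp
  finally have "(\<integral>\<^sup>+\<omega>. emeasure (X \<omega>) UNIV \<partial>M) \<noteq> \<infinity>" by simp
  moreover have "(\<lambda>\<omega>. emeasure (X \<omega>) UNIV) \<in> borel_measurable M"
    using measurable_compose[OF process_basics(2) measurable_emeasure_measure_algebra] by auto
  ultimately show ?thesis by (intro nn_integral_noteq_infinite) auto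
qed

lemma AE_simple_finite:
  "AE \<omega> in M. sets (X \<omega>) = sets borel \<and> (\<forall>D\<in>sets borel. emeasure (X \<omega>) D \<in> \<nat>) \<and>
     (\<forall>x. emeasure (X \<omega>) {x} \<le> 1)"
proof -
  have "AE \<omega> in M. \<forall>D\<in>sets borel. emeasure (X \<omega>) D \<in> \<nat> \<union> {\<infinity>}"
    using dp by (auto simp: determinantal_process_def point_process_def elim: eventually_mono)
  moreover have "AE \<omega> in M. \<forall>x. emeasure (X \<omega>) {x} \<le> 1"
    using dp by (auto simp: determinantal_process_def simple_process_def)
  ultimately show ?thesis
    using AE_total_finite AE_space[of M]
  proof eventually_elim
    case (elim \<omega>)
    have "emeasure (X \<omega>) D \<noteq> \<infinity>" if "D \<in> sets borel" for D
      using elim(3) emeasure_mono[of D UNIV "X \<omega>"] process_basics(3)[OF elim(4)] by (auto simp: top_unique)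
    then show ?case using elim process_basics(3)[OF elim(4)] by auto
  qed
qed

lemma factorial_moment_determinantal:
  assumes A: "\<And>i. i < k \<Longrightarrow> rotation_invariant (A i)"
  shows "(\<lambda>N. ennreal (index_moment N k A)) \<longlonglongrightarrow>
    (\<integral>\<^sup>+\<omega>. of_nat (card (distinct_tuples k (\<lambda>i. support (X \<omega>) \<inter> A i))) \<partial>M)"
proof (cases "k = 0")
  \<comment> \<open>Joint intensities start at \<open>k = 1\<close>; there is exactly one empty tuple.\<close>
  case True
  interpret M: prob_space M by (rule process_basics)
  have "distinct_tuples 0 A' = {\<lambda>_. undefined}" for A' :: "nat \<Rightarrow> 'b set" by (auto simp: distinct_tuples_def)
  then show ?thesis using True by (simp add: index_moment_def distinct_tuples_def M.emeasure_space_1)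
next
  case False
  then have k: "1 \<le> k" by simp
  obtain \<rho> where \<rho>: "joint_intensities M X \<mu> \<rho>"
    and lim: "\<forall>k\<ge>1. \<forall>A. (\<forall>i<k. rotation_invariant (A i)) \<longrightarrow>
      (\<lambda>N. ennreal (index_moment N k A)) \<longlonglongrightarrow> (\<integral>\<^sup>+x\<in>distinct_tuples k A. ennreal (\<rho> k x) \<partial>(\<mu>_power k))"
    using ex_intensity by blast
  have "(\<integral>\<^sup>+\<omega>. of_nat (card (distinct_tuples k (\<lambda>i. support (X \<omega>) \<inter> A i))) \<partial>M) =
      (\<integral>\<^sup>+x\<in>distinct_tuples k A. ennreal (\<rho> k x) \<partial>(\<mu>_power k))"
    unfolding support_def
    by (rule factorial_moment_eq_integral_intensity[OF process_basics(2) AE_simple_finite sets_\<mu> \<rho> k])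
      (use A in \<open>simp add: rotation_invariant_def\<close>)
  then show ?thesis using lim[rule_format, OF k A] by simp
qed

lemma emeasure_sq_modulus_process:
  "\<omega> \<in> space M \<Longrightarrow> D \<in> sets borel \<Longrightarrow> emeasure (sq_modulus_process X \<omega>) D = emeasure (X \<omega>) (sq_annulus D)"
proof -
  assume \<omega>: "\<omega> \<in> space M" and D: "D \<in> sets borel"
  have "(\<lambda>z. (cmod z)\<^sup>2) \<in> borel_measurable (X \<omega>)"
    unfolding measurable_cong_sets[OF process_basics(3)[OF \<omega>] refl] by measurable
  then show ?thesis
    unfolding sq_modulus_process_def
    using D sets_eq_imp_space_eq[OF process_basics(3)[OF \<omega>]] by (subst emeasure_distr) (auto simp: vimage_def)
qed

lemma sq_modulus_process_counts:
  shows "finite_counts M (sq_modulus_process X)"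
    and "AE \<omega> in M. finite (support (X \<omega>)) \<and>
      (\<forall>D\<in>sets borel. num_points (sq_modulus_process X \<omega>) D = card (support (X \<omega>) \<inter> sq_annulus D))"
proof -
  have *: "AE \<omega> in M. finite (support (X \<omega>)) \<and>
      (\<forall>D\<in>sets borel. emeasure (sq_modulus_process X \<omega>) D = of_nat (card (support (X \<omega>) \<inter> sq_annulus D)))"
    using AE_simple_finite AE_space[of M]
  proof eventually_elim
    case (elim \<omega>)
    show ?case
    proof (intro conjI ballI)
      show "finite (support (X \<omega>))"
        unfolding support_def by (rule simple_integer_valued_eq_card(1)) (use elim in auto)
      fix D :: "real set" assume D: "D \<in> sets borel"
      have "emeasure (X \<omega>) (sq_annulus D) = of_nat (card (support (X \<omega>) \<inter> sq_annulus D))"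
        unfolding support_def
        by (rule simple_integer_valued_eq_card(2)) (use elim sets_sq_annulus[OF D] in auto)
      then show "emeasure (sq_modulus_process X \<omega>) D = of_nat (card (support (X \<omega>) \<inter> sq_annulus D))"
        by (simp add: emeasure_sq_modulus_process[OF elim(2) D])
    qed
  qed
  have "sq_modulus_process X \<in> M \<rightarrow>\<^sub>M measure_algebra"
  proof (rule measurable_measure_algebraI)
    fix D :: "real set" assume D: "D \<in> sets borel"
    have "(\<lambda>\<omega>. emeasure (X \<omega>) (sq_annulus D)) \<in> borel_measurable M"
      by (rule measurable_compose[OF process_basics(2) measurable_emeasure_measure_algebra[OF sets_sq_annulus[OF D]]])
    then show "(\<lambda>\<omega>. emeasure (sq_modulus_process X \<omega>) D) \<in> borel_measurable M"
      by (subst measurable_cong[OF emeasure_sq_modulus_process[OF _ D]]) auto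
  qed (simp add: sq_modulus_process_def)
  then show "finite_counts M (sq_modulus_process X)"
    unfolding finite_counts_def
  proof (intro conjI process_basics(1))
    show "AE \<omega> in M. \<forall>D\<in>sets borel. emeasure (sq_modulus_process X \<omega>) D \<in> \<nat>"
      using * by eventually_elim simp
  qed
  show "AE \<omega> in M. finite (support (X \<omega>)) \<and>
      (\<forall>D\<in>sets borel. num_points (sq_modulus_process X \<omega>) D = card (support (X \<omega>) \<inter> sq_annulus D))"
    using * by eventually_elim (auto intro: num_points_eqI)
qed

text \<open>
  Both factorial moments are the limit of the same sequence of index moments.
\<close>

theorem law_sq_modulus_eq_thinned:
  assumes rc: "radial_construction \<mu> n lam a P Z Q B"
  shows "distr M measure_algebra (sq_modulus_process X) = distr P measure_algebra (thinned_process n Q B)"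
proof (rule law_eqI_factorial_moments)
  show "finite_counts M (sq_modulus_process X)" "finite_counts P (thinned_process n Q B)"
    by (rule sq_modulus_process_counts(1), rule thinned_process_counts(1)[OF rc])
  show "0 \<le> suminf lam0" using summable_lam0 lam0_nonneg by (intro suminf_nonneg)
  have X_moment: "(\<lambda>N. ennreal (index_moment N k (\<lambda>i. sq_annulus (E (c i))))) \<longlonglongrightarrow>
      factorial_moment M (sq_modulus_process X) J E \<kappa>"
    if J: "finite J" "disjoint_family_on E J" "\<And>j. j \<in> J \<Longrightarrow> E j \<in> sets borel"
      and c: "c ` {..<k} \<subseteq> J" "\<And>j. j \<in> J \<Longrightarrow> card {i\<in>{..<k}. c i = j} = \<kappa> j"
    for J :: "real set set set" and E \<kappa> c k
  proof -
    have "factorial_moment M (sq_modulus_process X) J E \<kappa> =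
        (\<integral>\<^sup>+\<omega>. of_nat (card (distinct_tuples k (\<lambda>i. support (X \<omega>) \<inter> sq_annulus (E (c i))))) \<partial>M)"
      by (rule nn_integral_prod_binomial_num_points[where T = "\<lambda>\<omega> D. support (X \<omega>) \<inter> sq_annulus D", OF _ _ _ J c])
        (use sq_modulus_process_counts(2) in auto)
    moreover have "rotation_invariant (sq_annulus (E (c i)))" if "i < k" for i
      using that c(1) J(3) by (intro rotation_invariant_sq_annulus) auto
    ultimately show ?thesis using factorial_moment_determinantal[of k "\<lambda>i. sq_annulus (E (c i))"] by simp
  qed
  have P_moment: "(\<lambda>N. ennreal (index_moment N k (\<lambda>i. sq_annulus (E (c i))))) \<longlonglongrightarrow>
      factorial_moment P (thinned_process n Q B) J E \<kappa>"
    if J: "finite J" "disjoint_family_on E J" "\<And>j. j \<in> J \<Longrightarrow> E j \<in> sets borel"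
      and c: "c ` {..<k} \<subseteq> J" "\<And>j. j \<in> J \<Longrightarrow> card {i\<in>{..<k}. c i = j} = \<kappa> j"
    for J :: "real set set set" and E \<kappa> c k
  proof -
    have "factorial_moment P (thinned_process n Q B) J E \<kappa> =
        (\<integral>\<^sup>+\<omega>. of_nat (card (distinct_tuples k (\<lambda>i. included n Q B \<omega> (E (c i))))) \<partial>P)"
      by (rule nn_integral_prod_binomial_num_points[where T = "included n Q B", OF thinned_process_counts(2)[OF rc] _ _ J c])
        (auto simp: included_def)
    moreover have "E (c i) \<in> sets borel" if "i < k" for i using that c(1) J(3) by auto
    ultimately show ?thesis using factorial_moment_thinned[OF rc, of k "\<lambda>i. E (c i)"] by simp
  qed
  show "factorial_moment M (sq_modulus_process X) J E \<kappa> =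
      factorial_moment P (thinned_process n Q B) J E \<kappa>"
    if J: "finite J" "disjoint_family_on E J" "\<And>j. j \<in> J \<Longrightarrow> E j \<in> sets borel"
    for J :: "real set set set" and E \<kappa>
  proof -
    obtain c :: "nat \<Rightarrow> real set set" where c: "c ` {..<sum \<kappa> J} \<subseteq> J"
      "\<And>j. j \<in> J \<Longrightarrow> card {i\<in>{..<sum \<kappa> J}. c i = j} = \<kappa> j"
      by (rule ex_labelling[OF J(1), of \<kappa>]) blast
    show ?thesis by (rule LIMSEQ_unique[OF X_moment[OF J c] P_moment[OF J c]])
  qed
  show "(\<integral>\<^sup>+\<omega>. of_nat (fact k * (num_points (sq_modulus_process X \<omega>) UNIV choose k)) \<partial>M) \<le> ennreal (suminf lam0 ^ k)" for k
  proof -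
    have "(\<lambda>N. ennreal (index_moment N k (\<lambda>i. sq_annulus UNIV))) \<longlonglongrightarrow>
      (\<integral>\<^sup>+\<omega>. of_nat (fact k * (num_points (sq_modulus_process X \<omega>) UNIV choose k)) \<partial>M)"
      using X_moment[of "{{}}" "\<lambda>_. UNIV" "\<lambda>_. {}" k "\<lambda>_. k"] by (simp add: disjoint_family_on_def image_subset_iff)
    then show ?thesis
      by (rule LIMSEQ_le_const2) (intro exI allI impI ennreal_leI index_moment_le, auto)
  qed
qed

end

end

section \<open>Densities and existence of the construction\<close>

lemma emeasure_lborel_sq_annulus_atMost:
  "emeasure lborel {z :: complex. (cmod z)\<^sup>2 \<le> r} = ennreal (pi * max 0 r)"
proof (cases "0 \<le> r")
  case True
  have "{z :: complex. (cmod z)\<^sup>2 \<le> r} = cball 0 (sqrt r)"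
    using True by (auto simp: real_le_rsqrt sqrt_ge_absD dist_norm)
  moreover have "emeasure lborel (cball (0 :: complex) (sqrt r)) = ennreal (pi * r)"
    using True by (subst emeasure_cball) (simp_all add: unit_ball_vol_2)
  ultimately show ?thesis using True by simp
next
  case False
  then have "{z :: complex. (cmod z)\<^sup>2 \<le> r} = {}"
    by (auto simp: not_le) (smt (verit) zero_le_power2)
  then show ?thesis using False by simp
qed

text \<open>
  The disc of squared radius \<open>r\<close> has area \<open>pi * r\<close>; this replaces polar coordinates.
\<close>

lemma distr_lborel_cmod_sq:
  "distr lborel borel (\<lambda>z :: complex. (cmod z)\<^sup>2) = density lborel (\<lambda>q. ennreal (pi * indicator {0<..} q))"
  (is "?M = ?N")
proof (rule measure_eqI_generator_eq_countable)
  let ?E = "range (\<lambda>r :: real. {..r})"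
  show "Int_stable ?E" by (auto simp: Int_stable_def)
  have "sets (borel :: real measure) = sigma_sets UNIV ?E" by (subst borel_eq_atMost) simp
  then show "?E \<subseteq> Pow UNIV" "sets ?M = sigma_sets UNIV ?E" "sets ?N = sigma_sets UNIV ?E" by simp_all
  have M: "emeasure ?M {..r} = ennreal (pi * max 0 r)" for r
  proof -
    have "(\<lambda>z :: complex. (cmod z)\<^sup>2) -` {..r} = {z. (cmod z)\<^sup>2 \<le> r}" by auto
    then show ?thesis by (simp add: emeasure_distr emeasure_lborel_sq_annulus_atMost)
  qed
  have N: "emeasure ?N {..r} = ennreal (pi * max 0 r)" for r
  proof -
    have "emeasure ?N {..r} = (\<integral>\<^sup>+q. ennreal (pi * indicator {0<..} q) * indicator {..r} q \<partial>lborel)"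
      by (rule emeasure_density) measurable
    also have "\<dots> = (\<integral>\<^sup>+q. ennreal pi * indicator {0<..r} q \<partial>lborel)"
      by (intro nn_integral_cong) (auto simp: indicator_def)
    also have "\<dots> = ennreal pi * emeasure lborel {0<..r}"
      by (rule nn_integral_cmult_indicator) auto
    also have "\<dots> = ennreal (pi * max 0 r)"
      by (cases "0 \<le> r") (simp_all add: ennreal_mult max_def)
    finally show ?thesis .
  qed
  show "emeasure ?M A = emeasure ?N A" if "A \<in> ?E" for A using that M N by auto
  show "range (\<lambda>i :: nat. {..real i}) \<subseteq> ?E" "countable (range (\<lambda>i :: nat. {..real i}))" by auto
  show "\<Union> (range (\<lambda>i :: nat. {..real i})) = UNIV" by (auto intro: real_arch_simple)
  show "emeasure ?M A \<noteq> \<infinity>" if "A \<in> range (\<lambda>i :: nat. {..real i})" for A using that M by auto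
qed

context radial_kernel_data begin

lemma radial_law_density:
  fixes \<phi> :: "real \<Rightarrow> real"
  assumes \<phi>0: "\<And>r. 0 \<le> r \<Longrightarrow> 0 \<le> \<phi> r" and \<phi>m [measurable]: "(\<lambda>z :: complex. \<phi> (cmod z)) \<in> borel_measurable borel"
    and \<mu>: "\<mu> = density lborel (\<lambda>z. ennreal (\<phi> (cmod z)))"
  shows "(\<lambda>q. ennreal (indicator {0<..} q * (pi * (a k)\<^sup>2 * q ^ k * \<phi> (sqrt q)))) \<in> borel_measurable borel"
    and "radial_law k = density lborel (\<lambda>q. ennreal (indicator {0<..} q * (pi * (a k)\<^sup>2 * q ^ k * \<phi> (sqrt q))))"
proof -
  let ?f = "\<lambda>q. ennreal (indicator {0<..} q * (pi * (a k)\<^sup>2 * q ^ k * \<phi> (sqrt q)))"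
  \<comment> \<open>Measurability is known for the function of the modulus only, hence the detour through the plane.\<close>
  define \<psi> where "\<psi> q = \<phi> (cmod (complex_of_real (sqrt q)))" for q
  have \<psi>m [measurable]: "\<psi> \<in> borel_measurable borel"
    unfolding \<psi>_def by (rule measurable_compose[OF _ \<phi>m]) measurable
  have \<psi>: "\<psi> q = \<phi> (sqrt q)" if "0 \<le> q" for q using that by (simp add: \<psi>_def)
  have \<psi>0: "0 \<le> \<psi> q" for q by (simp add: \<psi>_def \<phi>0)
  let ?g = "\<lambda>q. ennreal (\<psi> q * ((a k)\<^sup>2 * q ^ k))"
  have f_eq: "?f = (\<lambda>q. ennreal (pi * indicator {0<..} q) * ?g q)"
  proof
    fix q :: real
    show "?f q = ennreal (pi * indicator {0<..} q) * ?g q"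
      using \<psi>0[of q] by (cases "0 < q") (simp_all add: ennreal_mult[symmetric] \<psi> mult_ac)
  qed
  show "?f \<in> borel_measurable borel" unfolding f_eq by measurable
  have "density \<mu> (\<lambda>z. ennreal (eigen_density k z)) =
      density lborel (\<lambda>z. ennreal (\<phi> (cmod z)) * ennreal (eigen_density k z))"
    by (subst \<mu>) (rule density_density_eq; measurable)
  also have "\<dots> = density lborel (\<lambda>z. ?g ((cmod z)\<^sup>2))"
  proof (rule arg_cong[where f = "density lborel"], rule ext)
    fix z :: complex
    show "ennreal (\<phi> (cmod z)) * ennreal (eigen_density k z) = ?g ((cmod z)\<^sup>2)"
      using \<phi>0[of "cmod z"] by (simp add: ennreal_mult[symmetric] \<psi> power_mult)
  qed
  finally have "radial_law k = distr (density lborel (\<lambda>z :: complex. ?g ((cmod z)\<^sup>2))) borel (\<lambda>z. (cmod z)\<^sup>2)"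
    unfolding radial_law_def tilted_law_def by simp
  also have "\<dots> = density (distr lborel borel (\<lambda>z :: complex. (cmod z)\<^sup>2)) ?g"
    by (rule density_distr[symmetric]) measurable
  also have "\<dots> = density lborel ?f"
    unfolding distr_lborel_cmod_sq f_eq by (rule density_density_eq) measurable
  finally show "radial_law k = density lborel ?f" .
qed

lemma prob_space_tilted_law:
  assumes "enat k < n" shows "prob_space (tilted_law k)"
proof
  have i: "integrable \<mu> (\<lambda>z. eigen_density k z)" "(\<integral>z. eigen_density k z \<partial>\<mu>) = 1"
    using norm_1'[OF assms] unfolding has_bochner_integral_iff by auto
  have "emeasure (tilted_law k) (space (tilted_law k)) = (\<integral>\<^sup>+z. ennreal (eigen_density k z) \<partial>\<mu>)"
    unfolding tilted_law_def by (simp add: emeasure_density)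
  also have "\<dots> = ennreal (\<integral>z. eigen_density k z \<partial>\<mu>)"
    by (rule nn_integral_eq_integral[OF i(1)]) simp
  finally show "emeasure (tilted_law k) (space (tilted_law k)) = 1" by (simp only: i(2) ennreal_1)
qed

lemma tilted_law_0: "tilted_law 0 = scale_measure (1 / emeasure \<mu> UNIV) \<mu>"
  unfolding emeasure_UNIV_\<mu> tilted_law_def by (rule measure_eqI) (simp_all add: emeasure_density_const)

text \<open>
  The coins take the complex values \<open>0\<close> and \<open>1\<close>, so that they can share a product space with the points.
\<close>

definition coin_law :: "nat \<Rightarrow> complex measure" where
  "coin_law k = distr (measure_pmf (bernoulli_pmf (lam0 k))) borel of_bool"

text \<open>
  Coordinates with \<open>k \<ge> n\<close> are filled with an arbitrary probability measure.
\<close>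

definition coordinate_law :: "nat + nat \<Rightarrow> complex measure" where
  "coordinate_law = case_sum (\<lambda>k. if enat k < n then tilted_law k else tilted_law 0) coin_law"

lemma sets_coordinate_law [simp, measurable_cong]: "sets (coordinate_law j) = sets borel"
  by (cases j) (simp_all add: coordinate_law_def tilted_law_def coin_law_def)

lemma prob_space_coordinate_law: "prob_space (coordinate_law j)"
proof (cases j)
  case (Inl k)
  then show ?thesis using prob_space_tilted_law zero_less_n by (simp add: coordinate_law_def)
next
  case (Inr k)
  then show ?thesis
    by (simp add: coordinate_law_def coin_law_def prob_space.prob_space_distr[OF prob_space_measure_pmf])
qed

lemma coin_law_1:
  assumes "enat k < n" shows "measure (coin_law k) {1} = lam k"
proof -
  have l: "lam0 k \<in> {0..1}" using lam01[OF assms] assms by (simp add: lam0_def)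
  have "measure (coin_law k) {1} = measure (measure_pmf (bernoulli_pmf (lam0 k))) {True}"
    unfolding coin_law_def by (subst measure_distr) (auto simp: vimage_def intro!: arg_cong2[where f = measure] elim: of_bool_eq_1_iff[THEN iffD1])
  also have "\<dots> = lam k" using l assms by (simp add: measure_pmf_single lam0_def)
  finally show ?thesis .
qed

text \<open>
  Independent coordinates, one for each point and one for each coin, are provided by an infinite
  product; pairing the coordinates of equal index moves the construction to the required space.
\<close>

theorem ex_radial_construction:
  "\<exists>(P :: (nat \<Rightarrow> complex \<times> bool) measure) Z Q B. radial_construction \<mu> n lam a P Z Q B"
proof -
  let ?J = "{k. enat k < n} <+> {k. enat k < n}"
  define P0 where "P0 = (\<Pi>\<^sub>M j\<in>UNIV. coordinate_law j)"
  interpret P0: prob_space P0 unfolding P0_def by (intro prob_space_PiM prob_space_coordinate_law)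
  define pair where "pair = (\<lambda>(\<omega> :: nat + nat \<Rightarrow> complex) k. (\<omega> (Inl k), \<omega> (Inr k) = 1))"
  define S where "S = (\<Pi>\<^sub>M k\<in>(UNIV :: nat set). (borel :: complex measure) \<Otimes>\<^sub>M count_space (UNIV :: bool set))"
  define P where "P = distr P0 S pair"
  define Z where "Z = (\<lambda>\<omega> :: nat \<Rightarrow> complex \<times> bool. fst (\<omega> 0))"
  define Q where "Q = (\<lambda>k (\<omega> :: nat \<Rightarrow> complex \<times> bool). (cmod (fst (\<omega> k)))\<^sup>2)"
  define B where "B = (\<lambda>k (\<omega> :: nat \<Rightarrow> complex \<times> bool). snd (\<omega> k))"
  define Y where "Y = case_sum (\<lambda>_ :: nat. \<lambda>z :: complex. (cmod z)\<^sup>2) (\<lambda>_ :: nat. \<lambda>z. of_bool (z = 1))"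
  let ?X = "case_sum Q (\<lambda>k \<omega>. of_bool (B k \<omega>) :: real)"
  have coord: "(\<lambda>\<omega>. \<omega> j) \<in> P0 \<rightarrow>\<^sub>M coordinate_law j" for j
    unfolding P0_def by (rule measurable_component_singleton) simp
  then have coord' [measurable]: "(\<lambda>\<omega>. \<omega> j) \<in> borel_measurable P0" for j
    by (simp add: measurable_cong_sets[OF refl sets_coordinate_law])
  have coord_law: "distr P0 (coordinate_law j) (\<lambda>\<omega>. \<omega> j) = coordinate_law j" for j
    unfolding P0_def by (rule distr_PiM_component) (auto intro: prob_space_coordinate_law)
  have coord_law': "distr P0 borel (\<lambda>\<omega>. \<omega> j) = coordinate_law j" for j
    using coord_law[of j] by (metis (no_types, lifting) distr_cong sets_coordinate_law)
  have pair: "pair \<in> P0 \<rightarrow>\<^sub>M S"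
    unfolding S_def pair_def
  proof (rule measurable_PiM_single')
    fix k
    have "Measurable.pred P0 (\<lambda>\<omega>. \<omega> (Inr k) \<in> {1})" by (rule pred_sets2[OF _ coord']) simp
    then have "(\<lambda>\<omega>. \<omega> (Inr k) = 1) \<in> P0 \<rightarrow>\<^sub>M count_space UNIV" by simp
    with coord' show "(\<lambda>\<omega>. (\<omega> (Inl k), \<omega> (Inr k) = 1)) \<in> P0 \<rightarrow>\<^sub>M borel \<Otimes>\<^sub>M count_space UNIV"
      by (rule measurable_Pair)
  qed (auto simp: space_pair_measure)
  have fstS [measurable]: "(\<lambda>\<omega>. fst (\<omega> k)) \<in> borel_measurable S" and sndS [measurable]: "Measurable.pred S (\<lambda>\<omega>. snd (\<omega> k))" for k
    unfolding S_def by measurable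
  interpret P: prob_space P unfolding P_def by (rule P0.prob_space_distr[OF pair])
  have sets_P [measurable_cong]: "sets P = sets S" by (simp add: P_def)
  have law: "distr P N f = distr P0 N (\<lambda>\<omega>. f (pair \<omega>))" if "f \<in> S \<rightarrow>\<^sub>M N" for N :: "'x measure" and f
    unfolding P_def using distr_distr[OF that pair] by (simp add: comp_def)
  have X_pair: "?X j (pair \<omega>) = Y j (\<omega> j)" for j \<omega>
    by (cases j) (simp_all add: Q_def B_def Y_def pair_def)
  have Y_meas: "Y j \<in> borel_measurable borel" for j
    by (cases j) (simp_all add: Y_def)
  have X_meas: "?X j \<in> borel_measurable S" for j
    by (cases j) (simp_all add: Q_def B_def)
  have indep0: "P0.indep_vars (\<lambda>_. borel) (\<lambda>j \<omega>. Y j (\<omega> j)) ?J"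
  proof -
    have "P0.indep_vars coordinate_law (\<lambda>j \<omega>. \<omega> j) UNIV"
    proof (subst P0.indep_vars_iff_distr_eq_PiM'[OF _ coord])
      have "(\<lambda>x :: nat + nat \<Rightarrow> complex. \<lambda>j\<in>UNIV. x j) = (\<lambda>x. x)" by (simp add: restrict_def)
      then show "distr P0 (\<Pi>\<^sub>M j\<in>UNIV. coordinate_law j) (\<lambda>x. \<lambda>j\<in>UNIV. x j) =
          (\<Pi>\<^sub>M j\<in>UNIV. distr P0 (coordinate_law j) (\<lambda>\<omega>. \<omega> j))"
        unfolding coord_law P0_def[symmetric] by simp
    qed simp
    then have "P0.indep_vars (\<lambda>_. borel) (\<lambda>j \<omega>. Y j (\<omega> j)) UNIV"
    proof (rule P0.indep_vars_compose2)
      show "Y j \<in> borel_measurable (coordinate_law j)" for j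
        using Y_meas[of j] by (simp add: measurable_cong_sets[OF sets_coordinate_law refl])
    qed
    then show ?thesis by (rule P0.indep_vars_subset) simp
  qed
  have J: "?J \<noteq> {}" using zero_less_n by auto
  have indep: "P.indep_vars (\<lambda>_. borel) ?X ?J"
  proof (subst P.indep_vars_iff_distr_eq_PiM'[OF J])
    show X_meas': "?X j \<in> borel_measurable P" for j
      using X_meas[of j] by (simp add: measurable_cong_sets[OF sets_P refl])
    have "distr P (\<Pi>\<^sub>M j\<in>?J. borel) (\<lambda>x. \<lambda>j\<in>?J. ?X j x) =
        distr P0 (\<Pi>\<^sub>M j\<in>?J. borel) (\<lambda>x. \<lambda>j\<in>?J. Y j (x j))"
      by (subst law) (auto intro!: measurable_restrict X_meas simp: X_pair)
    also have "\<dots> = (\<Pi>\<^sub>M j\<in>?J. distr P0 borel (\<lambda>\<omega>. Y j (\<omega> j)))"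
      using indep0 by (subst (asm) P0.indep_vars_iff_distr_eq_PiM'[OF J])
        (auto intro: measurable_compose[OF coord' Y_meas])
    also have "\<dots> = (\<Pi>\<^sub>M j\<in>?J. distr P borel (?X j))"
      by (intro PiM_cong refl) (subst law[OF X_meas], simp add: X_pair)
    finally show "distr P (\<Pi>\<^sub>M j\<in>?J. borel) (\<lambda>x. \<lambda>j\<in>?J. ?X j x) =
        (\<Pi>\<^sub>M j\<in>?J. distr P borel (?X j))" .
  qed
  have Z_law: "distr P borel Z = scale_measure (1 / emeasure \<mu> UNIV) \<mu>"
  proof -
    have "distr P borel Z = distr P0 borel (\<lambda>\<omega>. \<omega> (Inl 0))"
      unfolding Z_def by (subst law) (simp_all add: pair_def)
    then show ?thesis using zero_less_n by (simp add: coord_law' coordinate_law_def tilted_law_0)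
  qed
  have Q_law: "distr P borel (Q k) = radial_law k" if "enat k < n" for k
  proof -
    have "distr P borel (Q k) = distr P0 borel (\<lambda>\<omega>. (cmod (\<omega> (Inl k)))\<^sup>2)"
      unfolding Q_def by (subst law) (simp_all add: pair_def)
    also have "\<dots> = distr (distr P0 borel (\<lambda>\<omega>. \<omega> (Inl k))) borel (\<lambda>z. (cmod z)\<^sup>2)"
      by (subst distr_distr) (simp_all add: comp_def)
    also have "\<dots> = radial_law k"
      using that by (simp add: coord_law' coordinate_law_def radial_law_def tilted_law_def)
    finally show ?thesis .
  qed
  have B_prob: "measure P {\<omega> \<in> space P. B k \<omega>} = lam k" if "enat k < n" for k
  proof -
    have "{\<omega> \<in> space S. B k \<omega>} \<in> sets S" unfolding B_def by measurable
    then have "measure P {\<omega> \<in> space P. B k \<omega>} = measure P0 (pair -` {\<omega> \<in> space S. B k \<omega>} \<inter> space P0)"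
      unfolding P_def using pair by (subst measure_distr) auto
    also have "pair -` {\<omega> \<in> space S. B k \<omega>} \<inter> space P0 = (\<lambda>\<omega>. \<omega> (Inr k)) -` {1} \<inter> space P0"
      using measurable_space[OF pair] by (auto simp: B_def pair_def)
    also have "measure P0 \<dots> = measure (distr P0 borel (\<lambda>\<omega>. \<omega> (Inr k))) {1}"
      by (rule measure_distr[symmetric]) auto
    also have "\<dots> = lam k" using that by (simp add: coord_law' coordinate_law_def coin_law_1)
    finally show ?thesis .
  qed
  have "radial_construction \<mu> n lam a P Z Q B"
    unfolding radial_construction_def
  proof (intro conjI allI impI ballI)
    show "prob_space P" by (rule P.prob_space_axioms)
    show "Z \<in> borel_measurable P" unfolding Z_def by measurable
    show "distr P borel Z = scale_measure (1 / emeasure \<mu> UNIV) \<mu>" by (rule Z_law)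
    show "Q 0 \<omega> = (cmod (Z \<omega>))\<^sup>2" for \<omega> by (simp add: Q_def Z_def)
    show "distr P borel (Q k) = density (distr P borel (Q (k - 1))) (\<lambda>q. ennreal ((a k)\<^sup>2 / (a (k - 1))\<^sup>2 * q))"
      if k: "1 \<le> k \<and> enat k < n" for k
    proof -
      obtain m where m: "k = Suc m" using k by (cases k) auto
      have mn: "enat m < n" using k unfolding m by (meson enat_ord_simps(2) lessI less_trans)
      show ?thesis using k radial_law_Suc[of m] unfolding m by (simp add: Q_law[OF mn] Q_law)
    qed
    show "measure P {\<omega> \<in> space P. B k \<omega>} = lam k" if "enat k < n" for k by (rule B_prob[OF that])
    show "P.indep_vars (\<lambda>_. borel) ?X ?J" by (rule indep)
  qed
  then show ?thesis by blast
qed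

end

section \<open>The squared moduli of a radial determinantal process\<close>

theorem theorem26:
  fixes M :: "'w measure" and X :: "'w \<Rightarrow> complex measure" and \<mu> :: "complex measure"
    and n :: enat and lam a :: "nat \<Rightarrow> real"
  assumes "n \<ge> 1"
    and "radially_symmetric \<mu>"
    and "determinantal_process M X \<mu> (radial_kernel n lam a)"
    and "\<And>k. enat k < n \<Longrightarrow> a k > 0"
    and "\<And>k. enat k < n \<Longrightarrow> lam k \<in> {0..1}"
    and "\<And>k. enat k < n \<Longrightarrow>
           normalized_eigenfunction \<mu> (radial_kernel n lam a) (complex_of_real (lam k))
             (\<lambda>z. complex_of_real (a k) * z ^ k)"
    and "lam summable_on {k. enat k < n}"
  shows "(\<exists>(P :: (nat \<Rightarrow> complex \<times> bool) measure) Z Q B. radial_construction \<mu> n lam a P Z Q B) \<and>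
    (\<forall>(P :: 's measure) Z Q B. radial_construction \<mu> n lam a P Z Q B \<longrightarrow>
       point_process_law M (\<lambda>\<omega>. distr (X \<omega>) borel (\<lambda>z. (cmod z)\<^sup>2)) =
         point_process_law P (thinned_process n Q B) \<and>
       (\<forall>\<phi> :: real \<Rightarrow> real.
          (\<forall>r\<ge>0. 0 \<le> \<phi> r) \<and> (\<lambda>z :: complex. \<phi> (cmod z)) \<in> borel_measurable borel \<and>
          \<mu> = density lborel (\<lambda>z. ennreal (\<phi> (cmod z))) \<longrightarrow>
          (\<forall>k. enat k < n \<longrightarrow>
             distributed P lborel (Q k)
               (\<lambda>q. ennreal (indicator {0<..} q * (pi * (a k)\<^sup>2 * q ^ k * \<phi> (sqrt q)))))))"
proof -
  interpret radial_kernel_data \<mu> n lam a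
  proof
    show "sets \<mu> = sets borel"
      using assms(3) by (simp add: determinantal_process_def radon_measure_def)
    show "has_bochner_integral \<mu> (\<lambda>z. (cmod (complex_of_real (a k) * z ^ k))\<^sup>2) 1" if "enat k < n" for k
      using assms(6)[OF that] unfolding normalized_eigenfunction_def by simp
  qed (use assms in auto)
  have process: "(\<lambda>\<omega>. distr (X \<omega>) borel (\<lambda>z. (cmod z)\<^sup>2)) = sq_modulus_process X"
    by (rule ext) (simp add: sq_modulus_process_def)
  show ?thesis
  proof (intro conjI allI impI)
    show "\<exists>(P :: (nat \<Rightarrow> complex \<times> bool) measure) Z Q B. radial_construction \<mu> n lam a P Z Q B"
      by (rule ex_radial_construction)
    fix P :: "'s measure" and Z Q B
    assume rc: "radial_construction \<mu> n lam a P Z Q B"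
    show "point_process_law M (\<lambda>\<omega>. distr (X \<omega>) borel (\<lambda>z. (cmod z)\<^sup>2)) =
        point_process_law P (thinned_process n Q B)"
      unfolding process point_process_law_def by (rule law_sq_modulus_eq_thinned[OF assms(3) rc])
    fix \<phi> :: "real \<Rightarrow> real" and k
    assume \<phi>: "(\<forall>r\<ge>0. 0 \<le> \<phi> r) \<and> (\<lambda>z :: complex. \<phi> (cmod z)) \<in> borel_measurable borel \<and>
          \<mu> = density lborel (\<lambda>z. ennreal (\<phi> (cmod z)))"
      and k: "enat k < n"
    have "distr P lborel (Q k) = distr P borel (Q k)" by (rule distr_cong) simp_all
    also have "\<dots> = radial_law k" by (rule law_Q[OF rc k])
    finally show "distributed P lborel (Q k)
        (\<lambda>q. ennreal (indicator {0<..} q * (pi * (a k)\<^sup>2 * q ^ k * \<phi> (sqrt q))))"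
      unfolding distributed_def
      using radial_law_density[of \<phi> k] \<phi> radial_construction_measurable(1)[OF rc k] by simp
  qed
qed

end
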